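(* Let $n\ge 2$, let $\Omega\subset\mathbb{C}^n$ be a bounded $\mathbb{C}$-convex domain and let $\mathcal{S}\neq\varnothing$ be a finite family of complex affine hyperplanes of $\mathbb{C}^n$, each intersecting $\Omega$. Then $(\Omega\setminus\bigcup\mathcal{S},\,k_{\Omega\setminus\bigcup\mathcal{S}})$ is not Gromov hyperbolic.
   Context: A domain is a non-empty connected open set. A domain $\Omega\subset\mathbb{C}^n$ is $\mathbb{C}$-convex if every non-empty intersection of $\Omega$ with a complex affine line is a simply connected domain (in that line). Let $\mathbb{D}=\{\lambda\in\mathbb{C}:|\lambda|<1\}$. For a domain $G\subset\mathbb{C}^n$ the Kobayashi pseudometric is $\kappa_G(z;X)=\inf\{|\lambda|:\text{there is a holomorphic } f:\mathbb{D}\to G \text{ with } f(0)=z,\ \lambda f'(0)=X\}$ for $z\in G$, $X\in\mathbb{C}^n$. The Kobayashi pseudodistance is $k_G(p,q)=\inf_\alpha\int_0^1\kappa_G(\alpha(t);\alpha'(t))\,dt$, the infimum over all piecewise $\mathcal{C}^1$ curves $\alpha:[0,1]\to G$ with $\alpha(0)=p$, $\alpha(1)=q$. It is a distance if $G$ is bounded. In a metric space $(X,d)$ a curve $\alpha:[a,b]\to X$ is a geodesic if $d(\alpha(s),\alpha(t))=|s-t|$ for all $s,t\in[a,b]$. A geodesic triangle is a choice of three points together with geodesic segments joining them pairwise; it is $M$-thin if every point on any side is within distance $M$ of the union of the other two sides. A geodesic metric space is Gromov hyperbolic if there is $M>0$ such that every geodesic triangle is $M$-thin. "Not Gromov hyperbolic"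 means that for every $M>0$ there is a geodesic triangle that is not $M$-thin. *)

theory Defs
  imports "HOL-Complex_Analysis.Complex_Analysis"
begin

definition complex_line :: "(complex ^ 'n) set \<Rightarrow> bool" where
  "complex_line L \<longleftrightarrow> (\<exists>p v. v \<noteq> 0 \<and> L = {p + c *s v | c. True})"

definition complex_hyperplane :: "(complex ^ 'n) set \<Rightarrow> bool" where
  "complex_hyperplane H \<longleftrightarrow> (\<exists>a b. a \<noteq> 0 \<and> H = {z. (\<Sum>i\<in>UNIV. a $ i * z $ i) = b})"

definition domain_in :: "'a::topological_space set \<Rightarrow> 'a set \<Rightarrow> bool" where
  "domain_in V U \<longleftrightarrow> openin (top_of_set V) U \<and> connected U \<and> U \<noteq> {}"

definition C_convex_domain :: "(complex ^ 'n) set \<Rightarrow> bool" where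
  "C_convex_domain \<Omega> \<longleftrightarrow> domain_in UNIV \<Omega> \<and>
     (\<forall>L. complex_line L \<and> \<Omega> \<inter> L \<noteq> {} \<longrightarrow>
        domain_in L (\<Omega> \<inter> L) \<and> simply_connected (\<Omega> \<inter> L))"

definition holomorphic_disc :: "(complex \<Rightarrow> complex ^ 'n) \<Rightarrow> (complex ^ 'n) set \<Rightarrow> bool" where
  "holomorphic_disc f G \<longleftrightarrow>
     (\<forall>i. (\<lambda>\<zeta>. f \<zeta> $ i) holomorphic_on ball 0 1) \<and> f ` ball 0 1 \<subseteq> G"

definition kobayashi_metric ::
  "(complex ^ 'n) set \<Rightarrow> complex ^ 'n \<Rightarrow> complex ^ 'n \<Rightarrow> real" where
  "kobayashi_metric G z X =
     Inf {cmod c | c f. holomorphic_disc f G \<and> f 0 = z \<and>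
                        c *s (\<chi> i. deriv (\<lambda>\<zeta>. f \<zeta> $ i) 0) = X}"

text \<open>Here the derivative is required to extend continuously to the end points of each piece.
  The library's \<^const>\<open>piecewise_C1_differentiable_on\<close> does not require this and admits curves
  of infinite length.\<close>

definition piecewise_C1_curve :: "(real \<Rightarrow> 'a::real_normed_vector) \<Rightarrow> bool" where
  "piecewise_C1_curve \<alpha> \<longleftrightarrow>
     (\<exists>T. finite T \<and> {0, 1} \<subseteq> T \<and> T \<subseteq> {0..1} \<and>
        (\<forall>a\<in>T. \<forall>b\<in>T. a < b \<and> {a<..<b} \<inter> T = {} \<longrightarrow>
           (\<exists>D. continuous_on {a..b} D \<and>
              (\<forall>t\<in>{a..b}. (\<alpha> has_vector_derivative D t) (at t within {a..b})))))"

text \<open>At the finitely many break points \<^const>\<open>vector_derivative\<close> may be a junk value; this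
  does not affect the integral.\<close>

definition kobayashi_length :: "(complex ^ 'n) set \<Rightarrow> (real \<Rightarrow> complex ^ 'n) \<Rightarrow> ennreal" where
  "kobayashi_length G \<alpha> =
     (\<integral>\<^sup>+t\<in>{0..1}. ennreal (kobayashi_metric G (\<alpha> t)
                       (vector_derivative \<alpha> (at t within {0..1}))) \<partial>lborel)"

text \<open>When \<open>G\<close> is a domain and \<open>p\<close>, \<open>q\<close> lie in \<open>G\<close>, the infimum is finite, so
  \<^const>\<open>enn2real\<close> loses nothing.\<close>

definition kobayashi_dist ::
  "(complex ^ 'n) set \<Rightarrow> complex ^ 'n \<Rightarrow> complex ^ 'n \<Rightarrow> real" where
  "kobayashi_dist G p q =
     enn2real (INF \<alpha>\<in>{\<alpha>. piecewise_C1_curve \<alpha> \<and> \<alpha> ` {0..1} \<subseteq> G \<and> \<alpha> 0 = p \<and> \<alpha> 1 = q}.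
                 kobayashi_length G \<alpha>)"

definition geodesic_on :: "'a set \<Rightarrow> ('a \<Rightarrow> 'a \<Rightarrow> real) \<Rightarrow> real \<Rightarrow> real \<Rightarrow> (real \<Rightarrow> 'a) \<Rightarrow> bool" where
  "geodesic_on X d a b \<alpha> \<longleftrightarrow>
     a \<le> b \<and> \<alpha> ` {a..b} \<subseteq> X \<and> (\<forall>s\<in>{a..b}. \<forall>t\<in>{a..b}. d (\<alpha> s) (\<alpha> t) = \<bar>s - t\<bar>)"

definition geodesic_segment :: "'a set \<Rightarrow> ('a \<Rightarrow> 'a \<Rightarrow> real) \<Rightarrow> 'a \<Rightarrow> 'a \<Rightarrow> 'a set \<Rightarrow> bool" where
  "geodesic_segment X d x y A \<longleftrightarrow>
     (\<exists>a b \<alpha>. geodesic_on X d a b \<alpha> \<and> \<alpha> a = x \<and> \<alpha> b = y \<and> A = \<alpha> ` {a..b})"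

definition geodesic_triangle ::
  "'a set \<Rightarrow> ('a \<Rightarrow> 'a \<Rightarrow> real) \<Rightarrow> 'a set \<Rightarrow> 'a set \<Rightarrow> 'a set \<Rightarrow> bool" where
  "geodesic_triangle X d A B C \<longleftrightarrow>
     (\<exists>x\<in>X. \<exists>y\<in>X. \<exists>z\<in>X. geodesic_segment X d x y A \<and> geodesic_segment X d y z B \<and>
        geodesic_segment X d z x C)"

definition within_dist :: "('a \<Rightarrow> 'a \<Rightarrow> real) \<Rightarrow> real \<Rightarrow> 'a set \<Rightarrow> 'a set \<Rightarrow> bool" where
  "within_dist d M A B \<longleftrightarrow> (\<forall>p\<in>A. \<exists>q\<in>B. d p q \<le> M)"

definition thin_triangle :: "('a \<Rightarrow> 'a \<Rightarrow> real) \<Rightarrow> real \<Rightarrow> 'a set \<Rightarrow> 'a set \<Rightarrow> 'a set \<Rightarrow> bool" where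
  "thin_triangle d M A B C \<longleftrightarrow>
     within_dist d M A (B \<union> C) \<and> within_dist d M B (C \<union> A) \<and> within_dist d M C (A \<union> B)"

text \<open>That \<open>(X, d)\<close> is a geodesic metric space is deliberately not a conjunct: the negation must
  say that for every \<open>M > 0\<close> some geodesic triangle is not \<open>M\<close>-thin.\<close>

definition Gromov_hyperbolic :: "'a set \<Rightarrow> ('a \<Rightarrow> 'a \<Rightarrow> real) \<Rightarrow> bool" where
  "Gromov_hyperbolic X d \<longleftrightarrow>
     (\<exists>M>0. \<forall>A B C. geodesic_triangle X d A B C \<longrightarrow> thin_triangle d M A B C)"

end

theory Submission
  imports Defs
begin

text \<open>Let \<open>G\<close> be the complement of the hyperplanes in \<open>\<Omega>\<close>. A \<open>\<complex>\<close>-convex domain is linearly convex: if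
  every complex line of a plane through a point outside \<open>\<Omega>\<close> met \<open>\<Omega>\<close>, then the simply connected slices
  would give a trivialisation of the tautological bundle of the projective line. So every point \<open>q\<close>
  outside \<open>G\<close> lies on an affine hyperplane \<open>m = 0\<close> missing \<open>G\<close>. Comparing \<open>G\<close> with a punctured disc by
  \<open>m\<close> shows that \<open>ln (ln (R / \<bar>m\<bar>)) / 2\<close> is 1-Lipschitz for the Kobayashi distance. It tends to infinity
  at \<open>q\<close>, so closed balls are compact and geodesics exist.

  Take a complex line \<open>L\<close> in a hyperplane \<open>H\<close> of the family, not contained in the other ones. Over each
  point of \<open>L \<inter> \<Omega>\<close> off the other hyperplanes there is a cusp of \<open>G\<close> along \<open>H\<close>, and it carries a ray which
  is geodesic up to an additive constant; any two such rays stay at bounded distance. By hyperbolicity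
  they come within a distance depending on the thinness constant only. But the function
  \<open>ln (ln (R / \<bar>m\<bar>)) / 2\<close> of a boundary point of \<open>L \<inter> \<Omega>\<close> is unbounded on \<open>L \<inter> \<Omega>\<close>, so the distance
  between two rays can be made arbitrarily large.\<close>

text \<open>The two rays must be asymptotic and yet far apart. Points over neighbouring base points
  at equal height above \<open>H\<close> differ by a vector parallel to \<open>H\<close>; affine
  discs in that direction miss \<open>H\<close> however low they lie, so the distance between the
  rays stays bounded. This bound depends on the base points, but thinness replaces it by
  \<open>8 * M + 4\<close>, which does not. The opposing lower bound uses a height function that is
  continuous across \<open>H\<close>, so along each ray it converges to its value at the base point.
  Hence the second base point can be chosen after \<open>M\<close>, close to the boundary. Dimension
  at least 2 enters because \<open>H\<close> must contain a line; the slice of \<Omega> by it is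
  bounded and so has a boundary point.

  For linear convexity, a linear coordinate without zeros on a simply connected slice has a
  logarithm. Two logarithms over a connected set of lines differ by a constant, so local ones glue
  over a rectangle of latitudes and longitudes. Running through all longitudes then changes the
  logarithm differently at the two poles, which is impossible.\<close>

unbundle no fps_syntax

section \<open>Estimates for the Kobayashi metric\<close>

text \<open>The pairing of \<open>complex_hyperplane\<close>, without conjugation:
  \<open>cform a\<close> is complex linear, so its composition with a holomorphic disc is
  holomorphic.\<close>

definition cform :: "complex ^ 'n \<Rightarrow> complex ^ 'n \<Rightarrow> complex" where
  "cform a z = (\<Sum>i\<in>UNIV. a $ i * z $ i)"

lemma cform_zero [simp]: "cform a 0 = 0"
  by (simp add: cform_def)

lemma cform_add [simp]: "cform a (x + y) = cform a x + cform a y"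
  by (simp add: cform_def algebra_simps sum.distrib)

lemma cform_diff [simp]: "cform a (x - y) = cform a x - cform a y"
  by (simp add: cform_def algebra_simps sum_subtractf)

lemma cform_smult [simp]: "cform a (c *s x) = c * cform a x"
  by (simp add: cform_def algebra_simps sum_distrib_left)

lemma cform_scaleR [simp]: "cform a (r *\<^sub>R x) = r *\<^sub>R cform a x"
  by (simp add: cform_def scaleR_sum_right)

lemma cform_axis [simp]: "cform (axis i c) z = c * z $ i"
proof -
  have "axis i c $ j * z $ j = (if j = i then c * z $ i else 0)" for j
    by (simp add: axis_def)
  then show ?thesis by (simp add: cform_def)
qed

lemma cform_axis_right [simp]: "cform a (axis i c) = a $ i * c"
  by (simp add: cform_def axis_def if_distrib sum.delta cong: if_cong)

lemma bounded_linear_cform: "bounded_linear (cform a)"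
proof -
  have "linear (cform a)" by (rule linearI) auto
  then show ?thesis by (simp add: linear_conv_bounded_linear)
qed

lemmas continuous_on_cform [continuous_intros] = bounded_linear.continuous_on[OF bounded_linear_cform]

lemma bounded_cform:
  assumes "bounded S"
  obtains R where "0 < R" "\<And>z. z \<in> S \<Longrightarrow> cmod (cform a z - b) < R"
proof -
  have "bounded ((\<lambda>z. cform a z - b) ` S)"
    using bounded_linear_image[OF assms bounded_linear_cform] bounded_translation[of "cform a ` S" "- b"]
    by (simp add: image_image)
  then obtain B where B: "\<forall>x\<in>(\<lambda>z. cform a z - b) ` S. cmod x \<le> B" "B > 0" using bounded_pos by metis
  show ?thesis using B by (intro that[of "B + 1"]) force+
qed

text \<open>Schwarz-Pick for the punctured disc: lift to the left half-plane by a logarithm, move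
  the base point to 0 by a Cayley transform and apply the Schwarz lemma.
  \<open>2 * r * ln (1 / r)\<close> is the reciprocal of the hyperbolic density at modulus
  \<open>r\<close>, normalised to 1 at the centre of the unit disc.\<close>

lemma norm_deriv_punctured_disc_le:
  assumes hol: "\<phi> holomorphic_on ball 0 1"
    and \<phi>: "\<And>\<zeta>. \<zeta> \<in> ball 0 1 \<Longrightarrow> \<phi> \<zeta> \<noteq> 0 \<and> cmod (\<phi> \<zeta>) < 1"
  shows "cmod (deriv \<phi> 0) \<le> 2 * cmod (\<phi> 0) * ln (1 / cmod (\<phi> 0))"
proof -
  obtain \<psi> where hol\<psi>: "\<psi> holomorphic_on ball 0 1" and \<psi>: "\<And>\<zeta>. \<zeta> \<in> ball 0 1 \<Longrightarrow> \<phi> \<zeta> = exp (\<psi> \<zeta>)"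
    using contractible_imp_holomorphic_log[OF hol] \<phi>
    by (metis convex_ball convex_imp_contractible)
  have Re: "Re (\<psi> \<zeta>) < 0" if "\<zeta> \<in> ball 0 1" for \<zeta>
    using \<phi>[OF that] \<psi>[OF that] by simp
  define w where "w = \<psi> 0"
  have w: "Re w < 0" using Re by (simp add: w_def)
  \<comment> \<open>\<open>- cnj w\<close> is the mirror image of \<open>w\<close> in the imaginary
    axis; points to the left of the axis are nearer to \<open>w\<close>.\<close>
  have lt: "cmod (v - w) < cmod (v + cnj w)" if "Re v < 0" for v
  proof -
    have "(cmod (v + cnj w))\<^sup>2 - (cmod (v - w))\<^sup>2 = 4 * (Re v * Re w)"
      by (simp add: cmod_power2) (simp add: power2_eq_square algebra_simps)
    moreover have "Re v * Re w > 0" using that w by (simp add: mult_neg_neg)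
    ultimately have "(cmod (v - w))\<^sup>2 < (cmod (v + cnj w))\<^sup>2" by linarith
    then show ?thesis by (rule power_less_imp_less_base) simp
  qed
  have nz: "\<psi> \<zeta> + cnj w \<noteq> 0" if "\<zeta> \<in> ball 0 1" for \<zeta>
    using lt[OF Re[OF that]] by auto
  define F where "F = (\<lambda>\<zeta>. (\<psi> \<zeta> - w) / (\<psi> \<zeta> + cnj w))"
  have "F holomorphic_on ball 0 1"
    unfolding F_def using nz by (intro holomorphic_intros hol\<psi>) auto
  moreover have "F 0 = 0" by (simp add: F_def w_def)
  moreover have "cmod (F z) < 1" if "cmod z < 1" for z
    using lt[OF Re[of z]] nz[of z] that by (simp add: F_def norm_divide divide_simps)
  ultimately have F': "cmod (deriv F 0) \<le> 1" using Schwarz_Lemma(2)[of F 0] by simp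
  have D\<psi>: "(\<psi> has_field_derivative deriv \<psi> 0) (at 0)"
    using hol\<psi> holomorphic_derivI[OF hol\<psi>] by simp
  have ww: "w + cnj w = 2 * Re w" by (simp add: complex_eq_iff)
  have "(F has_field_derivative (deriv \<psi> 0 * (w + cnj w) - (w - w) * deriv \<psi> 0) / ((w + cnj w) * (w + cnj w))) (at 0)"
    unfolding F_def w_def using nz[of 0] 
    by (auto intro!: derivative_eq_intros D\<psi> simp: w_def)
  then have "deriv F 0 = deriv \<psi> 0 / (2 * Re w)"
    using w by (simp add: DERIV_imp_deriv ww power2_eq_square[symmetric] divide_simps)
  then have \<psi>': "cmod (deriv \<psi> 0) \<le> 2 * (- Re w)"
    using F' w by (simp add: norm_divide norm_mult neg_le_divide_eq)
  have "((\<lambda>\<zeta>. exp (\<psi> \<zeta>)) has_field_derivative exp (\<psi> 0) * deriv \<psi> 0) (at 0)"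
    by (auto intro!: derivative_eq_intros D\<psi>)
  then have "(\<phi> has_field_derivative exp (\<psi> 0) * deriv \<psi> 0) (at 0)"
    by (rule has_field_derivative_transform_within_open[where S = "ball 0 1"]) (auto simp: \<psi>)
  then have "deriv \<phi> 0 = \<phi> 0 * deriv \<psi> 0" by (simp add: DERIV_imp_deriv \<psi>)
  moreover have "ln (1 / cmod (\<phi> 0)) = - Re w" by (simp add: \<psi> w_def ln_div)
  ultimately show ?thesis using mult_left_mono[OF \<psi>', of "cmod (\<phi> 0)"] by (simp add: norm_mult algebra_simps)
qed

lemma kobayashi_metric_le:
  assumes "holomorphic_disc f G" "f 0 = z" "c *s (\<chi> i. deriv (\<lambda>\<zeta>. f \<zeta> $ i) 0) = X"
  shows "kobayashi_metric G z X \<le> cmod c"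
  unfolding kobayashi_metric_def
  by (rule cInf_lower) (use assms in \<open>auto intro!: bdd_belowI[of _ 0]\<close>)

lemma holomorphic_disc_affine:
  assumes "\<And>\<zeta>. cmod \<zeta> < 1 \<Longrightarrow> z + \<zeta> *s Y \<in> G"
  shows "holomorphic_disc (\<lambda>\<zeta>. z + \<zeta> *s Y) G" "(\<chi> i. deriv (\<lambda>\<zeta>. (z + \<zeta> *s Y) $ i) 0) = Y"
proof -
  show "holomorphic_disc (\<lambda>\<zeta>. z + \<zeta> *s Y) G"
    using assms unfolding holomorphic_disc_def by (auto intro!: holomorphic_intros)
  have "((\<lambda>\<zeta>. (z + \<zeta> *s Y) $ i) has_field_derivative Y $ i) (at 0)" for i
    by (auto intro!: derivative_eq_intros)
  then show "(\<chi> i. deriv (\<lambda>\<zeta>. (z + \<zeta> *s Y) $ i) 0) = Y"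
    by (simp add: DERIV_imp_deriv vec_eq_iff)
qed

lemma norm_smult: "norm (c *s x) = cmod c * norm (x :: complex ^ 'n)"
  by (simp add: norm_vec_def norm_mult L2_set_right_distrib)

text \<open>A small affine disc shows that the infimum runs over a non-empty set; \<open>Inf\<close>
  of the empty set would be unspecified.\<close>

lemma kobayashi_metric_witness:
  assumes "open G" "z \<in> G"
  obtains c f where "holomorphic_disc f G" "f 0 = z" "c *s (\<chi> i. deriv (\<lambda>\<zeta>. f \<zeta> $ i) 0) = X"
proof -
  obtain r where r: "r > 0" "ball z r \<subseteq> G" using assms open_contains_ball by blast
  define \<delta> where "\<delta> = r / (norm X + 1)"
  have \<delta>: "\<delta> > 0" "\<delta> * norm X < r" using r by (auto simp: \<delta>_def field_simps add_strict_increasing)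
  have disc: "z + \<zeta> *s (complex_of_real \<delta> *s X) \<in> G" if "cmod \<zeta> < 1" for \<zeta>
  proof -
    have "norm (\<zeta> *s (complex_of_real \<delta> *s X)) \<le> 1 * (\<delta> * norm X)"
      unfolding norm_smult using that \<delta> by (intro mult_mono) auto
    then show ?thesis using \<delta> r(2) by (auto simp: dist_norm subset_iff)
  qed
  show ?thesis
  proof (rule that)
    show "holomorphic_disc (\<lambda>\<zeta>. z + \<zeta> *s (complex_of_real \<delta> *s X)) G"
      by (rule holomorphic_disc_affine(1)[OF disc])
    show "z + 0 *s (complex_of_real \<delta> *s X) = z" by simp
    show "(1 / complex_of_real \<delta>) *s (\<chi> i. deriv (\<lambda>\<zeta>. (z + \<zeta> *s (complex_of_real \<delta> *s X)) $ i) 0) = X"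
      by (subst holomorphic_disc_affine(2)[OF disc]) (use \<delta> in simp_all)
  qed
qed

lemma kobayashi_metric_ge:
  assumes "open G" "z \<in> G"
    and "\<And>c f. holomorphic_disc f G \<Longrightarrow> f 0 = z \<Longrightarrow> c *s (\<chi> i. deriv (\<lambda>\<zeta>. f \<zeta> $ i) 0) = X \<Longrightarrow> B \<le> cmod c"
  shows "B \<le> kobayashi_metric G z X"
  unfolding kobayashi_metric_def
proof (rule cInf_greatest)
  obtain c f where "holomorphic_disc f G" "f 0 = z" "c *s (\<chi> i. deriv (\<lambda>\<zeta>. f \<zeta> $ i) 0) = X"
    using kobayashi_metric_witness[OF assms(1,2)] .
  then have "cmod c \<in> {cmod c |c f. holomorphic_disc f G \<and> f 0 = z \<and> c *s (\<chi> i. deriv (\<lambda>\<zeta>. f \<zeta> $ i) 0) = X}"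
    by (intro CollectI exI[of _ c] exI[of _ f]) simp
  then show "{cmod c |c f. holomorphic_disc f G \<and> f 0 = z \<and> c *s (\<chi> i. deriv (\<lambda>\<zeta>. f \<zeta> $ i) 0) = X} \<noteq> {}"
    by (metis empty_iff)
qed (use assms(3) in blast)

lemma kobayashi_metric_nonneg: "open G \<Longrightarrow> z \<in> G \<Longrightarrow> 0 \<le> kobayashi_metric G z X"
  by (rule kobayashi_metric_ge) auto

lemma kobayashi_metric_scaleR:
  assumes "open G" "z \<in> G" "t \<noteq> 0"
  shows "kobayashi_metric G z (t *\<^sub>R X) = \<bar>t\<bar> * kobayashi_metric G z X"
proof -
  have le: "kobayashi_metric G z (t *\<^sub>R X) \<le> \<bar>t\<bar> * kobayashi_metric G z X" if "t \<noteq> 0" for t X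
  proof -
    have "kobayashi_metric G z (t *\<^sub>R X) / \<bar>t\<bar> \<le> kobayashi_metric G z X"
    proof (rule kobayashi_metric_ge[OF assms(1,2)])
      fix c f assume *: "holomorphic_disc f G" "f 0 = z" "c *s (\<chi> i. deriv (\<lambda>\<zeta>. f \<zeta> $ i) 0) = X"
      have "(complex_of_real t * c) *s (\<chi> i. deriv (\<lambda>\<zeta>. f \<zeta> $ i) 0) = t *\<^sub>R X"
        using *(3) by (auto simp: vec_eq_iff scaleR_conv_of_real[where 'a = complex] mult.assoc)
      from kobayashi_metric_le[OF *(1,2) this]
      show "kobayashi_metric G z (t *\<^sub>R X) / \<bar>t\<bar> \<le> cmod c"
        using that by (simp add: norm_mult divide_simps mult.commute)
    qed
    then show ?thesis using that by (simp add: divide_simps mult.commute)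
  qed
  show ?thesis
  proof (rule antisym)
    have "kobayashi_metric G z X \<le> 1 / \<bar>t\<bar> * kobayashi_metric G z (t *\<^sub>R X)"
      using le[of "1 / t" "t *\<^sub>R X"] assms(3) by simp
    then show "\<bar>t\<bar> * kobayashi_metric G z X \<le> kobayashi_metric G z (t *\<^sub>R X)"
      using assms(3) by (simp add: pos_le_divide_eq mult.commute)
  qed (rule le[OF assms(3)])
qed

text \<open>The affine functional divided by \<open>R\<close> maps every disc in \<open>G\<close>
  into the punctured unit disc, and \<open>norm_deriv_punctured_disc_le\<close> applies to the
  composition.\<close>

lemma kobayashi_metric_ge_punctured:
  assumes "open G" "z \<in> G" and m: "\<And>x. x \<in> G \<Longrightarrow> cform a x \<noteq> b \<and> cmod (cform a x - b) < R"
  shows "cmod (cform a X) / (2 * cmod (cform a z - b) * ln (R / cmod (cform a z - b))) \<le> kobayashi_metric G z X"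
proof (rule kobayashi_metric_ge[OF assms(1,2)])
  fix c f assume *: "holomorphic_disc f G" "f 0 = z" "c *s (\<chi> i. deriv (\<lambda>\<zeta>. f \<zeta> $ i) 0) = X"
  define Y where "Y = (\<chi> i. deriv (\<lambda>\<zeta>. f \<zeta> $ i) 0)"
  have mz: "cform a z \<noteq> b" "cmod (cform a z - b) < R" using m[OF assms(2)] by auto
  then have R: "R > 0" by (smt (verit) norm_ge_zero)
  define \<phi> where "\<phi> = (\<lambda>\<zeta>. (cform a (f \<zeta>) - b) / R)"
  have hol: "(\<lambda>\<zeta>. f \<zeta> $ i) holomorphic_on ball 0 1" and fG: "\<zeta> \<in> ball 0 1 \<Longrightarrow> f \<zeta> \<in> G" for i \<zeta>
    using *(1) unfolding holomorphic_disc_def by auto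
  have "\<phi> holomorphic_on ball 0 1"
    unfolding \<phi>_def cform_def using R by (intro holomorphic_intros hol) auto
  moreover have "\<phi> \<zeta> \<noteq> 0 \<and> cmod (\<phi> \<zeta>) < 1" if "\<zeta> \<in> ball 0 1" for \<zeta>
    using m[OF fG[OF that]] R by (simp add: \<phi>_def norm_divide)
  ultimately have le: "cmod (deriv \<phi> 0) \<le> 2 * cmod (\<phi> 0) * ln (1 / cmod (\<phi> 0))"
    by (rule norm_deriv_punctured_disc_le)
  have D: "((\<lambda>\<zeta>. f \<zeta> $ i) has_field_derivative Y $ i) (at 0)" for i
    using holomorphic_derivI[OF hol[of i]] by (simp add: Y_def)
  have "(\<phi> has_field_derivative (\<Sum>i\<in>UNIV. a $ i * Y $ i) / R) (at 0)"
    unfolding \<phi>_def cform_def using R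
    by (auto intro!: derivative_eq_intros D DERIV_cmult simp: mult.commute)
  then have "deriv \<phi> 0 = cform a Y / R" by (simp add: DERIV_imp_deriv cform_def)
  then have "cmod (cform a Y) \<le> 2 * cmod (cform a z - b) * ln (R / cmod (cform a z - b))" (is "_ \<le> ?K")
  proof -
    have \<phi>0: "cmod (\<phi> 0) = cmod (cform a z - b) / R" using R by (simp add: \<phi>_def *(2) norm_divide)
    have "cmod (cform a Y) = R * cmod (deriv \<phi> 0)"
      using R \<open>deriv \<phi> 0 = cform a Y / R\<close> by (simp add: norm_divide)
    also have "\<dots> \<le> R * (2 * cmod (\<phi> 0) * ln (1 / cmod (\<phi> 0)))"
      using le R by (intro mult_left_mono) auto
    also have "\<dots> = ?K" using R by (simp add: \<phi>0)
    finally show ?thesis .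
  qed
  moreover have "cmod (cform a X) = cmod c * cmod (cform a Y)"
    using *(3)[folded Y_def] by (auto simp: norm_mult)
  ultimately have "cmod (cform a X) \<le> cmod c * ?K"
    by (simp add: mult_left_mono)
  moreover have "?K > 0" using mz R by (intro mult_pos_pos ln_gt_zero) auto
  ultimately show "cmod (cform a X) / ?K \<le> cmod c" by (simp add: divide_simps)
qed

section \<open>Lower integrals and piecewise smooth curves\<close>

text \<open>The Kobayashi metric is not known to be measurable here, and \<^const>\<open>nn_integral\<close> of a
  non-measurable function is its lower integral. Additivity over functions then fails, but the
  substitution rule and additivity over disjoint sets survive.\<close>

lemma nn_integral_affine_substitution:
  fixes F :: "real \<Rightarrow> ennreal"
  assumes "c \<noteq> 0"
  shows "(\<integral>\<^sup>+x. F x \<partial>lborel) = (\<integral>\<^sup>+x. ennreal \<bar>c\<bar> * F (t + c * x) \<partial>lborel)"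
proof -
  have le: "(\<integral>\<^sup>+x. F x \<partial>lborel) \<le> (\<integral>\<^sup>+x. ennreal \<bar>c\<bar> * F (t + c * x) \<partial>lborel)"
    if c: "c \<noteq> 0" for F :: "real \<Rightarrow> ennreal" and c t
    unfolding nn_integral_def[of lborel F]
  proof (rule SUP_least)
    fix g assume "g \<in> {g. simple_function lborel g \<and> g \<le> F}"
    then have g: "simple_function lborel g" "\<And>x. g x \<le> F x" by (auto simp: le_fun_def)
    then have [measurable]: "g \<in> borel_measurable borel"
      using borel_measurable_simple_function by fastforce
    have "integral\<^sup>S lborel g = (\<integral>\<^sup>+x. g x \<partial>lborel)" by (rule nn_integral_eq_simple_integral[symmetric, OF g(1)])
    also have "\<dots> = (\<integral>\<^sup>+x. ennreal \<bar>c\<bar> * g (t + c * x) \<partial>lborel)"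
      by (subst nn_integral_real_affine[OF _ c, of g t]) (auto simp: nn_integral_cmult)
    also have "\<dots> \<le> (\<integral>\<^sup>+x. ennreal \<bar>c\<bar> * F (t + c * x) \<partial>lborel)"
      by (intro nn_integral_mono mult_left_mono g) auto
    finally show "integral\<^sup>S lborel g \<le> (\<integral>\<^sup>+x. ennreal \<bar>c\<bar> * F (t + c * x) \<partial>lborel)" .
  qed
  \<comment> \<open>The reverse inequality will be \<open>le\<close> for the inverse
    substitution.\<close>
  have "ennreal \<bar>1 / c\<bar> * (ennreal \<bar>c\<bar> * F (t + c * (- t / c + (1 / c) * x))) = F x" for x
  proof -
    have "t + c * (- t / c + (1 / c) * x) = x" using assms by (simp add: field_simps)
    moreover have "ennreal \<bar>1 / c\<bar> * ennreal \<bar>c\<bar> = 1"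
      using assms by (simp flip: ennreal_mult)
    ultimately show ?thesis by (simp flip: mult.assoc)
  qed
  then show ?thesis
    using le[OF assms, of F t] le[of "1 / c" "\<lambda>x. ennreal \<bar>c\<bar> * F (t + c * x)" "- t / c"] assms
    by (intro antisym) auto
qed

text \<open>A simple minorant on the union splits into its restrictions to \<open>A\<close> and
  \<open>B\<close>; conversely, minorants with disjoint supports add up to a minorant. Only simple
  functions are ever added.\<close>

lemma nn_integral_disjoint_Un_lower:
  fixes F :: "'a \<Rightarrow> ennreal"
  assumes [measurable]: "A \<in> sets M" "B \<in> sets M" and disj: "A \<inter> B = {}"
  shows "(\<integral>\<^sup>+x\<in>A \<union> B. F x \<partial>M) = (\<integral>\<^sup>+x\<in>A. F x \<partial>M) + (\<integral>\<^sup>+x\<in>B. F x \<partial>M)"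
proof (rule antisym)
  show "(\<integral>\<^sup>+x\<in>A \<union> B. F x \<partial>M) \<le> (\<integral>\<^sup>+x\<in>A. F x \<partial>M) + (\<integral>\<^sup>+x\<in>B. F x \<partial>M)"
    unfolding nn_integral_def[of M "\<lambda>x. F x * indicator (A \<union> B) x"]
  proof (rule SUP_least)
    fix g assume "g \<in> {g. simple_function M g \<and> g \<le> (\<lambda>x. F x * indicator (A \<union> B) x)}"
    then have g: "simple_function M g" "\<And>x. g x \<le> F x * indicator (A \<union> B) x" by (auto simp: le_fun_def)
    then have [measurable]: "g \<in> borel_measurable M"
      using borel_measurable_simple_function by blast
    have "integral\<^sup>S M g = (\<integral>\<^sup>+x. g x \<partial>M)" by (rule nn_integral_eq_simple_integral[symmetric, OF g(1)])
    also have "\<dots> \<le> (\<integral>\<^sup>+x. g x * indicator A x + g x * indicator B x \<partial>M)"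
    proof (rule nn_integral_mono)
      show "g x \<le> g x * indicator A x + g x * indicator B x" for x
        using g(2)[of x] by (auto split: split_indicator)
    qed
    also have "\<dots> = (\<integral>\<^sup>+x\<in>A. g x \<partial>M) + (\<integral>\<^sup>+x\<in>B. g x \<partial>M)" by (rule nn_integral_add) auto
    also have "\<dots> \<le> (\<integral>\<^sup>+x\<in>A. F x \<partial>M) + (\<integral>\<^sup>+x\<in>B. F x \<partial>M)"
    proof (intro add_mono nn_integral_mono)
      show "g x * indicator A x \<le> F x * indicator A x" "g x * indicator B x \<le> F x * indicator B x" for x
        using g(2)[of x] by (auto split: split_indicator)
    qed
    finally show "integral\<^sup>S M g \<le> \<dots>" .
  qed
next
  let ?S = "\<lambda>A. {g. simple_function M g \<and> g \<le> (\<lambda>x. F x * indicator A x)}"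
  have ne: "?S C \<noteq> {}" for C by (auto intro!: exI[of _ "\<lambda>_. 0"] simp: le_fun_def)
  have le: "integral\<^sup>S M g + integral\<^sup>S M h \<le> (\<integral>\<^sup>+x\<in>A \<union> B. F x \<partial>M)" if "g \<in> ?S A" "h \<in> ?S B" for g h
  proof -
    have gh: "simple_function M g" "simple_function M h"
      "\<And>x. g x \<le> F x * indicator A x" "\<And>x. h x \<le> F x * indicator B x" using that by (auto simp: le_fun_def)
    have "integral\<^sup>S M g + integral\<^sup>S M h = integral\<^sup>S M (\<lambda>x. g x + h x)"
      by (rule simple_integral_add[symmetric]) (use gh in auto)
    also have "\<dots> = (\<integral>\<^sup>+x. g x + h x \<partial>M)"
      by (rule nn_integral_eq_simple_integral[symmetric]) (use gh in auto)
    also have "\<dots> \<le> (\<integral>\<^sup>+x\<in>A \<union> B. F x \<partial>M)"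
    proof (rule nn_integral_mono)
      show "g x + h x \<le> F x * indicator (A \<union> B) x" for x
        using gh(3,4)[of x] disj by (cases "x \<in> A"; cases "x \<in> B") auto
    qed
    finally show ?thesis .
  qed
  show "(\<integral>\<^sup>+x\<in>A. F x \<partial>M) + (\<integral>\<^sup>+x\<in>B. F x \<partial>M) \<le> (\<integral>\<^sup>+x\<in>A \<union> B. F x \<partial>M)"
    unfolding nn_integral_def[of M "\<lambda>x. F x * indicator A x"] nn_integral_def[of M "\<lambda>x. F x * indicator B x"]
  proof -
    have "(SUP g\<in>?S A. integral\<^sup>S M g) + (SUP h\<in>?S B. integral\<^sup>S M h)
        = (SUP h\<in>?S B. SUP g\<in>?S A. integral\<^sup>S M g + integral\<^sup>S M h)"
      by (simp only: ennreal_SUP_add_left[OF ne, symmetric] ennreal_SUP_add_right[OF ne])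
    also have "\<dots> \<le> (\<integral>\<^sup>+x\<in>A \<union> B. F x \<partial>M)" by (intro SUP_least le)
    finally show "(SUP g\<in>?S A. integral\<^sup>S M g) + (SUP h\<in>?S B. integral\<^sup>S M h)
        \<le> (\<integral>\<^sup>+x\<in>A \<union> B. F x \<partial>M)" .
  qed
qed

lemma nn_integral_Icc_split:
  fixes F :: "real \<Rightarrow> ennreal"
  assumes "a \<le> c" "c \<le> b"
  shows "(\<integral>\<^sup>+x\<in>{a..b}. F x \<partial>lborel) = (\<integral>\<^sup>+x\<in>{a..c}. F x \<partial>lborel) + (\<integral>\<^sup>+x\<in>{c..b}. F x \<partial>lborel)"
proof -
  have "{a..b} = {a..c} \<union> {c<..b}" using assms by auto
  moreover have "{a..c} \<inter> {c<..b} = {}" by auto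
  ultimately have "(\<integral>\<^sup>+x\<in>{a..b}. F x \<partial>lborel) = (\<integral>\<^sup>+x\<in>{a..c}. F x \<partial>lborel) + (\<integral>\<^sup>+x\<in>{c<..b}. F x \<partial>lborel)"
    using nn_integral_disjoint_Un_lower[of "{a..c}" lborel "{c<..b}" F] by simp
  also have "(\<integral>\<^sup>+x\<in>{c<..b}. F x \<partial>lborel) = (\<integral>\<^sup>+x\<in>{c..b}. F x \<partial>lborel)"
    by (rule nn_integral_cong_AE) (use AE_lborel_singleton[of c] in \<open>eventually_elim; auto split: split_indicator\<close>)
  finally show ?thesis .
qed

lemma nn_integral_Icc_cong_finite:
  fixes F :: "real \<Rightarrow> ennreal"
  assumes "finite S" "\<And>x. x \<in> {a<..<b} - S \<Longrightarrow> F x = F' x"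
  shows "(\<integral>\<^sup>+x\<in>{a..b}. F x \<partial>lborel) = (\<integral>\<^sup>+x\<in>{a..b}. F' x \<partial>lborel)"
proof (rule nn_integral_cong_AE)
  have "AE x in lborel. x \<notin> S \<union> {a, b}"
    by (intro AE_not_in finite_imp_null_set_lborel) (use assms(1) in auto)
  then show "AE x in lborel. F x * indicator {a..b} x = F' x * indicator {a..b} x"
    by eventually_elim (use assms(2) in \<open>auto split: split_indicator\<close>)
qed

text \<open>\<open>K\<close> stands for the Kobayashi metric along a curve and may fail to be
  measurable. The derivative \<open>f'\<close> is Lebesgue measurable because it is gauge
  integrable, and it is enough to compare \<open>K\<close> with \<open>f'\<close>.\<close>

lemma variation_le_nn_integral:
  fixes f :: "real \<Rightarrow> real"
  assumes "finite S" "a \<le> b" "continuous_on {a..b} f"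
    and D: "\<And>x. x \<in> {a<..<b} - S \<Longrightarrow> (f has_vector_derivative f' x) (at x)"
    and K: "\<And>x. x \<in> {a<..<b} - S \<Longrightarrow> \<bar>f' x\<bar> \<le> K x"
  shows "ennreal \<bar>f b - f a\<bar> \<le> (\<integral>\<^sup>+x\<in>{a..b}. ennreal (K x) \<partial>lborel)"
proof -
  have int: "(f' has_integral (f b - f a)) {a..b}"
    using fundamental_theorem_of_calculus_interior_strong[OF assms(1,2) D assms(3)] by blast
  let ?g = "\<lambda>x. f' x * indicator {a..b} x"
  have meas: "?g \<in> borel_measurable lebesgue"
    using has_integral_implies_lebesgue_measurable_real[OF int] by simp
  have "AE x in lborel. x \<notin> S \<union> {a, b}"
    by (intro AE_not_in finite_imp_null_set_lborel) (use assms(1) in auto)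
  then have "AE x in lborel. ennreal \<bar>?g x\<bar> \<le> ennreal (K x) * indicator {a..b} x"
    by eventually_elim (use K in \<open>auto split: split_indicator intro!: ennreal_leI\<close>)
  then have le: "(\<integral>\<^sup>+x. ennreal \<bar>?g x\<bar> \<partial>lborel) \<le> (\<integral>\<^sup>+x\<in>{a..b}. ennreal (K x) \<partial>lborel)"
    by (rule nn_integral_mono_AE)
  show ?thesis
  \<comment> \<open>With finite integral \<open>f'\<close> is absolutely integrable and its Lebesgue
    integral is the gauge integral \<open>f b - f a\<close>; otherwise the right-hand side is
    infinite.\<close>
  proof (cases "(\<integral>\<^sup>+x. ennreal \<bar>?g x\<bar> \<partial>lborel) < \<infinity>")
    case True
    then have gint: "integrable lebesgue ?g"
      using meas by (simp add: integrable_iff_bounded nn_integral_completion)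
    have "(?g has_integral (f b - f a)) UNIV"
    proof -
      have "?g = (\<lambda>x. if x \<in> {a..b} then f' x else 0)" by (auto simp: indicator_def)
      then show ?thesis using int by (simp only: has_integral_restrict_UNIV)
    qed
    moreover have "(?g has_integral (integral\<^sup>L lebesgue ?g)) UNIV"
      by (rule has_integral_integral_lebesgue[OF gint])
    ultimately have "f b - f a = integral\<^sup>L lebesgue ?g" by (rule has_integral_unique)
    then have "\<bar>f b - f a\<bar> \<le> (LINT x|lebesgue. \<bar>?g x\<bar>)"
      using integral_norm_bound[of lebesgue ?g] by simp
    then have "ennreal \<bar>f b - f a\<bar> \<le> ennreal (LINT x|lebesgue. \<bar>?g x\<bar>)" by (rule ennreal_leI)
    also have "\<dots> = (\<integral>\<^sup>+x. ennreal \<bar>?g x\<bar> \<partial>lborel)"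
      using gint by (subst nn_integral_eq_integral[symmetric]) (auto simp: nn_integral_completion)
    finally show ?thesis using le by simp
  next
    case False
    then show ?thesis using le by (simp add: top_unique not_less)
  qed
qed

text \<open>An inductive form of \<open>piecewise_C1_curve\<close> on arbitrary intervals:
  concatenation becomes a rule, and reparametrisation and restriction go by induction.\<close>

inductive pwC1 :: "(real \<Rightarrow> 'a::real_normed_vector) \<Rightarrow> real \<Rightarrow> real \<Rightarrow> bool" for \<alpha> where
  smooth: "a < b \<Longrightarrow> continuous_on {a..b} D \<Longrightarrow>
    (\<And>t. t \<in> {a..b} \<Longrightarrow> (\<alpha> has_vector_derivative D t) (at t within {a..b})) \<Longrightarrow> pwC1 \<alpha> a b"
| join: "pwC1 \<alpha> a c \<Longrightarrow> pwC1 \<alpha> c b \<Longrightarrow> pwC1 \<alpha> a b"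

lemma pwC1_less: "pwC1 \<alpha> a b \<Longrightarrow> a < b"
  by (induction rule: pwC1.induct) auto

lemma pwC1_cong:
  assumes "pwC1 \<alpha> a b" "\<And>t. t \<in> {a..b} \<Longrightarrow> \<alpha> t = \<beta> t"
  shows "pwC1 \<beta> a b"
  using assms
proof (induction rule: pwC1.induct)
  case (smooth a b D)
  show ?case
  proof (rule pwC1.smooth[OF smooth(1,2)])
    fix t assume t: "t \<in> {a..b}"
    show "(\<beta> has_vector_derivative D t) (at t within {a..b})"
      by (rule has_vector_derivative_transform[OF t _ smooth(3)[OF t]]) (use smooth(4) in auto)
  qed
next
  case (join a c b)
  then show ?case using pwC1_less[OF join(1)] pwC1_less[OF join(2)] by (intro pwC1.join[of \<beta> a c b]) auto
qed

lemma pwC1_affine: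
  assumes "pwC1 \<alpha> a b" "c > 0"
  shows "pwC1 (\<lambda>t. \<alpha> (t0 + c * t)) ((a - t0) / c) ((b - t0) / c)"
  using assms(1)
proof (induction rule: pwC1.induct)
  case (smooth a b D)
  let ?I = "{(a - t0) / c..(b - t0) / c}"
  have im: "(\<lambda>t. t0 + c * t) ` ?I \<subseteq> {a..b}"
    using assms(2) by (auto simp: field_simps)
  show ?case
  proof (rule pwC1.smooth)
    show "(a - t0) / c < (b - t0) / c" using smooth(1) assms(2) by (simp add: divide_strict_right_mono)
    show "continuous_on ?I (\<lambda>t. c *\<^sub>R D (t0 + c * t))"
      by (intro continuous_intros continuous_on_compose2[OF smooth(2) _ im])
    fix t assume t: "t \<in> ?I"
    have "((\<lambda>t. t0 + c * t) has_vector_derivative c) (at t within ?I)"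
      by (auto intro!: derivative_eq_intros simp flip: has_real_derivative_iff_has_vector_derivative)
    moreover have "(\<alpha> has_vector_derivative D (t0 + c * t)) (at (t0 + c * t) within (\<lambda>t. t0 + c * t) ` ?I)"
      using smooth(3)[of "t0 + c * t"] im t by (meson has_vector_derivative_within_subset image_subset_iff)
    ultimately have "(\<alpha> \<circ> (\<lambda>t. t0 + c * t) has_vector_derivative c *\<^sub>R D (t0 + c * t)) (at t within ?I)"
      by (rule vector_diff_chain_within)
    then show "((\<lambda>t. \<alpha> (t0 + c * t)) has_vector_derivative c *\<^sub>R D (t0 + c * t)) (at t within ?I)"
      by (simp add: o_def)
  qed
next
  case (join a c b)
  then show ?case by (blast intro: pwC1.join)
qed

lemma pwC1_reverse:
  assumes "pwC1 \<alpha> a b"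
  shows "pwC1 (\<lambda>t. \<alpha> (- t)) (- b) (- a)"
  using assms
proof (induction rule: pwC1.induct)
  case (smooth a b D)
  show ?case
  proof (rule pwC1.smooth)
    show "- b < - a" using smooth(1) by simp
    show "continuous_on {- b..- a} (\<lambda>t. - D (- t))"
      by (intro continuous_intros continuous_on_compose2[OF smooth(2)]) auto
    fix t assume t: "t \<in> {- b..- a}"
    have "(uminus has_vector_derivative -1) (at t within {- b..- a})"
      by (auto intro!: derivative_eq_intros simp flip: has_real_derivative_iff_has_vector_derivative)
    moreover have "(\<alpha> has_vector_derivative D (- t)) (at (- t) within uminus ` {- b..- a})"
      using smooth(3)[of "- t"] t by simp
    ultimately have "(\<alpha> \<circ> uminus has_vector_derivative (-1) *\<^sub>R D (- t)) (at t within {- b..- a})"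
      by (rule vector_diff_chain_within)
    then show "((\<lambda>t. \<alpha> (- t)) has_vector_derivative - D (- t)) (at t within {- b..- a})"
      by (simp add: o_def)
  qed
next
  case (join a c b)
  then show ?case by (blast intro: pwC1.join)
qed

lemma pwC1_restrict:
  assumes "pwC1 \<alpha> a b" "a \<le> a'" "a' < b'" "b' \<le> b"
  shows "pwC1 \<alpha> a' b'"
  using assms
proof (induction arbitrary: a' b' rule: pwC1.induct)
  case (smooth a b D)
  have sub: "{a'..b'} \<subseteq> {a..b}" using smooth by auto
  show ?case
    by (rule pwC1.smooth[of a' b' D])
      (use smooth sub in \<open>auto intro: continuous_on_subset has_vector_derivative_within_subset[OF _ sub]\<close>)
next
  case (join a c b)
  consider "b' \<le> c" | "c \<le> a'" | "a' < c" "c < b'" by linarith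
  then show ?case
    by cases (use join in \<open>auto intro: pwC1.join[of \<alpha> a' c b']\<close>)
qed

lemma pwC1_differentiable:
  assumes "pwC1 \<alpha> a b"
  shows "\<exists>S. finite S \<and> (\<forall>t\<in>{a<..<b} - S. \<alpha> differentiable at t)"
  using assms
proof (induction rule: pwC1.induct)
  case (smooth a b D)
  have "\<alpha> differentiable at t" if "t \<in> {a<..<b}" for t
    using smooth(3)[of t] that at_within_Icc_at[of a t b]
    by (auto intro!: differentiableI_vector)
  then show ?case by (intro exI[of _ "{}"]) auto
next
  case (join a c b)
  then obtain S T where "finite S" "finite T" "\<forall>t\<in>{a<..<c} - S. \<alpha> differentiable at t"
    "\<forall>t\<in>{c<..<b} - T. \<alpha> differentiable at t" by blast
  then have "\<alpha> differentiable at t" if "t \<in> {a<..<b} - (S \<union> T \<union> {c})" for t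
    using that by (cases t c rule: linorder_cases) auto
  then show ?case using \<open>finite S\<close> \<open>finite T\<close> by (intro exI[of _ "S \<union> T \<union> {c}"]) auto
qed

lemma pwC1_continuous_on:
  assumes "pwC1 \<alpha> a b"
  shows "continuous_on {a..b} \<alpha>"
  using assms
proof (induction rule: pwC1.induct)
  case (smooth a b D)
  then show ?case using has_vector_derivative_continuous continuous_on_eq_continuous_within by blast
next
  case (join a c b)
  have "{a..b} = {a..c} \<union> {c..b}" using pwC1_less[OF join(1)] pwC1_less[OF join(2)] by auto
  then show ?case using continuous_on_closed_Un[OF closed_atLeastAtMost closed_atLeastAtMost] join by metis
qed

lemma piecewise_C1_curve_imp_pwC1:
  assumes "piecewise_C1_curve \<alpha>"
  shows "pwC1 \<alpha> 0 1"
proof -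
  from assms obtain T where T: "finite T" "{0, 1} \<subseteq> T" "T \<subseteq> {0..1}"
    and D: "\<And>a b. a \<in> T \<Longrightarrow> b \<in> T \<Longrightarrow> a < b \<Longrightarrow> {a<..<b} \<inter> T = {} \<Longrightarrow>
      \<exists>D. continuous_on {a..b} D \<and> (\<forall>t\<in>{a..b}. (\<alpha> has_vector_derivative D t) (at t within {a..b}))"
    unfolding piecewise_C1_curve_def by metis
  have "pwC1 \<alpha> a b" if "a \<in> T" "b \<in> T" "a < b" for a b
    using that
  proof (induction "card ({a<..<b} \<inter> T)" arbitrary: a b rule: less_induct)
    case less
    show ?case
    proof (cases "{a<..<b} \<inter> T = {}")
      case True
      then show ?thesis using D[OF less(2-4)] less(4) by (blast intro: pwC1.smooth)
    next
      case False
      then obtain c where c: "a < c" "c < b" "c \<in> T" by auto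
      have "card ({a<..<c} \<inter> T) < card ({a<..<b} \<inter> T)" "card ({c<..<b} \<inter> T) < card ({a<..<b} \<inter> T)"
        using T(1) c by (auto intro!: psubset_card_mono)
      then show ?thesis using less c pwC1.join[of \<alpha> a c b] by blast
    qed
  qed
  then show ?thesis using T(2) by auto
qed

lemma pwC1_imp_piecewise_C1_curve:
  assumes "pwC1 \<alpha> 0 1"
  shows "piecewise_C1_curve \<alpha>"
proof -
  have "\<exists>T. finite T \<and> {a, b} \<subseteq> T \<and> T \<subseteq> {a..b} \<and>
        (\<forall>x\<in>T. \<forall>y\<in>T. x < y \<and> {x<..<y} \<inter> T = {} \<longrightarrow>
           (\<exists>D. continuous_on {x..y} D \<and> (\<forall>t\<in>{x..y}. (\<alpha> has_vector_derivative D t) (at t within {x..y}))))"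
    if "pwC1 \<alpha> a b" for a b
    using that
  proof (induction rule: pwC1.induct)
    case (smooth a b D)
    then show ?case by (intro exI[of _ "{a, b}"]) auto
  next
    case (join a c b)
    note ac = pwC1_less[OF join(1)] and cb = pwC1_less[OF join(2)]
    obtain T where T: "finite T" "{a, c} \<subseteq> T" "T \<subseteq> {a..c}" and TD: "\<And>x y. x \<in> T \<Longrightarrow> y \<in> T \<Longrightarrow> x < y \<Longrightarrow> {x<..<y} \<inter> T = {} \<Longrightarrow>
      \<exists>D. continuous_on {x..y} D \<and> (\<forall>t\<in>{x..y}. (\<alpha> has_vector_derivative D t) (at t within {x..y}))"
      using join(3) by metis
    obtain U where U: "finite U" "{c, b} \<subseteq> U" "U \<subseteq> {c..b}" and UD: "\<And>x y. x \<in> U \<Longrightarrow> y \<in> U \<Longrightarrow> x < y \<Longrightarrow> {x<..<y} \<inter> U = {} \<Longrightarrow>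
      \<exists>D. continuous_on {x..y} D \<and> (\<forall>t\<in>{x..y}. (\<alpha> has_vector_derivative D t) (at t within {x..y}))"
      using join(4) by metis
    have key: "\<exists>D. continuous_on {x..y} D \<and> (\<forall>t\<in>{x..y}. (\<alpha> has_vector_derivative D t) (at t within {x..y}))"
      if xy: "x \<in> T \<union> U" "y \<in> T \<union> U" "x < y" "{x<..<y} \<inter> (T \<union> U) = {}" for x y
    proof -
      \<comment> \<open>\<open>c\<close> is itself a break point, so a gap between break points lies
        on one side of it.\<close>
      have "\<not> (x < c \<and> c < y)" using xy T by auto
      then consider "y \<le> c" | "c \<le> x" by linarith
      then show ?thesis
      proof cases
        case 1
        then have "x \<in> T" "y \<in> T" using xy T U by force+
        then show ?thesis using TD xy by blast
      next
        case 2
        then have "x \<in> U" "y \<in> U" using xy T U by force+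
        then show ?thesis using UD xy by blast
      qed
    qed
    have fin: "finite (T \<union> U)" "{a, b} \<subseteq> T \<union> U" "T \<union> U \<subseteq> {a..b}"
      using T U ac cb by force+
    show ?case
    proof (intro exI[of _ "T \<union> U"] conjI ballI impI fin)
      fix x y assume "x \<in> T \<union> U" "y \<in> T \<union> U" "x < y \<and> {x<..<y} \<inter> (T \<union> U) = {}"
      then show "\<exists>D. continuous_on {x..y} D \<and> (\<forall>t\<in>{x..y}. (\<alpha> has_vector_derivative D t) (at t within {x..y}))"
        by (intro key) simp_all
    qed
  qed
  then show ?thesis using assms unfolding piecewise_C1_curve_def by blast
qed

section \<open>Rays in spaces with thin triangles\<close>

lemma geodesic_segment_reverse:
  assumes "geodesic_segment X d x y A"
  shows "geodesic_segment X d y x A"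
proof -
  from assms obtain a b \<alpha> where \<alpha>: "geodesic_on X d a b \<alpha>" "\<alpha> a = x" "\<alpha> b = y" "A = \<alpha> ` {a..b}"
    unfolding geodesic_segment_def by blast
  let ?\<beta> = "\<lambda>t. \<alpha> (a + b - t)"
  have "(\<lambda>t. a + b - t) ` {a..b} = {a..b}"
    by (auto simp: image_def intro: bexI[of _ "a + b - _"])
  then have im: "?\<beta> ` {a..b} = A" using \<alpha>(4) by (metis image_image)
  have "geodesic_on X d a b ?\<beta>"
    using \<alpha>(1,4) im unfolding geodesic_on_def by auto
  then show ?thesis
    unfolding geodesic_segment_def using \<alpha> im by (intro exI[of _ a] exI[of _ b] exI[of _ ?\<beta>]) auto
qed

locale pseudometric_on =
  fixes X :: "'a set" and d :: "'a \<Rightarrow> 'a \<Rightarrow> real"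
  assumes nonneg: "\<And>x y. 0 \<le> d x y"
    and sym: "\<And>x y. x \<in> X \<Longrightarrow> y \<in> X \<Longrightarrow> d x y = d y x"
    and triangle: "\<And>x y z. x \<in> X \<Longrightarrow> y \<in> X \<Longrightarrow> z \<in> X \<Longrightarrow> d x z \<le> d x y + d y z"
begin

lemma geodesic_segmentD:
  assumes "geodesic_segment X d x y A"
  shows "x \<in> X" "y \<in> X" "A \<subseteq> X"
    and "\<And>p. p \<in> A \<Longrightarrow> d x p + d p y = d x y"
    and "\<And>p q. p \<in> A \<Longrightarrow> q \<in> A \<Longrightarrow> d p q = \<bar>d x p - d x q\<bar>"
    and "\<And>s. 0 \<le> s \<Longrightarrow> s \<le> d x y \<Longrightarrow> \<exists>p\<in>A. d x p = s"
proof -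
  from assms obtain a b \<alpha> where ab: "a \<le> b" and sub: "\<alpha> ` {a..b} \<subseteq> X"
    and dist: "\<And>s t. s \<in> {a..b} \<Longrightarrow> t \<in> {a..b} \<Longrightarrow> d (\<alpha> s) (\<alpha> t) = \<bar>s - t\<bar>"
    and x: "x = \<alpha> a" and y: "y = \<alpha> b" and A: "A = \<alpha> ` {a..b}"
    unfolding geodesic_segment_def geodesic_on_def by blast
  have dx: "d x (\<alpha> t) = t - a" "d (\<alpha> t) y = b - t" if "t \<in> {a..b}" for t
    using dist[of a t] dist[of t b] that ab by (auto simp: x y)
  have dxy: "d x y = b - a"
    using dx(1)[of b] ab by (simp add: y)
  show "x \<in> X" "y \<in> X" "A \<subseteq> X" using sub ab by (auto simp: x y A)
  show "d x p + d p y = d x y" if "p \<in> A" for p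
    using that dx dxy by (auto simp: A)
  show "d p q = \<bar>d x p - d x q\<bar>" if "p \<in> A" "q \<in> A" for p q
    using that dist dx by (auto simp: A)
  show "\<exists>p\<in>A. d x p = s" if "0 \<le> s" "s \<le> d x y" for s
    using that dxy dx(1)[of "a + s"] by (intro bexI[of _ "\<alpha> (a + s)"]) (auto simp: A)
qed

end

locale thin_geodesic_space = pseudometric_on +
  fixes M :: real
  assumes geo: "\<And>x y. x \<in> X \<Longrightarrow> y \<in> X \<Longrightarrow> \<exists>A. geodesic_segment X d x y A"
    and thin: "\<And>A B C. geodesic_triangle X d A B C \<Longrightarrow> thin_triangle d M A B C"
    and M_nonneg: "0 \<le> M"
begin

lemma thin_side:
  assumes "geodesic_segment X d x z C" "geodesic_segment X d x y A" "geodesic_segment X d y z B" "p \<in> C"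
  obtains q where "q \<in> A \<union> B" "d p q \<le> M"
proof -
  have "geodesic_triangle X d A B C"
    unfolding geodesic_triangle_def
    using assms(2,3) geodesic_segment_reverse[OF assms(1)] geodesic_segmentD(1,2)[OF assms(1)]
      geodesic_segmentD(2)[OF assms(2)] by blast
  then have "within_dist d M C (A \<union> B)" using thin unfolding thin_triangle_def by blast
  then show ?thesis using that assms(4) unfolding within_dist_def by blast
qed

text \<open>Take \<open>p\<close> on \<open>A\<close> as far from \<open>x\<close> as
  \<open>v\<close> is. Thinness of the triangle \<open>x\<close>, \<open>v\<close>, \<open>y\<close>
  puts a point \<open>q\<close> of another side within \<open>M\<close> of \<open>p\<close>, and
  comparing distances to the end points places \<open>q\<close> within \<open>M + \<epsilon>\<close>
  of \<open>v\<close>.\<close>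

lemma almost_between:
  assumes A: "geodesic_segment X d x y A" and v: "v \<in> X" and e: "d x v + d v y \<le> d x y + \<epsilon>" and "0 \<le> \<epsilon>"
  obtains p where "p \<in> A" "d v p \<le> 2 * M + \<epsilon>"
proof -
  note AD = geodesic_segmentD[OF A]
  obtain A1 where A1: "geodesic_segment X d x v A1" using geo AD(1) v by blast
  obtain A2 where A2: "geodesic_segment X d v y A2" using geo AD(2) v by blast
  note A1D = geodesic_segmentD[OF A1] and A2D = geodesic_segmentD[OF A2]
  show ?thesis
  proof (cases "d x v \<le> d x y")
    case True
    then obtain p where p: "p \<in> A" "d x p = d x v" using AD(6)[of "d x v"] nonneg by blast
    have pX: "p \<in> X" using p AD(3) by blast
    obtain q where q: "q \<in> A1 \<union> A2" "d p q \<le> M" using thin_side[OF A A1 A2 p(1)] by blast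
    have qX: "q \<in> X" using q A1D(3) A2D(3) by blast
    have "d v p \<le> 2 * M + \<epsilon>"
    proof (cases "q \<in> A1")
      case True
      have "d x p \<le> d x q + d q p" using triangle AD(1) pX qX by blast
      moreover have "d x q + d q v = d x v" using A1D(4) True by blast
      moreover have "d v p \<le> d v q + d q p" using triangle v pX qX by blast
      ultimately show ?thesis using q p sym[OF pX qX] sym[OF v qX] \<open>0 \<le> \<epsilon>\<close> by linarith
    next
      case False
      then have "q \<in> A2" using q by blast
      then have "d v q + d q y = d v y" using A2D(4) by blast
      moreover have "d p y \<le> d p q + d q y" using triangle AD(2) pX qX by blast
      moreover have "d x p + d p y = d x y" using AD(4) p by blast
      moreover have "d v p \<le> d v q + d q p" using triangle v pX qX by blast
      ultimately show ?thesis using q p e sym[OF pX qX] by linarith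
    qed
    then show ?thesis using that p by blast
  next
    \<comment> \<open>Now \<open>v\<close> is farther from \<open>x\<close> than \<open>y\<close>
      is, so \<open>y\<close> itself is within \<open>\<epsilon>\<close> of
      \<open>v\<close>.\<close>
    case False
    obtain p where p: "p \<in> A" "d x p = d x y" using AD(6)[of "d x y"] nonneg by blast
    have pX: "p \<in> X" using p AD(3) by blast
    have "d p y = 0" using AD(4)[OF p(1)] p by linarith
    moreover have "d v p \<le> d v y + d y p" using triangle v pX AD(2) by blast
    ultimately have "d v p \<le> 2 * M + \<epsilon>" using False e sym[OF pX AD(2)] M_nonneg by linarith
    then show ?thesis using that p by blast
  qed
qed

text \<open>Any two rays at bounded distance are eventually close by a bound independent of that
  distance: far from both ends, the short sides of the quadrilateral they span are out of reach.\<close>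

lemma asymptotic_rays_close:
  assumes V: "\<And>t. t0 \<le> t \<Longrightarrow> V t \<in> X" and W: "\<And>t. t0 \<le> t \<Longrightarrow> W t \<in> X"
    and Vd: "\<And>s t. t0 \<le> s \<Longrightarrow> s \<le> t \<Longrightarrow> t - s - 1 \<le> d (V s) (V t) \<and> d (V s) (V t) \<le> t - s"
    and Wd: "\<And>s t. t0 \<le> s \<Longrightarrow> s \<le> t \<Longrightarrow> t - s - 1 \<le> d (W s) (W t) \<and> d (W s) (W t) \<le> t - s"
    and VW: "\<And>t. t0 \<le> t \<Longrightarrow> d (V t) (W t) \<le> B"
  shows "\<exists>s\<ge>t0. \<exists>t\<ge>t0. d (V s) (W t) \<le> 8 * M + 4"
proof -
  have B: "0 \<le> B" using VW[of t0] nonneg[of "V t0" "W t0"] by simp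
  \<comment> \<open>Being close to a short side would force \<open>K - 1\<close> to be at most
    \<open>4 * M + 1 + B\<close>; this \<open>K\<close> exceeds that margin by one.\<close>
  define K where "K = 4 * M + B + 3"
  have K: "0 \<le> K" using B M_nonneg by (simp add: K_def)
  define t1 where "t1 = t0 + K"
  define t2 where "t2 = t1 + K"
  have t: "t0 \<le> t1" "t1 \<le> t2" "t0 \<le> t2" using K by (auto simp: t1_def t2_def)
  note inX = V[OF order_refl] V[OF t(1)] V[OF t(3)] W[OF order_refl] W[OF t(3)]
  obtain A where A: "geodesic_segment X d (V t0) (V t2) A" using geo inX by blast
  obtain E where E: "geodesic_segment X d (V t0) (W t2) E" using geo inX by blast
  obtain F where F: "geodesic_segment X d (W t2) (V t2) F" using geo inX by blast
  obtain G where G: "geodesic_segment X d (V t0) (W t0) G" using geo inX by blast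
  obtain H where H: "geodesic_segment X d (W t0) (W t2) H" using geo inX by blast
  \<comment> \<open>The excess 1 is the additive error of the ray: two pieces of total length at
    most \<open>t2 - t0\<close> against a distance of at least \<open>t2 - t0 - 1\<close>.\<close>
  obtain p where p: "p \<in> A" "d (V t1) p \<le> 2 * M + 1"
    using almost_between[OF A inX(2), of 1] Vd[of t0 t1] Vd[of t1 t2] Vd[of t0 t2] t by auto
  have pX: "p \<in> X" using p A geodesic_segmentD(3) by blast
  obtain p' where p': "p' \<in> E \<union> F" "d p p' \<le> M" using thin_side[OF A E F p(1)] by blast
  have p'X: "p' \<in> X" using p' E F geodesic_segmentD(3) by blast
  have vp': "d (V t1) p' \<le> 3 * M + 1" using triangle[OF inX(2) pX p'X] p p' by linarith
  have "p' \<notin> F"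
  proof
    assume "p' \<in> F"
    then have "d (W t2) p' + d p' (V t2) = d (W t2) (V t2)" using geodesic_segmentD(4)[OF F] by blast
    then have "d p' (V t2) \<le> B" using VW[OF t(3)] nonneg[of "W t2" p'] sym[OF inX(3) inX(5)] by linarith
    then have "d (V t1) (V t2) \<le> 3 * M + 1 + B" using triangle[OF inX(2) p'X inX(3)] vp' by linarith
    moreover have "t2 - t1 - 1 \<le> d (V t1) (V t2)" using Vd t by blast
    ultimately show False using M_nonneg by (simp add: t2_def K_def)
  qed
  with p' have "p' \<in> E" by blast
  then obtain p'' where p'': "p'' \<in> G \<union> H" "d p' p'' \<le> M" using thin_side[OF E G H] by blast
  have p''X: "p'' \<in> X" using p'' G H geodesic_segmentD(3) by blast
  have vp'': "d (V t1) p'' \<le> 4 * M + 1" using triangle[OF inX(2) p'X p''X] vp' p'' by linarith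
  have "p'' \<notin> G"
  proof
    assume "p'' \<in> G"
    then have "d (V t0) p'' + d p'' (W t0) = d (V t0) (W t0)" using geodesic_segmentD(4)[OF G] by blast
    then have "d (V t0) p'' \<le> B" using VW[of t0] nonneg[of p'' "W t0"] by linarith
    then have "d (V t0) (V t1) \<le> 4 * M + 1 + B"
      using triangle[OF inX(1) p''X inX(2)] vp'' sym[OF inX(2) p''X] by linarith
    moreover have "t1 - t0 - 1 \<le> d (V t0) (V t1)" using Vd t by blast
    ultimately show False by (simp add: t1_def K_def)
  qed
  with p'' have p''H: "p'' \<in> H" by blast
  note HD = geodesic_segmentD[OF H]
  \<comment> \<open>\<open>W s\<close> is about as far from \<open>W t0\<close> as
    \<open>p''\<close> is. It is within \<open>2 * M + 1\<close> of some \<open>w\<close> on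
    \<open>H\<close>, and the positions of \<open>w\<close> and \<open>p''\<close> on
    \<open>H\<close> differ by at most \<open>2 * M + 2\<close>. With \<open>4 * M + 1\<close> from
    \<open>vp''\<close> this sums to \<open>8 * M + 4\<close>.\<close>
  define s where "s = t0 + d (W t0) p''"
  have s: "t0 \<le> s" "s \<le> t2"
    using HD(4)[OF p''H] nonneg[of "W t0" p''] nonneg[of p'' "W t2"] Wd[of t0 t2] t by (auto simp: s_def)
  have ws: "W s \<in> X" using W s by blast
  obtain w where w: "w \<in> H" "d (W s) w \<le> 2 * M + 1"
    using almost_between[OF H ws, of 1] Wd[of t0 s] Wd[of s t2] Wd[of t0 t2] t s by auto
  have wX: "w \<in> X" using w HD by blast
  have "\<bar>d (W t0) (W s) - d (W t0) w\<bar> \<le> 2 * M + 1"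
    using triangle[OF inX(4) ws wX] triangle[OF inX(4) wX ws] w sym[OF ws wX] by linarith
  moreover have "\<bar>d (W t0) (W s) - d (W t0) p''\<bar> \<le> 1" using Wd[OF order_refl s(1)] by (simp add: s_def)
  ultimately have "d p'' w \<le> 2 * M + 2" using HD(5)[OF p''H w(1)] by linarith
  then have "d p'' (W s) \<le> 4 * M + 3" using triangle[OF p''X wX ws] w sym[OF ws wX] by linarith
  then have "d (V t1) (W s) \<le> 8 * M + 4" using triangle[OF inX(2) p''X ws] vp'' by linarith
  then show ?thesis using t s by blast
qed

end

section \<open>The Kobayashi pseudodistance\<close>

text \<open>The two-sided derivative makes the integrand independent of the interval, so lengths of
  subintervals add up.\<close>

definition klen :: "(complex ^ 'n) set \<Rightarrow> (real \<Rightarrow> complex ^ 'n) \<Rightarrow> real \<Rightarrow> real \<Rightarrow> ennreal" where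
  "klen G \<alpha> a b = (\<integral>\<^sup>+t\<in>{a..b}. ennreal (kobayashi_metric G (\<alpha> t) (vector_derivative \<alpha> (at t))) \<partial>lborel)"

lemma kobayashi_length_eq_klen: "kobayashi_length G \<alpha> = klen G \<alpha> 0 1"
  unfolding kobayashi_length_def klen_def
  by (rule nn_integral_Icc_cong_finite[of "{}"]) (auto simp: at_within_Icc_at)

lemma klen_cong:
  assumes "\<And>t. t \<in> {a..b} \<Longrightarrow> \<alpha> t = \<beta> t"
  shows "klen G \<alpha> a b = klen G \<beta> a b"
  unfolding klen_def
proof (rule nn_integral_Icc_cong_finite[of "{}"])
  fix t assume t: "t \<in> {a<..<b} - {}"
  then have "eventually (\<lambda>x. x \<in> {a<..<b}) (nhds t)" by (intro eventually_nhds_in_open) auto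
  then have "eventually (\<lambda>x. x \<in> UNIV \<longrightarrow> \<alpha> x = \<beta> x) (nhds t)"
    by eventually_elim (use assms in auto)
  then have "vector_derivative \<alpha> (at t) = vector_derivative \<beta> (at t)"
    by (rule vector_derivative_cong_eq) auto
  then show "ennreal (kobayashi_metric G (\<alpha> t) (vector_derivative \<alpha> (at t))) =
      ennreal (kobayashi_metric G (\<beta> t) (vector_derivative \<beta> (at t)))"
    using assms t by auto
qed auto

lemma klen_split: "a \<le> c \<Longrightarrow> c \<le> b \<Longrightarrow> klen G \<alpha> a b = klen G \<alpha> a c + klen G \<alpha> c b"
  unfolding klen_def by (rule nn_integral_Icc_split)

text \<open>\<open>c\<close> may be negative, which covers reversal as well as rescaling;
  \<open>iff\<close> describes the preimage of the interval for both signs.\<close>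

lemma klen_substitution:
  assumes "open G" "c \<noteq> 0" "pwC1 \<alpha> a b" and G: "\<alpha> ` {a..b} \<subseteq> G"
    and iff: "\<And>x. x \<in> {a'..b'} \<longleftrightarrow> t0 + c * x \<in> {a..b}"
  shows "klen G (\<lambda>x. \<alpha> (t0 + c * x)) a' b' = klen G \<alpha> a b"
proof -
  obtain S where S: "finite S" "\<And>t. t \<in> {a<..<b} - S \<Longrightarrow> \<alpha> differentiable at t"
    using pwC1_differentiable[OF assms(3)] by blast
  let ?\<beta> = "\<lambda>x. \<alpha> (t0 + c * x)"
  let ?F = "\<lambda>s. ennreal (kobayashi_metric G (\<alpha> s) (vector_derivative \<alpha> (at s))) * indicator {a..b} s"
  let ?T = "(\<lambda>x. t0 + c * x) -` (S \<union> {a, b})"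
  have "finite ?T" by (rule finite_vimageI) (use S assms(2) in \<open>auto simp: inj_on_def\<close>)
  then have ae: "AE x in lborel. x \<notin> ?T"
    by (intro AE_not_in finite_imp_null_set_lborel)
  have "klen G \<alpha> a b = (\<integral>\<^sup>+x. ennreal \<bar>c\<bar> * ?F (t0 + c * x) \<partial>lborel)"
    unfolding klen_def by (rule nn_integral_affine_substitution[OF assms(2)])
  also have "\<dots> = klen G ?\<beta> a' b'"
    unfolding klen_def
  proof (rule nn_integral_cong_AE, use ae in eventually_elim)
    fix x assume x: "x \<notin> ?T"
    show "ennreal \<bar>c\<bar> * ?F (t0 + c * x) =
      ennreal (kobayashi_metric G (?\<beta> x) (vector_derivative ?\<beta> (at x))) * indicator {a'..b'} x"
    proof (cases "x \<in> {a'..b'}")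
      case True
      then have t: "t0 + c * x \<in> {a..b}" "t0 + c * x \<in> {a<..<b} - S" using iff[of x] x by auto
      have "(\<alpha> has_vector_derivative vector_derivative \<alpha> (at (t0 + c * x))) (at (t0 + c * x))"
        using S(2)[OF t(2)] vector_derivative_works by blast
      moreover have "((\<lambda>x. t0 + c * x) has_vector_derivative c) (at x)"
        by (auto intro!: derivative_eq_intros simp flip: has_real_derivative_iff_has_vector_derivative)
      ultimately have "(\<alpha> \<circ> (\<lambda>x. t0 + c * x) has_vector_derivative c *\<^sub>R vector_derivative \<alpha> (at (t0 + c * x))) (at x)"
        by (intro vector_diff_chain_at)
      then have "vector_derivative ?\<beta> (at x) = c *\<^sub>R vector_derivative \<alpha> (at (t0 + c * x))"
        by (intro vector_derivative_at) (simp add: o_def)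
      moreover have "\<alpha> (t0 + c * x) \<in> G" using G t by blast
      ultimately show ?thesis
        using True t assms(1,2) by (simp add: kobayashi_metric_scaleR ennreal_mult kobayashi_metric_nonneg)
    next
      case False
      then have "t0 + c * x \<notin> {a..b}" using iff[of x] by blast
      with False show ?thesis by simp
    qed
  qed
  finally show ?thesis by simp
qed

text \<open>The distance before \<open>enn2real\<close>: the triangle inequality holds here even for
  infinite values, and finiteness on a domain is then deduced from it.\<close>

definition ekd :: "(complex ^ 'n) set \<Rightarrow> complex ^ 'n \<Rightarrow> complex ^ 'n \<Rightarrow> ennreal" where
  "ekd G p q = (INF \<alpha>\<in>{\<alpha>. piecewise_C1_curve \<alpha> \<and> \<alpha> ` {0..1} \<subseteq> G \<and> \<alpha> 0 = p \<and> \<alpha> 1 = q}. kobayashi_length G \<alpha>)"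

lemma kobayashi_dist_eq: "kobayashi_dist G p q = enn2real (ekd G p q)"
  by (simp add: kobayashi_dist_def ekd_def)

lemma ekd_le_klen:
  assumes "open G" "pwC1 \<alpha> a b" "\<alpha> ` {a..b} \<subseteq> G"
  shows "ekd G (\<alpha> a) (\<alpha> b) \<le> klen G \<alpha> a b"
proof -
  let ?\<beta> = "\<lambda>t. \<alpha> (a + (b - a) * t)"
  note ab = pwC1_less[OF assms(2)]
  have b: "a + (b - a) * x \<in> {a..b} \<longleftrightarrow> x \<in> {0..1}" for x
  proof -
    have "(b - a) * x \<le> b - a \<longleftrightarrow> x \<le> 1" using mult_le_cancel_left_pos[of "b - a" x 1] ab by simp
    moreover have "0 \<le> (b - a) * x \<longleftrightarrow> 0 \<le> x" using ab by (simp add: zero_le_mult_iff)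
    ultimately show ?thesis by auto
  qed
  have "pwC1 ?\<beta> 0 1" using pwC1_affine[OF assms(2), of "b - a" a] ab by simp
  moreover have "?\<beta> ` {0..1} \<subseteq> G" using b assms(3) by blast
  ultimately have "ekd G (?\<beta> 0) (?\<beta> 1) \<le> kobayashi_length G ?\<beta>"
    unfolding ekd_def by (intro INF_lower) (simp add: pwC1_imp_piecewise_C1_curve)
  also have "\<dots> = klen G \<alpha> a b"
    unfolding kobayashi_length_eq_klen
    by (rule klen_substitution[OF assms(1) _ assms(2,3)]) (use ab b in auto)
  finally show ?thesis by simp
qed

lemma ekd_greatest:
  assumes "\<And>\<alpha>. pwC1 \<alpha> 0 1 \<Longrightarrow> \<alpha> ` {0..1} \<subseteq> G \<Longrightarrow> \<alpha> 0 = p \<Longrightarrow> \<alpha> 1 = q \<Longrightarrow> B \<le> klen G \<alpha> 0 1"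
  shows "B \<le> ekd G p q"
  unfolding ekd_def by (rule INF_greatest) (use assms piecewise_C1_curve_imp_pwC1 in \<open>auto simp: kobayashi_length_eq_klen\<close>)

lemma ekd_less_curve:
  assumes "ekd G p q < B"
  obtains \<alpha> where "pwC1 \<alpha> 0 1" "\<alpha> ` {0..1} \<subseteq> G" "\<alpha> 0 = p" "\<alpha> 1 = q" "klen G \<alpha> 0 1 < B"
  using assms unfolding ekd_def INF_less_iff
  by (auto simp: kobayashi_length_eq_klen dest!: piecewise_C1_curve_imp_pwC1)

lemma ekd_sym_le:
  assumes "open G"
  shows "ekd G q p \<le> ekd G p q"
proof (rule ekd_greatest)
  fix \<alpha> assume \<alpha>: "pwC1 \<alpha> 0 1" "\<alpha> ` {0..1} \<subseteq> G" "\<alpha> 0 = p" "\<alpha> 1 = q"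
  let ?\<beta> = "\<lambda>t. \<alpha> (- t)"
  have "?\<beta> ` {-1..0} \<subseteq> G" using \<alpha>(2) by force
  then have "ekd G (?\<beta> (-1)) (?\<beta> 0) \<le> klen G ?\<beta> (-1) 0"
    using ekd_le_klen[OF assms, of ?\<beta> "-1" 0] pwC1_reverse[OF \<alpha>(1)] by simp
  also have "\<dots> = klen G \<alpha> 0 1"
    using klen_substitution[OF assms _ \<alpha>(1,2), of "-1" "-1" 0 0] by auto
  finally show "ekd G q p \<le> klen G \<alpha> 0 1" using \<alpha> by simp
qed

lemma ekd_sym: "open G \<Longrightarrow> ekd G p q = ekd G q p"
  by (intro antisym ekd_sym_le)

lemma less_add_ennreal: "x < top \<Longrightarrow> 0 < e \<Longrightarrow> x < x + ennreal e"
  by (cases x) (auto simp: ennreal_less_iff simp flip: ennreal_plus)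

lemma ekd_triangle:
  assumes "open G"
  shows "ekd G p r \<le> ekd G p q + ekd G q r"
proof (rule ennreal_le_epsilon)
  fix e :: real assume fin: "ekd G p q + ekd G q r < top" and e: "e > 0"
  have "ekd G p q < ekd G p q + ennreal (e / 2)" "ekd G q r < ekd G q r + ennreal (e / 2)"
    using fin e by (auto intro!: less_add_ennreal)
  then obtain \<alpha> \<beta> where \<alpha>: "pwC1 \<alpha> 0 1" "\<alpha> ` {0..1} \<subseteq> G" "\<alpha> 0 = p" "\<alpha> 1 = q" "klen G \<alpha> 0 1 < ekd G p q + ennreal (e / 2)"
    and \<beta>: "pwC1 \<beta> 0 1" "\<beta> ` {0..1} \<subseteq> G" "\<beta> 0 = q" "\<beta> 1 = r" "klen G \<beta> 0 1 < ekd G q r + ennreal (e / 2)"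
    using ekd_less_curve by (metis (no_types, lifting))
  \<comment> \<open>The shift is written \<open>-1 + 1 * t\<close> to match the form
    \<open>t0 + c * t\<close> of \<open>pwC1_affine\<close> and
    \<open>klen_substitution\<close>.\<close>
  define \<gamma> where "\<gamma> t = (if t \<le> 1 then \<alpha> t else \<beta> (-1 + 1 * t))" for t
  let ?\<beta> = "\<lambda>t. \<beta> (-1 + 1 * t)"
  have g1: "\<And>t. t \<in> {0..1} \<Longrightarrow> \<alpha> t = \<gamma> t" and g2: "\<And>t. t \<in> {1..2} \<Longrightarrow> ?\<beta> t = \<gamma> t"
    using \<alpha>(4) \<beta>(3) by (auto simp: \<gamma>_def)
  have \<beta>': "pwC1 ?\<beta> 1 2" using pwC1_affine[OF \<beta>(1), of 1 "-1"] by simp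
  have "pwC1 \<gamma> 0 2"
    by (rule pwC1.join[OF pwC1_cong[OF \<alpha>(1) g1] pwC1_cong[OF \<beta>' g2]])
  moreover have "\<gamma> ` {0..2} \<subseteq> G"
  proof
    fix x assume "x \<in> \<gamma> ` {0..2}"
    then obtain t where t: "t \<in> {0..2}" "x = \<gamma> t" by blast
    show "x \<in> G"
    proof (cases "t \<le> 1")
      case True
      then have "\<alpha> t \<in> G" using t \<alpha>(2) by auto
      with True t show ?thesis by (simp add: \<gamma>_def)
    next
      case False
      then have "\<beta> (-1 + 1 * t) \<in> G" using t by (intro subsetD[OF \<beta>(2)] imageI) auto
      with False t show ?thesis by (simp add: \<gamma>_def)
    qed
  qed
  ultimately have "ekd G (\<gamma> 0) (\<gamma> 2) \<le> klen G \<gamma> 0 2" by (rule ekd_le_klen[OF assms])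
  also have "\<dots> = klen G \<gamma> 0 1 + klen G \<gamma> 1 2" by (rule klen_split) auto
  also have "klen G \<gamma> 0 1 = klen G \<alpha> 0 1" by (rule klen_cong) (use g1 in simp)
  also have "klen G \<gamma> 1 2 = klen G ?\<beta> 1 2" by (rule klen_cong) (use g2 in simp)
  also have "\<dots> = klen G \<beta> 0 1" by (rule klen_substitution[OF assms _ \<beta>(1,2)]) auto
  also have "klen G \<alpha> 0 1 + klen G \<beta> 0 1 \<le> (ekd G p q + ennreal (e / 2)) + (ekd G q r + ennreal (e / 2))"
    by (intro add_mono less_imp_le \<alpha> \<beta>)
  also have "\<dots> = ekd G p q + ekd G q r + ennreal e"
  proof -
    have "ennreal e = ennreal (e / 2) + ennreal (e / 2)" using e by (simp flip: ennreal_plus)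
    then show ?thesis by (simp only: ac_simps)
  qed
  finally show "ekd G p r \<le> ekd G p q + ekd G q r + ennreal e" using \<alpha>(3) \<beta>(4) by (simp add: \<gamma>_def)
qed

lemma ekd_intermediate:
  assumes "open G" "pwC1 \<alpha> 0 1" "\<alpha> ` {0..1} \<subseteq> G" "0 < t" "t < 1"
  shows "ekd G (\<alpha> 0) (\<alpha> t) + ekd G (\<alpha> t) (\<alpha> 1) \<le> klen G \<alpha> 0 1"
proof -
  have "ekd G (\<alpha> 0) (\<alpha> t) \<le> klen G \<alpha> 0 t" "ekd G (\<alpha> t) (\<alpha> 1) \<le> klen G \<alpha> t 1"
    using assms by (auto intro!: ekd_le_klen pwC1_restrict[OF assms(2)])
  then show ?thesis using klen_split[of 0 t 1 G \<alpha>] assms by (simp add: add_mono)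
qed

section \<open>Upper bounds from curves of bounded speed\<close>

lemma ekd_le_of_speed:
  assumes "open G" "continuous_on {0..1} D" "\<alpha> ` {0..1} \<subseteq> G"
    and D: "\<And>t. t \<in> {0..1} \<Longrightarrow> (\<alpha> has_vector_derivative D t) (at t within {0..1})"
    and B: "\<And>t. t \<in> {0..1} \<Longrightarrow> kobayashi_metric G (\<alpha> t) (D t) \<le> B"
  shows "ekd G (\<alpha> 0) (\<alpha> 1) \<le> ennreal B"
proof -
  have "pwC1 \<alpha> 0 1" by (rule pwC1.smooth[OF _ assms(2) D]) auto
  then have "ekd G (\<alpha> 0) (\<alpha> 1) \<le> klen G \<alpha> 0 1" using ekd_le_klen assms by blast
  also have "\<dots> = (\<integral>\<^sup>+t\<in>{0..1}. ennreal (kobayashi_metric G (\<alpha> t) (D t)) \<partial>lborel)"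
    unfolding klen_def
  proof (rule nn_integral_Icc_cong_finite[of "{}"])
    fix t :: real assume t: "t \<in> {0<..<1} - {}"
    then have "vector_derivative \<alpha> (at t) = D t"
      using D[of t] by (intro vector_derivative_at) (simp add: at_within_Icc_at)
    then show "ennreal (kobayashi_metric G (\<alpha> t) (vector_derivative \<alpha> (at t))) = ennreal (kobayashi_metric G (\<alpha> t) (D t))" by simp
  qed auto
  also have "\<dots> \<le> (\<integral>\<^sup>+t\<in>{0..1::real}. ennreal B \<partial>lborel)"
    by (intro nn_integral_mono) (auto split: split_indicator intro!: ennreal_leI B)
  also have "\<dots> = ennreal B" by (simp add: nn_integral_cmult_indicator)
  finally show ?thesis .
qed

text \<open>An affine disc of radius \<open>N\<close>, measured in units of \<open>q - p\<close>,
  about each point of the segment bounds the speed by \<open>1 / N\<close>. Only the complex line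
  through \<open>p\<close> and \<open>q\<close> matters, so the segment may run close to a parallel
  hyperplane.\<close>

lemma ekd_le_segment:
  assumes "open G" "N > 0"
    and G: "\<And>t \<zeta>. t \<in> {0..1} \<Longrightarrow> cmod \<zeta> < 1 \<Longrightarrow> p + (complex_of_real t + complex_of_real N * \<zeta>) *s (q - p) \<in> G"
  shows "ekd G p q \<le> ennreal (1 / N)"
proof -
  let ?\<alpha> = "\<lambda>t. p + t *\<^sub>R (q - p)"
  have eq: "?\<alpha> t + \<zeta> *s (complex_of_real N *s (q - p)) = p + (complex_of_real t + complex_of_real N * \<zeta>) *s (q - p)" for t \<zeta>
    by (simp add: vec_eq_iff scaleR_conv_of_real[where 'a = complex] algebra_simps)
  have disc: "?\<alpha> t + \<zeta> *s (complex_of_real N *s (q - p)) \<in> G" if "t \<in> {0..1}" "cmod \<zeta> < 1" for t \<zeta>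
    unfolding eq using G that by blast
  have "ekd G (?\<alpha> 0) (?\<alpha> 1) \<le> ennreal (1 / N)"
  proof (rule ekd_le_of_speed[OF assms(1)])
    show "continuous_on {0..1} (\<lambda>t. q - p)" by simp
    show "?\<alpha> ` {0..1} \<subseteq> G" using disc[of _ 0] by auto
    fix t :: real assume t: "t \<in> {0..1}"
    show "(?\<alpha> has_vector_derivative q - p) (at t within {0..1})"
      by (auto intro!: derivative_eq_intros)
    have "kobayashi_metric G (?\<alpha> t) (q - p) \<le> cmod (1 / complex_of_real N)"
    proof (rule kobayashi_metric_le[OF holomorphic_disc_affine(1)[OF disc[OF t]]])
      show "1 / complex_of_real N *s (\<chi> i. deriv (\<lambda>\<zeta>. (?\<alpha> t + \<zeta> *s (complex_of_real N *s (q - p))) $ i) 0) = q - p"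
        by (subst holomorphic_disc_affine(2)[OF disc[OF t]]) (use assms(2) in simp_all)
    qed auto
    then show "kobayashi_metric G (?\<alpha> t) (q - p) \<le> 1 / N" using assms(2) by (simp add: norm_divide)
  qed
  then show ?thesis by simp
qed

text \<open>\<open>ln (ln (R / r)) / 2\<close> is the arc length along a radius for the Kobayashi metric of the
  punctured disc of radius \<open>R\<close>. It tends to infinity at the puncture.\<close>

definition cusp_height :: "complex ^ 'n \<Rightarrow> complex \<Rightarrow> real \<Rightarrow> complex ^ 'n \<Rightarrow> real" where
  "cusp_height a b R z = ln (ln (R / cmod (cform a z - b))) / 2"

text \<open>Along a curve the derivative of \<open>cusp_height\<close> is at most the bound of
  \<open>kobayashi_metric_ge_punctured\<close>; integrate with
  \<open>variation_le_nn_integral\<close>.\<close>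

lemma cusp_height_lipschitz:
  assumes "open G" and m: "\<And>x. x \<in> G \<Longrightarrow> cform a x \<noteq> b \<and> cmod (cform a x - b) < R"
  shows "ennreal \<bar>cusp_height a b R q - cusp_height a b R p\<bar> \<le> ekd G p q"
proof (rule ekd_greatest)
  fix \<alpha> assume \<alpha>: "pwC1 \<alpha> 0 1" "\<alpha> ` {0..1} \<subseteq> G" "\<alpha> 0 = p" "\<alpha> 1 = q"
  obtain S where S: "finite S" "\<And>t. t \<in> {0<..<1} - S \<Longrightarrow> \<alpha> differentiable at t"
    using pwC1_differentiable[OF \<alpha>(1)] by blast
  define w where "w t = cform a (\<alpha> t) - b" for t
  define w' where "w' t = cform a (vector_derivative \<alpha> (at t))" for t
  \<comment> \<open>The chain rule for \<open>ln (ln (R / cmod (w t))) / 2\<close>, in which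
    \<open>w t \<bullet> w' t / cmod (w t)\<close> is the derivative of
    \<open>cmod (w t)\<close>.\<close>
  define f' where "f' t = - (w t \<bullet> w' t / cmod (w t)) / (2 * cmod (w t) * ln (R / cmod (w t)))" for t
  have w: "w t \<noteq> 0" "cmod (w t) < R" "R > 0" "1 < R / cmod (w t)" "ln (R / cmod (w t)) > 0" if "t \<in> {0..1}" for t
  proof -
    have "\<alpha> t \<in> G" using \<alpha>(2) that by blast
    then show 1: "w t \<noteq> 0" "cmod (w t) < R" using m by (auto simp: w_def)
    then show 2: "R > 0" by (smt (verit) norm_ge_zero)
    show "1 < R / cmod (w t)" using 1 2 by simp
    then show "ln (R / cmod (w t)) > 0" by simp
  qed
  have cw: "continuous_on {0..1} w" unfolding w_def
    by (intro continuous_intros continuous_on_compose2[OF continuous_on_cform[OF continuous_on_id, where s = UNIV]]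
        pwC1_continuous_on[OF \<alpha>(1)]) auto
  have "ennreal \<bar>cusp_height a b R (\<alpha> 1) - cusp_height a b R (\<alpha> 0)\<bar> \<le>
      (\<integral>\<^sup>+t\<in>{0..1}. ennreal (kobayashi_metric G (\<alpha> t) (vector_derivative \<alpha> (at t))) \<partial>lborel)"
  proof (rule variation_le_nn_integral[OF S(1)])
    have "continuous_on {0..1} (\<lambda>t. ln (ln (R / cmod (w t))) / 2)"
      by (intro continuous_intros cw) (use w in \<open>force+\<close>)
    then show "continuous_on {0..1} (\<lambda>t. cusp_height a b R (\<alpha> t))" by (simp add: cusp_height_def w_def)
    fix t :: real assume t: "t \<in> {0<..<1} - S"
    then have t01: "t \<in> {0..1}" by auto
    note w = w[OF t01]
    define A where "A = w t \<bullet> w' t / cmod (w t)"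
    have den: "2 * cmod (w t) * ln (R / cmod (w t)) > 0" using w(1,5) by (intro mult_pos_pos) auto
    have "(\<alpha> has_vector_derivative vector_derivative \<alpha> (at t)) (at t)"
      using S(2)[OF t] vector_derivative_works by blast
    then have dw: "(w has_vector_derivative w' t) (at t)"
      unfolding w_def w'_def
      by (auto intro!: derivative_eq_intros bounded_linear.has_vector_derivative[OF bounded_linear_cform])
    have "((\<lambda>t. norm (w t)) has_derivative (\<lambda>h. h *\<^sub>R w' t \<bullet> sgn (w t))) (at t)"
      using has_derivative_compose[OF dw[unfolded has_vector_derivative_def] has_derivative_norm[OF w(1)]] by simp
    then have dn: "((\<lambda>t. norm (w t)) has_real_derivative A) (at t)"
      unfolding A_def
      unfolding has_field_derivative_def
      by (rule has_derivative_eq_rhs) (auto simp: sgn_div_norm inner_commute field_simps)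
    have "((\<lambda>t. R / cmod (w t)) has_real_derivative - (R * A) / (cmod (w t) * cmod (w t))) (at t)"
      using w(1) by (auto intro!: derivative_eq_intros dn)
    then have "((\<lambda>t. ln (R / cmod (w t))) has_real_derivative
        1 / (R / cmod (w t)) * (- (R * A) / (cmod (w t) * cmod (w t)))) (at t)"
      by (rule DERIV_chain2[OF DERIV_ln_divide, rotated]) (use w in simp)
    then have "((\<lambda>t. ln (ln (R / cmod (w t)))) has_real_derivative
        1 / ln (R / cmod (w t)) * (1 / (R / cmod (w t)) * (- (R * A) / (cmod (w t) * cmod (w t))))) (at t)"
      by (rule DERIV_chain2[OF DERIV_ln_divide, rotated]) (use w in simp)
    from DERIV_cdivide[OF this, of 2]
    have "((\<lambda>t. ln (ln (R / cmod (w t))) / 2) has_real_derivative f' t) (at t)"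
    proof (rule DERIV_cong)
      have "1 / L * (1 / (R / N) * (- (R * A) / (N * N))) / 2 = - A / (2 * N * L)" if "L > 0" "N > 0" for L N :: real
        using that w(3) by (simp add: field_simps)
      from this[OF w(5), of "cmod (w t)"] w(1)
      show "1 / ln (R / cmod (w t)) * (1 / (R / cmod (w t)) * (- (R * A) / (cmod (w t) * cmod (w t)))) / 2 = f' t"
        by (simp add: f'_def A_def)
    qed
    then show "((\<lambda>t. cusp_height a b R (\<alpha> t)) has_vector_derivative f' t) (at t)"
      by (simp add: cusp_height_def w_def has_real_derivative_iff_has_vector_derivative)
    have "\<bar>A\<bar> \<le> cmod (w' t)"
      using Cauchy_Schwarz_ineq2[of "w t" "w' t"] w(1)
      by (simp add: A_def pos_divide_le_eq mult.commute)
    moreover have "\<bar>f' t\<bar> = \<bar>A\<bar> / (2 * cmod (w t) * ln (R / cmod (w t)))"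
      using den unfolding f'_def A_def[symmetric] by (simp only: abs_divide abs_minus_cancel abs_of_pos)
    ultimately have "\<bar>f' t\<bar> \<le> cmod (w' t) / (2 * cmod (w t) * ln (R / cmod (w t)))"
      using den by (simp only: divide_right_mono less_imp_le)
    also have "\<dots> \<le> kobayashi_metric G (\<alpha> t) (vector_derivative \<alpha> (at t))"
      unfolding w_def w'_def by (rule kobayashi_metric_ge_punctured[OF assms(1) _ m]) (use \<alpha>(2) t01 in auto)
    finally show "\<bar>f' t\<bar> \<le> kobayashi_metric G (\<alpha> t) (vector_derivative \<alpha> (at t))" .
  qed auto
  then show "ennreal \<bar>cusp_height a b R q - cusp_height a b R p\<bar> \<le> klen G \<alpha> 0 1"
    using \<alpha>(3,4) by (simp add: klen_def)
qed

section \<open>Completeness and existence of geodesics\<close>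

lemma ekd_refl:
  assumes "open G" "p \<in> G"
  shows "ekd G p p = 0"
proof -
  \<comment> \<open>For \<open>q = p\<close> the disc condition of \<open>ekd_le_segment\<close>
    reduces to membership of \<open>p\<close>, so its radius is arbitrary.\<close>
  have le: "ekd G p p \<le> 0 + ennreal e" if "e > 0" for e
    using ekd_le_segment[OF assms(1), of "1 / e" p p] that assms(2) by simp
  have "ekd G p p \<le> 0" by (rule ennreal_le_epsilon) (rule le)
  then show ?thesis by simp
qed

text \<open>The segment has length less than \<open>r\<close>; the radius \<open>2 * r\<close>
  leaves room for a disc of radius \<open>r\<close> about each of its points.\<close>

lemma ekd_le_ball:
  assumes "open G" "r > 0" "ball p (2 * r) \<subseteq> G" "dist p q < r"
  shows "ekd G p q \<le> ennreal (dist p q / r)"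
proof (cases "p = q")
  case True
  then show ?thesis using ekd_refl[of G p] assms by (auto simp: subset_iff)
next
  case False
  have dist_eq: "dist p (p + Y) = norm Y" for Y by (simp add: dist_norm)
  define n where "n = norm (q - p)"
  have n: "n > 0" "n < r" using False assms(4) by (auto simp: n_def dist_norm norm_minus_commute)
  have "ekd G p q \<le> ennreal (1 / (r / n))"
  proof (rule ekd_le_segment[OF assms(1)])
    show "r / n > 0" using n assms(2) by simp
    fix t :: real and \<zeta> :: complex assume t: "t \<in> {0..1}" and \<zeta>: "cmod \<zeta> < 1"
    have "cmod (of_real t + of_real (r / n) * \<zeta>) \<le> cmod (of_real t) + cmod (of_real (r / n) * \<zeta>)"
      by (rule norm_triangle_ineq)
    also have "\<dots> \<le> 1 + (r / n) * cmod \<zeta>" using t n by (simp add: norm_mult norm_divide)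
    finally have "cmod (of_real t + of_real (r / n) * \<zeta>) * n \<le> (1 + (r / n) * cmod \<zeta>) * n"
      using n by (intro mult_right_mono) auto
    also have "\<dots> = n + r * cmod \<zeta>" using n by (simp add: field_simps)
    also have "\<dots> < 2 * r"
    proof -
      have "r * cmod \<zeta> \<le> r * 1" using n \<zeta> by (intro mult_left_mono) auto
      then show ?thesis using n by linarith
    qed
    finally have "norm ((of_real t + of_real (r / n) * \<zeta>) *s (q - p)) < 2 * r"
      by (simp only: norm_smult n_def)
    then have "p + (of_real t + of_real (r / n) * \<zeta>) *s (q - p) \<in> ball p (2 * r)"
      by (simp only: mem_ball dist_eq)
    then show "p + (of_real t + of_real (r / n) * \<zeta>) *s (q - p) \<in> G"
      using assms(3) by blast
  qed
  then show ?thesis by (simp add: n_def dist_norm norm_minus_commute)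
qed

text \<open>The last assumption holds both for bounded linearly convex domains and for the
  complements of complex hyperplanes in them; through \<^const>\<open>cusp_height\<close> it
  makes the Kobayashi distance complete.\<close>

locale linearly_convex_domain =
  fixes G :: "(complex ^ 'n) set"
  assumes open_G: "open G" and connected_G: "connected G" and bounded_G: "bounded G"
    and separated: "\<And>q. q \<notin> G \<Longrightarrow> \<exists>a. \<forall>z\<in>G. cform a z \<noteq> cform a q"
begin

abbreviation "d \<equiv> kobayashi_dist G"

lemma ekd_finite:
  assumes "p \<in> G" "q \<in> G"
  shows "ekd G p q < top"
proof (rule connected_equivalence_relation[OF connected_G assms])
  fix x y z
  show "ekd G x y < top \<Longrightarrow> ekd G y x < top" using ekd_sym[OF open_G] by metis
  show "ekd G x y < top \<Longrightarrow> ekd G y z < top \<Longrightarrow> ekd G x z < top"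
    using ekd_triangle[OF open_G, of x z y] by (metis ennreal_add_less_top le_less_trans)
next
  fix x assume "x \<in> G"
  then obtain r where r: "r > 0" "ball x r \<subseteq> G" using open_G open_contains_ball by blast
  have "ekd G x y < top" if "y \<in> ball x (r / 2)" for y
  proof -
    have "ekd G x y \<le> ennreal (dist x y / (r / 2))"
      by (rule ekd_le_ball[OF open_G]) (use r that in auto)
    then show ?thesis using ennreal_less_top le_less_trans by blast
  qed
  moreover have "ball x (r / 2) \<subseteq> G" using r by auto
  ultimately show "\<exists>T. openin (top_of_set G) T \<and> x \<in> T \<and> (\<forall>y\<in>T. ekd G x y < top)"
    using r(1) by (intro exI[of _ "ball x (r / 2)"]) (auto intro: open_openin_trans[OF open_G])
qed

lemma ennreal_d: "p \<in> G \<Longrightarrow> q \<in> G \<Longrightarrow> ennreal (d p q) = ekd G p q"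
  unfolding kobayashi_dist_eq using ekd_finite by (intro ennreal_enn2real) auto

lemma d_le: "p \<in> G \<Longrightarrow> q \<in> G \<Longrightarrow> 0 \<le> B \<Longrightarrow> ekd G p q \<le> ennreal B \<Longrightarrow> d p q \<le> B"
  using ennreal_d by (metis ennreal_le_iff)

lemma d_ge: "p \<in> G \<Longrightarrow> q \<in> G \<Longrightarrow> ennreal B \<le> ekd G p q \<Longrightarrow> B \<le> d p q"
  using ennreal_d by (metis ennreal_le_iff2 kobayashi_dist_eq enn2real_nonneg linorder_not_le less_imp_le order.trans)

lemma kobayashi_dist_nonneg: "0 \<le> d x y"
  by (simp add: kobayashi_dist_eq)

sublocale pseudometric_on G d
proof
  show "0 \<le> d x y" for x y by (rule kobayashi_dist_nonneg)
  show "d x y = d y x" for x y using ekd_sym[OF open_G] by (simp add: kobayashi_dist_eq)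
  fix x y z assume "x \<in> G" "y \<in> G" "z \<in> G"
  then show "d x z \<le> d x y + d y z"
    using ekd_triangle[OF open_G, of x z y] kobayashi_dist_nonneg
    by (intro d_le) (simp_all add: ennreal_d ennreal_plus)
qed

lemma d_refl [simp]: "p \<in> G \<Longrightarrow> d p p = 0"
  by (simp add: kobayashi_dist_eq ekd_refl open_G)

lemma d_le_ball:
  assumes "r > 0" "ball p (2 * r) \<subseteq> G" "dist p q < r"
  shows "d p q \<le> dist p q / r"
  using ekd_le_ball[OF open_G assms] assms by (intro d_le) (auto simp: subset_iff)

lemma continuous_on_d:
  assumes "p \<in> G"
  shows "continuous_on G (d p)"
  unfolding continuous_on_iff
proof (intro ballI allI impI)
  fix x and e :: real assume x: "x \<in> G" and e: "0 < e"
  obtain r where r: "r > 0" "ball x r \<subseteq> G" using x open_G open_contains_ball by blast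
  show "\<exists>\<delta>>0. \<forall>y\<in>G. dist y x < \<delta> \<longrightarrow> dist (d p y) (d p x) < e"
  proof (intro exI[of _ "min (r / 2) (e * (r / 2))"] conjI ballI impI)
    fix y assume y: "y \<in> G" "dist y x < min (r / 2) (e * (r / 2))"
    have "d x y \<le> dist x y / (r / 2)" by (rule d_le_ball) (use r y in \<open>auto simp: dist_commute\<close>)
    also have "\<dots> < e" using y r by (simp add: dist_commute pos_divide_less_eq)
    finally show "dist (d p y) (d p x) < e"
      using triangle[OF assms x y(1)] triangle[OF assms y(1) x] sym[OF x y(1)] by (simp add: dist_real_def)
  qed (use r e in auto)
qed

lemma cusp_height_le_d:
  assumes "\<And>x. x \<in> G \<Longrightarrow> cform a x \<noteq> b \<and> cmod (cform a x - b) < R" "p \<in> G" "q \<in> G"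
  shows "\<bar>cusp_height a b R q - cusp_height a b R p\<bar> \<le> d p q"
  using cusp_height_lipschitz[OF open_G assms(1)] assms(2,3) by (intro d_ge) auto

text \<open>If the \<open>i\<close>-th coordinates differ, choose a value \<open>b\<close> missed by
  that coordinate on \<open>G\<close>, on the real line through the two and beyond that of
  \<open>q\<close>. Then \<open>p\<close> and \<open>q\<close> have different moduli relative to
  \<open>b\<close>, hence different heights.\<close>

lemma d_eq_0_imp_eq:
  assumes "p \<in> G" "q \<in> G" "d p q = 0"
  shows "p = q"
proof (rule ccontr)
  assume "p \<noteq> q"
  then obtain i where i: "p $ i \<noteq> q $ i" by (auto simp: vec_eq_iff)
  let ?a = "axis i (1::complex)"
  obtain B where B: "0 < B" "\<And>z. z \<in> G \<Longrightarrow> cmod (cform ?a z - 0) < B"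
    using bounded_cform[OF bounded_G, of ?a 0] by blast
  define \<delta> where "\<delta> = cmod (p $ i - q $ i)"
  have \<delta>: "\<delta> > 0" using i by (simp add: \<delta>_def)
  \<comment> \<open>Chosen so that \<open>b\<close>, at distance \<open>T * \<delta>\<close> from
    the coordinate of \<open>q\<close>, lies outside the disc of radius \<open>B\<close> containing
    all coordinates.\<close>
  define T where "T = 2 * B / \<delta> + 1"
  have T: "T > 0" "T * \<delta> = 2 * B + \<delta>" using \<delta> B by (auto simp: T_def field_simps add_pos_pos)
  define b where "b = q $ i - of_real T * (p $ i - q $ i)"
  have bq: "cmod (cform ?a q - b) = T * \<delta>" using T by (simp add: b_def norm_mult \<delta>_def)
  have "cform ?a p - b = of_real (T + 1) * (p $ i - q $ i)" by (simp add: b_def algebra_simps)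
  then have bp: "cmod (cform ?a p - b) = (T + 1) * \<delta>" using T by (simp only: norm_mult norm_of_real \<delta>_def)
  have "cmod b \<ge> B"
    using norm_triangle_ineq4[of "cform ?a q" b] bq B(2)[OF assms(2)] T(2) \<delta> B(1) by simp
  then have nz: "cform ?a x \<noteq> b" if "x \<in> G" for x using B(2)[OF that] by auto
  obtain R where R: "0 < R" "\<And>z. z \<in> G \<Longrightarrow> cmod (cform ?a z - b) < R" using bounded_cform[OF bounded_G] by metis
  have "cusp_height ?a b R q = cusp_height ?a b R p"
    using cusp_height_le_d[of ?a b R p q] nz R assms by simp
  moreover have pos: "T * \<delta> > 0" "(T + 1) * \<delta> > 0" using T(1) \<delta> by auto
  moreover have "1 < R / (T * \<delta>)" "1 < R / ((T + 1) * \<delta>)"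
    using R(2)[OF assms(1)] R(2)[OF assms(2)] pos by (simp_all only: bp bq less_divide_eq_1_pos)
  ultimately have "R / (T * \<delta>) = R / ((T + 1) * \<delta>)" unfolding cusp_height_def bp bq
    by (simp add: ln_inj_iff)
  then have "R * ((T + 1) * \<delta>) = R * (T * \<delta>)"
    using frac_eq_eq[of "T * \<delta>" "(T + 1) * \<delta>" R R] pos by simp
  then show False using R(1) \<delta> by (simp add: distrib_right)
qed

text \<open>By \<open>separated\<close>, a limit point outside \<open>G\<close> has a height
  function, which would have to be bounded on the ball and tend to infinity along the
  sequence.\<close>

lemma compact_d_ball:
  assumes p: "p \<in> G"
  shows "compact {z \<in> G. d p z \<le> \<rho>}"
  unfolding compact_eq_bounded_closed
proof (intro conjI)
  show "bounded {z \<in> G. d p z \<le> \<rho>}" by (rule bounded_subset[OF bounded_G]) auto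
  show "closed {z \<in> G. d p z \<le> \<rho>}"
    unfolding closed_sequential_limits
  proof (intro allI impI, elim conjE)
    fix x l assume x: "\<forall>n. x n \<in> {z \<in> G. d p z \<le> \<rho>}" and lim: "x \<longlonglongrightarrow> l"
    have "l \<in> G"
    proof (rule ccontr)
      assume "l \<notin> G"
      then obtain a where a: "\<And>z. z \<in> G \<Longrightarrow> cform a z \<noteq> cform a l" using separated by blast
      obtain R where R: "0 < R" "\<And>z. z \<in> G \<Longrightarrow> cmod (cform a z - cform a l) < R" using bounded_cform[OF bounded_G] by metis
      \<comment> \<open>\<open>C\<close> bounds the height on the ball; solving for the modulus
        gives the lower bound \<open>R * exp (- exp (2 * C))\<close>.\<close>
      define C where "C = cusp_height a (cform a l) R p + \<rho>"
      have "R * exp (- exp (2 * C)) \<le> cmod (cform a (x n) - cform a l)" for n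
      proof -
        have xn: "x n \<in> G" "d p (x n) \<le> \<rho>" using x by auto
        then have "cusp_height a (cform a l) R (x n) \<le> C"
          using cusp_height_le_d[of a "cform a l" R p "x n"] a R(2) p by (force simp: C_def)
        then have "ln (ln (R / cmod (cform a (x n) - cform a l))) \<le> 2 * C" by (simp add: cusp_height_def)
        moreover have pos: "cmod (cform a (x n) - cform a l) > 0" using a xn by simp
        moreover have gt: "R / cmod (cform a (x n) - cform a l) > 1" using R(2)[OF xn(1)] pos by simp
        ultimately have "ln (R / cmod (cform a (x n) - cform a l)) \<le> exp (2 * C)"
          by (metis exp_le_cancel_iff exp_ln ln_gt_zero)
        then have "R / cmod (cform a (x n) - cform a l) \<le> exp (exp (2 * C))"
          using gt by (metis exp_le_cancel_iff exp_ln less_trans zero_less_one)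
        then show ?thesis using pos by (simp add: exp_minus field_simps)
      qed
      moreover have "(\<lambda>n. cmod (cform a (x n) - cform a l)) \<longlonglongrightarrow> cmod (cform a l - cform a l)"
        by (intro tendsto_intros bounded_linear.tendsto[OF bounded_linear_cform lim])
      ultimately have "R * exp (- exp (2 * C)) \<le> cmod (cform a l - cform a l)"
        by (intro LIMSEQ_le_const) auto
      then show False using R(1) by (simp add: mult_le_0_iff)
    qed
    moreover have "d p l \<le> \<rho>"
    proof (rule LIMSEQ_le_const2)
      show "(\<lambda>n. d p (x n)) \<longlonglongrightarrow> d p l"
        by (rule continuous_on_tendsto_compose[OF continuous_on_d[OF p] lim \<open>l \<in> G\<close>]) (use x in auto)
    qed (use x in auto)
    ultimately show "l \<in> {z \<in> G. d p z \<le> \<rho>}" by blast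
  qed
qed

section \<open>Existence of geodesics\<close>

lemma compact_d_sphere:
  assumes "p \<in> G"
  shows "compact {z \<in> G. d p z = c}"
proof -
  have "closedin (top_of_set {z \<in> G. d p z \<le> c}) {z \<in> {z \<in> G. d p z \<le> c}. d p z = c}"
    by (intro continuous_closedin_preimage_constant continuous_on_subset[OF continuous_on_d[OF assms]]) auto
  then have "compact {z \<in> {z \<in> G. d p z \<le> c}. d p z = c}"
    using closedin_compact[OF compact_d_ball[OF assms]] by blast
  also have "{z \<in> {z \<in> G. d p z \<le> c}. d p z = c} = {z \<in> G. d p z = c}" by auto
  finally show ?thesis .
qed

text \<open>Take a curve of length less than \<open>d p q + \<epsilon>\<close> and use the
  intermediate value theorem for the distance from \<open>p\<close> along it.\<close>

lemma almost_between_exists: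
  assumes "p \<in> G" "q \<in> G" "0 \<le> s" "s \<le> d p q" "\<epsilon> > 0"
  obtains m where "m \<in> G" "d p m = s" "d m q \<le> d p q - s + \<epsilon>"
proof -
  have "ekd G p q < ekd G p q + ennreal \<epsilon>" using ekd_finite[OF assms(1,2)] assms(5) by (rule less_add_ennreal)
  then obtain \<alpha> where \<alpha>: "pwC1 \<alpha> 0 1" "\<alpha> ` {0..1} \<subseteq> G" "\<alpha> 0 = p" "\<alpha> 1 = q" "klen G \<alpha> 0 1 < ekd G p q + ennreal \<epsilon>"
    using ekd_less_curve by metis
  have "continuous_on {0..1} (\<lambda>t. d p (\<alpha> t))"
    by (rule continuous_on_compose2[OF continuous_on_d[OF assms(1)] pwC1_continuous_on[OF \<alpha>(1)] \<alpha>(2)])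
  then obtain t where t: "0 \<le> t" "t \<le> 1" "d p (\<alpha> t) = s"
    using IVT'[of "\<lambda>t. d p (\<alpha> t)" 0 s 1] assms \<alpha>(3,4) by auto
  have tG: "\<alpha> t \<in> G" using \<alpha>(2) t by auto
  have "d (\<alpha> t) q \<le> d p q - s + \<epsilon>"
  \<comment> \<open>\<open>ekd_intermediate\<close> cuts the curve into two non-degenerate pieces,
    so the end points are treated apart.\<close>
  proof (cases "0 < t \<and> t < 1")
    case True
    then have "ekd G p (\<alpha> t) + ekd G (\<alpha> t) q \<le> ekd G p q + ennreal \<epsilon>"
      using ekd_intermediate[OF open_G \<alpha>(1,2), of t] \<alpha>(3-5) by auto
    then have "ennreal (d p (\<alpha> t) + d (\<alpha> t) q) \<le> ennreal (d p q + \<epsilon>)"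
      using tG assms nonneg by (simp add: ennreal_d ennreal_plus)
    then show ?thesis using t(3) nonneg[of p q] assms(5) by (subst (asm) ennreal_le_iff) auto
  next
    case False
    then consider "t = 0" | "t = 1" using t by linarith
    then show ?thesis using t \<alpha> assms by cases auto
  qed
  then show ?thesis using that tG t by blast
qed

lemma between_exists:
  assumes "p \<in> G" "q \<in> G" "0 \<le> s" "s \<le> d p q"
  obtains m where "m \<in> G" "d p m = s" "d m q = d p q - s"
proof -
  have "\<exists>m. m \<in> G \<and> d p m = s \<and> d m q \<le> d p q - s + 1 / real (Suc n)" for n
    using almost_between_exists[OF assms, of "1 / real (Suc n)"] by auto
  then obtain m where m: "\<And>n. m n \<in> G" "\<And>n. d p (m n) = s" "\<And>n. d (m n) q \<le> d p q - s + 1 / real (Suc n)" by metis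
  then have "\<forall>n. m n \<in> {z \<in> G. d p z = s}" by auto
  then obtain l r where l: "l \<in> {z \<in> G. d p z = s}" "strict_mono r" "(m \<circ> r) \<longlonglongrightarrow> l"
    using compact_d_sphere[OF assms(1), of s] unfolding compact_def by blast
  have "(\<lambda>n. d q ((m \<circ> r) n)) \<longlonglongrightarrow> d q l"
    by (rule continuous_on_tendsto_compose[OF continuous_on_d[OF assms(2)] l(3)]) (use l m in auto)
  moreover have "(\<lambda>n. d p q - s + 1 / real (Suc (r n))) \<longlonglongrightarrow> d p q - s + 0"
    using LIMSEQ_subseq_LIMSEQ[OF lim_1_over_n l(2)] LIMSEQ_subseq_LIMSEQ[OF LIMSEQ_inverse_real_of_nat l(2)]
    by (intro tendsto_intros) (simp add: o_def inverse_eq_divide)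
  ultimately have "d q l \<le> d p q - s + 0"
    by (rule LIMSEQ_le) (use m sym assms(2) in \<open>auto intro!: exI[of _ 0]\<close>)
  then have "d l q \<le> d p q - s" using sym assms(2) l by auto
  moreover have "d p q \<le> d p l + d l q" using triangle assms l by auto
  ultimately show ?thesis using that l by force
qed

text \<open>A partial isometry defined at both end points extends to any further parameter \<open>t\<close>: finitely
  many constraints reduce to those at the two neighbours of \<open>t\<close>, and closed balls are compact.\<close>

lemma isometric_extension:
  assumes pq: "p \<in> G" "q \<in> G" "t \<in> {0..d p q}"
    and \<Gamma>: "\<Gamma> \<subseteq> {0..d p q} \<times> G" "(0, p) \<in> \<Gamma>" "(d p q, q) \<in> \<Gamma>"
    and iso: "\<And>s x s' x'. (s, x) \<in> \<Gamma> \<Longrightarrow> (s', x') \<in> \<Gamma> \<Longrightarrow> d x x' = \<bar>s - s'\<bar>"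
  obtains m where "m \<in> G" "\<And>s x. (s, x) \<in> \<Gamma> \<Longrightarrow> d x m = \<bar>s - t\<bar>"
proof -
  let ?K = "{z \<in> G. d p z \<le> d p q}"
  let ?C = "\<lambda>z. {m \<in> G. d (snd z) m = \<bar>fst z - t\<bar>}"
  have "?K \<inter> (\<Inter>z\<in>\<Gamma>. ?C z) \<noteq> {}"
  proof (rule compact_imp_fip_image[OF compact_d_ball[OF pq(1)]])
    show "closed (?C z)" if "z \<in> \<Gamma>" for z
      using that \<Gamma>(1) by (intro compact_imp_closed compact_d_sphere) auto
    fix I assume I: "finite I" "I \<subseteq> \<Gamma>"
    \<comment> \<open>Adding both end points guarantees a neighbour of \<open>t\<close> on either
      side.\<close>
    define J where "J = insert (0, p) (insert (d p q, q) I)"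
    have J: "finite J" "J \<subseteq> \<Gamma>" "(0, p) \<in> J" "(d p q, q) \<in> J" "I \<subseteq> J" using I \<Gamma> by (auto simp: J_def)
    define S1 where "S1 = fst ` {z \<in> J. fst z \<le> t}"
    define S2 where "S2 = fst ` {z \<in> J. t \<le> fst z}"
    have fin: "finite S1" "finite S2" using J(1) by (auto simp: S1_def S2_def)
    have "0 \<in> S1" "d p q \<in> S2" using J(3,4) pq(3) by (force simp: S1_def S2_def)+
    then have "Max S1 \<in> S1" "Min S2 \<in> S2" using Max_in[OF fin(1)] Min_in[OF fin(2)] by auto
    then obtain x1 x2 where x1: "(Max S1, x1) \<in> J" "Max S1 \<le> t" and x2: "(Min S2, x2) \<in> J" "t \<le> Min S2"
      by (auto simp: S1_def S2_def)
    define s1 s2 where "s1 = Max S1" and "s2 = Min S2"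
    have xG: "x1 \<in> G" "x2 \<in> G" using x1 x2 J \<Gamma> by auto
    have d12: "d x1 x2 = s2 - s1" using iso x1 x2 J(2) by (force simp: s1_def s2_def)
    obtain m where m: "m \<in> G" "d x1 m = t - s1" "d m x2 = s2 - t"
      using between_exists[OF xG, of "t - s1"] d12 x1 x2 by (auto simp: s1_def s2_def)
    \<comment> \<open>For \<open>s\<close> on one side of \<open>t\<close>, the neighbour on that
      side gives the upper bound and the neighbour on the far side the lower bound.\<close>
    have *: "d x m = \<bar>s - t\<bar>" if "(s, x) \<in> J" for s x
    proof -
      have xG': "x \<in> G" using that J(2) \<Gamma>(1) by auto
      have d1: "d x x1 = \<bar>s - s1\<bar>" "d x x2 = \<bar>s - s2\<bar>"
        using iso that x1 x2 J(2) by (force simp: s1_def s2_def)+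
      have tri: "d x m \<le> d x x1 + d x1 m" "d x m \<le> d x x2 + d m x2" "d x x2 \<le> d x m + d m x2" "d x x1 \<le> d x m + d x1 m"
        using triangle[OF xG' xG(1) m(1)] triangle[OF xG' xG(2) m(1)] triangle[OF xG' m(1) xG(2)] triangle[OF xG' m(1) xG(1)]
          sym[OF xG(1) m(1)] sym[OF xG(2) m(1)] by auto
      show ?thesis
      proof (cases "s \<le> t")
        case True
        then have "s \<in> S1" using that by (force simp: S1_def)
        then have "s \<le> s1" using Max_ge[OF fin(1)] by (simp add: s1_def)
        then show ?thesis using tri d1 m True x2(2) by (simp add: s2_def)
      next
        case False
        then have "s \<in> S2" using that by (force simp: S2_def)
        then have "s2 \<le> s" using Min_le[OF fin(2)] by (simp add: s2_def)
        then show ?thesis using tri d1 m False x1(2) by (simp add: s1_def)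
      qed
    qed
    have "d p m \<le> d p q" using *[OF J(3)] pq(3) by simp
    then have "m \<in> ?K \<inter> (\<Inter>z\<in>I. ?C z)" using m(1) * J(5) by auto
    then show "?K \<inter> (\<Inter>z\<in>I. ?C z) \<noteq> {}" by blast
  qed
  then show ?thesis using that by fastforce
qed

text \<open>Zorn's lemma for graphs of partial isometries from the interval to \<open>G\<close>; by
  \<open>isometric_extension\<close> a maximal one is defined at every parameter.\<close>

lemma geodesic_exists:
  assumes pq: "p \<in> G" "q \<in> G"
  shows "\<exists>A. geodesic_segment G d p q A"
proof -
  define \<A> where "\<A> = {\<Gamma>. \<Gamma> \<subseteq> {0..d p q} \<times> G \<and> (0, p) \<in> \<Gamma> \<and> (d p q, q) \<in> \<Gamma> \<and>
    (\<forall>(s, x)\<in>\<Gamma>. \<forall>(s', x')\<in>\<Gamma>. d x x' = \<bar>s - s'\<bar>)}"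
  have "\<exists>\<Gamma>\<in>\<A>. \<forall>X\<in>\<A>. \<Gamma> \<subseteq> X \<longrightarrow> X = \<Gamma>"
  proof (rule subset_Zorn_nonempty)
    have "{(0, p), (d p q, q)} \<in> \<A>"
      using pq nonneg[of p q] sym[OF pq] by (auto simp: \<A>_def)
    then show "\<A> \<noteq> {}" by blast
    fix \<C> assume \<C>: "\<C> \<noteq> {}" "subset.chain \<A> \<C>"
    then have sub: "\<C> \<subseteq> \<A>" by (simp add: subset.chain_def)
    have "d x x' = \<bar>s - s'\<bar>" if \<C>': "(s, x) \<in> \<Union>\<C>" "(s', x') \<in> \<Union>\<C>" for s x s' x'
    proof -
      obtain X Y where "X \<in> \<C>" "(s, x) \<in> X" "Y \<in> \<C>" "(s', x') \<in> Y" using \<C>' by blast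
      moreover from this have "X \<subseteq> Y \<or> Y \<subseteq> X" using \<C>(2) by (auto simp: subset.chain_def)
      ultimately obtain Z where "Z \<in> \<C>" "(s, x) \<in> Z" "(s', x') \<in> Z" by blast
      moreover from this have "Z \<in> \<A>" using sub by blast
      ultimately show ?thesis unfolding \<A>_def by blast
    qed
    then show "\<Union>\<C> \<in> \<A>" using sub \<C>(1) unfolding \<A>_def by blast
  qed
  then obtain \<Gamma> where \<Gamma>\<A>: "\<Gamma> \<in> \<A>" and max: "\<forall>X\<in>\<A>. \<Gamma> \<subseteq> X \<longrightarrow> X = \<Gamma>" by (elim bexE)
  from \<Gamma>\<A> have \<Gamma>: "\<Gamma> \<subseteq> {0..d p q} \<times> G" "(0, p) \<in> \<Gamma>" "(d p q, q) \<in> \<Gamma>"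
    and iso: "\<And>s x s' x'. (s, x) \<in> \<Gamma> \<Longrightarrow> (s', x') \<in> \<Gamma> \<Longrightarrow> d x x' = \<bar>s - s'\<bar>" by (auto simp: \<A>_def)
  have "\<exists>x. (t, x) \<in> \<Gamma>" if t: "t \<in> {0..d p q}" for t
  proof -
    obtain m where m: "m \<in> G" "\<And>s x. (s, x) \<in> \<Gamma> \<Longrightarrow> d x m = \<bar>s - t\<bar>"
      using isometric_extension[OF pq t \<Gamma> iso] by blast
    have m': "d m x = \<bar>t - s\<bar>" if "(s, x) \<in> \<Gamma>" for s x
      using m(2)[OF that] sym[OF m(1), of x] \<Gamma>(1) that by auto
    have iso': "d x x' = \<bar>s - s'\<bar>" if "(s, x) \<in> insert (t, m) \<Gamma>" "(s', x') \<in> insert (t, m) \<Gamma>" for s x s' x'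
      using that by (elim insertE) (auto intro: m(2) m' iso simp: m(1))
    have "insert (t, m) \<Gamma> \<subseteq> {0..d p q} \<times> G" "(0, p) \<in> insert (t, m) \<Gamma>" "(d p q, q) \<in> insert (t, m) \<Gamma>"
      using \<Gamma> m(1) t by auto
    then have "insert (t, m) \<Gamma> \<in> \<A>"
      unfolding \<A>_def mem_Collect_eq using iso' by (intro conjI) blast+
    then have "insert (t, m) \<Gamma> = \<Gamma>" using max by (meson subset_insertI)
    then show ?thesis by blast
  qed
  then obtain \<alpha> where \<alpha>: "\<And>t. t \<in> {0..d p q} \<Longrightarrow> (t, \<alpha> t) \<in> \<Gamma>" by metis
  have "geodesic_on G d 0 (d p q) \<alpha>"
    unfolding geodesic_on_def
  proof (intro conjI ballI)
    show "\<alpha> ` {0..d p q} \<subseteq> G" using \<alpha> \<Gamma>(1) by blast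
  qed (use nonneg iso[OF \<alpha> \<alpha>] in auto)
  \<comment> \<open>\<open>\<alpha>\<close> was chosen from the graph, so its end values are known
    only to be at distance 0 from \<open>p\<close> and \<open>q\<close>.\<close>
  moreover have "\<alpha> 0 = p"
    using iso[OF \<alpha> \<Gamma>(2), of 0] \<alpha>[of 0] \<Gamma>(1) pq nonneg[of p q] by (intro d_eq_0_imp_eq) auto
  moreover have "\<alpha> (d p q) = q"
    using iso[OF \<alpha> \<Gamma>(3), of "d p q"] \<alpha>[of "d p q"] \<Gamma>(1) pq nonneg[of p q] by (intro d_eq_0_imp_eq) auto
  ultimately show ?thesis unfolding geodesic_segment_def by blast
qed

end

section \<open>Linear convexity of complex convex domains\<close>

lemma continuous_on_smult [continuous_intros]:
  fixes g :: "'a::topological_space \<Rightarrow> complex ^ 'n"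
  assumes "continuous_on S f" "continuous_on S g"
  shows "continuous_on S (\<lambda>x. f x *s g x)"
  unfolding vector_scalar_mult_def using assms by (intro continuous_intros)

lemma slice_homeomorphism:
  fixes x y :: "complex ^ 'n"
  assumes "y \<noteq> 0"
  obtains g where "homeomorphism A ((\<lambda>c. x + c *s y) ` A) (\<lambda>c. x + c *s y) g"
proof -
  obtain i where i: "y $ i \<noteq> 0" using assms by (auto simp: vec_eq_iff)
  have "homeomorphism A ((\<lambda>c. x + c *s y) ` A) (\<lambda>c. x + c *s y) (\<lambda>z. (z $ i - x $ i) / y $ i)"
    using i by (intro homeomorphismI) (auto intro!: continuous_intros)
  then show ?thesis by (rule that)
qed

text \<open>Slices in parametrised form, with \<open>y = 0\<close> and the empty slice included, so
  that two points can be joined without first knowing that they differ.\<close>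

lemma C_convex_slice:
  fixes \<Omega> :: "(complex ^ 'n) set"
  assumes "C_convex_domain \<Omega>"
  shows "open {c. x + c *s y \<in> \<Omega>}" "connected {c. x + c *s y \<in> \<Omega>}" "simply_connected {c. x + c *s y \<in> \<Omega>}"
proof -
  have op: "open \<Omega>" using assms by (simp add: C_convex_domain_def domain_in_def)
  have "continuous_on UNIV (\<lambda>c. x + c *s y)" by (intro continuous_intros)
  then show "open {c. x + c *s y \<in> \<Omega>}" using open_vimage[OF op] by (simp add: vimage_def)
  show "connected {c. x + c *s y \<in> \<Omega>}" "simply_connected {c. x + c *s y \<in> \<Omega>}"
  proof -
    have "connected {c. x + c *s y \<in> \<Omega>} \<and> simply_connected {c. x + c *s y \<in> \<Omega>}"
    proof (cases "y = 0 \<or> {c. x + c *s y \<in> \<Omega>} = {}")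
      case True
      then have "{c. x + c *s y \<in> \<Omega>} = {} \<or> {c. x + c *s y \<in> \<Omega>} = UNIV" by auto
      then show ?thesis by (auto simp: convex_imp_simply_connected)
    next
      case False
      let ?A = "{c. x + c *s y \<in> \<Omega>}" and ?L = "{x + c *s y | c. True}"
      have "complex_line ?L" using False unfolding complex_line_def by blast
      moreover have im: "\<Omega> \<inter> ?L = (\<lambda>c. x + c *s y) ` ?A" by auto
      moreover have "?A \<noteq> {}" using False by auto
      ultimately have *: "connected (\<Omega> \<inter> ?L)" "simply_connected (\<Omega> \<inter> ?L)"
        using assms unfolding C_convex_domain_def domain_in_def by auto
      obtain g where g: "homeomorphism ?A (\<Omega> \<inter> ?L) (\<lambda>c. x + c *s y) g"
        using slice_homeomorphism[of y ?A x] False unfolding im by blast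
      then have "?A homeomorphic \<Omega> \<inter> ?L" unfolding homeomorphic_def by blast
      then show ?thesis using * homeomorphic_connectedness homeomorphic_simply_connected_eq by blast
    qed
    then show "connected {c. x + c *s y \<in> \<Omega>}" "simply_connected {c. x + c *s y \<in> \<Omega>}" by auto
  qed
qed

text \<open>Distinct logarithms of one number are at least \<open>2 * pi\<close> apart, so
  \<open>\<Phi>\<close> has discrete range.\<close>

lemma exp_constant_imp_constant:
  fixes \<Phi> :: "'a::topological_space \<Rightarrow> complex"
  assumes "connected S" "continuous_on S \<Phi>" "\<And>x. x \<in> S \<Longrightarrow> exp (\<Phi> x) = c" "x \<in> S" "y \<in> S"
  shows "\<Phi> x = \<Phi> y"
proof -
  have "\<Phi> constant_on S"
  proof (rule continuous_discrete_range_constant[OF assms(1,2)])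
    fix x assume x: "x \<in> S"
    have "2 * pi \<le> cmod (\<Phi> y - \<Phi> x)" if y: "y \<in> S" "\<Phi> y \<noteq> \<Phi> x" for y
    proof -
      have "exp (\<Phi> y) = exp (\<Phi> x)" using assms(3) x y by simp
      then obtain n :: int where n: "\<Phi> y = \<Phi> x + (of_int (2 * n) * pi) * \<i>" using exp_eq by blast
      then have "n \<noteq> 0" using y by auto
      then have "1 \<le> \<bar>real_of_int n\<bar>" by linarith
      moreover have "cmod (\<Phi> y - \<Phi> x) = \<bar>real_of_int n\<bar> * (2 * pi)"
        using n by (simp add: norm_mult)
      ultimately show ?thesis by (simp add: mult_le_cancel_right1)
    qed
    then show "\<exists>e>0. \<forall>y. y \<in> S \<and> \<Phi> y \<noteq> \<Phi> x \<longrightarrow> e \<le> norm (\<Phi> y - \<Phi> x)"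
      by (intro exI[of _ "2 * pi"]) auto
  qed
  then show ?thesis using assms(4,5) unfolding constant_on_def by auto
qed

text \<open>\<open>1 + c * k\<close> is the value of an affine coordinate along a line relative to
  its value at \<open>c = 0\<close>; \<open>h 0 = 0\<close> singles out one branch.\<close>

lemma slice_log_exists:
  fixes k :: complex
  assumes "open A" "simply_connected A" "0 \<in> A" and nz: "\<And>c. c \<in> A \<Longrightarrow> 1 + c * k \<noteq> 0"
  obtains h where "continuous_on A h" "\<And>c. c \<in> A \<Longrightarrow> exp (h c) = 1 + c * k" "h 0 = 0"
proof -
  obtain h where h: "continuous_on A h" "\<And>c. c \<in> A \<Longrightarrow> 1 + c * k = exp (h c)"
  proof (rule continuous_logarithm_on_simply_connected)
    show "continuous_on A (\<lambda>c. 1 + c * k)" by (intro continuous_intros)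
  qed (use assms open_imp_locally_path_connected in auto)
  have "exp (h 0) = 1" using h(2)[OF assms(3)] by simp
  moreover have "continuous_on A (\<lambda>c. h c - h 0)" by (intro continuous_intros h)
  ultimately show ?thesis
    using that[of "\<lambda>c. h c - h 0"] h by (simp add: exp_diff)
qed

text \<open>The end point of the lift of \<open>1 + c k\<close> along a path from 0 to 1 depends
  continuously on \<open>k\<close>, and not on the set on which the lift is defined.\<close>

lemma slice_log_perturb:
  assumes A: "open A" "connected A" "0 \<in> A" "1 \<in> A"
    and h: "continuous_on A h" "\<And>c. c \<in> A \<Longrightarrow> exp (h c) = 1 + c * k" "h 0 = 0"
  obtains P \<delta> where "compact P" "P \<subseteq> A" "0 \<in> P" "\<delta> > 0"
    "\<And>A' k' h'. P \<subseteq> A' \<Longrightarrow> continuous_on A' h' \<Longrightarrow> (\<And>c. c \<in> A' \<Longrightarrow> exp (h' c) = 1 + c * k') \<Longrightarrow>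
       h' 0 = 0 \<Longrightarrow> cmod (k' - k) < \<delta> \<Longrightarrow> h' 1 = h 1 + Ln ((1 + k') / (1 + k))"
proof -
  have "path_connected A" using A(1,2) by (simp add: connected_open_path_connected)
  then obtain \<gamma> where \<gamma>: "path \<gamma>" "path_image \<gamma> \<subseteq> A" "pathstart \<gamma> = 0" "pathfinish \<gamma> = 1"
    using A(3,4) unfolding path_connected_def by blast
  define P where "P = path_image \<gamma>"
  have P: "compact P" "connected P" "P \<subseteq> A" "0 \<in> P" "1 \<in> P"
    using \<gamma> pathstart_in_path_image[of \<gamma>] pathfinish_in_path_image[of \<gamma>]
    by (auto simp: P_def compact_path_image connected_path_image)
  have nz: "1 + c * k \<noteq> 0" if "c \<in> P" for c using h(2)[of c] P(3) that by (metis exp_not_eq_zero subsetD)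
  have "continuous_on P (\<lambda>c. c / (1 + c * k))" using nz by (intro continuous_intros) auto
  then have "bounded ((\<lambda>c. c / (1 + c * k)) ` P)" using P(1) compact_continuous_image compact_imp_bounded by blast
  then obtain B where B: "B > 0" "\<And>c. c \<in> P \<Longrightarrow> cmod (c / (1 + c * k)) \<le> B"
    unfolding bounded_pos by auto
  show ?thesis
  proof (rule that[OF P(1,3,4)])
    \<comment> \<open>Within this tolerance the ratio \<open>(1 + c * k') / (1 + c * k)\<close>
      stays at distance less than 1 from 1 along the path, so the principal logarithm is continuous
      there.\<close>
    show "1 / B > 0" using B by simp
    fix A' k' h' assume A': "P \<subseteq> A'" "continuous_on A' h'" "\<And>c. c \<in> A' \<Longrightarrow> exp (h' c) = 1 + c * k'" "h' 0 = 0"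
      and k': "cmod (k' - k) < 1 / B"
    let ?\<rho> = "\<lambda>c. (1 + c * k') / (1 + c * k)"
    have Re: "Re (?\<rho> c) > 0" if c: "c \<in> P" for c
    proof -
      have eq: "?\<rho> c - 1 = c / (1 + c * k) * (k' - k)" using nz[OF c] by (simp add: field_simps)
      have "cmod (?\<rho> c - 1) \<le> B * cmod (k' - k)"
        unfolding eq norm_mult using B(2)[OF c] by (intro mult_right_mono) auto
      also have "\<dots> < 1" using k' B(1) by (simp add: field_simps)
      finally have "\<bar>Re (?\<rho> c - 1)\<bar> < 1" using abs_Re_le_cmod le_less_trans by blast
      then show ?thesis by simp
    qed
    have "continuous_on P (\<lambda>c. h' c - h c - Ln (?\<rho> c))"
    proof -
      have "continuous_on P h'" "continuous_on P h" using A' h(1) P(3) continuous_on_subset by blast+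
      moreover have "?\<rho> c \<notin> \<real>\<^sub>\<le>\<^sub>0" if "c \<in> P" for c
        using Re[OF that] by (auto simp: complex_nonpos_Reals_iff)
      ultimately show ?thesis using nz by (intro continuous_intros) auto
    qed
    moreover have "exp (h' c - h c - Ln (?\<rho> c)) = 1" if c: "c \<in> P" for c
    proof -
      have "?\<rho> c \<noteq> 0" using Re[OF c] by auto
      then have "1 + c * k' \<noteq> 0" by auto
      then show ?thesis
        using nz[OF c] A'(1,3) h(2) P(3) c by (simp add: exp_diff exp_Ln subset_iff)
    qed
    ultimately have "h' 1 - h 1 - Ln (?\<rho> 1) = h' 0 - h 0 - Ln (?\<rho> 0)"
      using exp_constant_imp_constant[OF P(2), where \<Phi> = "\<lambda>c. h' c - h c - Ln (?\<rho> c)"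
          and x = 1 and y = 0 and c = 1] P(4,5) by blast
    then show "h' 1 = h 1 + Ln ((1 + k') / (1 + k))" using A'(4) h(3) by (simp add: algebra_simps)
  qed
qed

text \<open>The lines \<open>\<complex> v b\<close> sweep out the projective line spanned by \<open>p\<close> and \<open>u\<close>, and all the
  spaces \<open>q + V + \<complex> v b\<close> are assumed to meet \<open>\<Omega>\<close>. Along them \<open>coeff\<close> has a continuous
  logarithm; this trivialises the tautological line bundle of the projective line.\<close>

locale swept_plane =
  fixes \<Omega> V :: "(complex ^ 'n) set" and q p u a1 a2 :: "complex ^ 'n"
  assumes C_convex: "C_convex_domain \<Omega>"
    and V: "vec.subspace V" and missed: "\<And>x. x \<in> V \<Longrightarrow> q + x \<notin> \<Omega>"
    and a1: "cform a1 p = 1" "cform a1 u = 0" "\<And>x. x \<in> V \<Longrightarrow> cform a1 x = 0"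
    and a2: "cform a2 p = 0" "cform a2 u = 1" "\<And>x. x \<in> V \<Longrightarrow> cform a2 x = 0"
begin

text \<open>Latitude \<open>fst b\<close> and longitude \<open>snd b\<close> on the Riemann sphere
  of lines: latitude 0 is the pole \<open>p\<close>, and at latitude \<open>pi / 2\<close> all
  longitudes give multiples of \<open>u\<close>.\<close>

definition v :: "real \<times> real \<Rightarrow> complex ^ 'n" where
  "v b = complex_of_real (cos (fst b)) *s p + (complex_of_real (sin (fst b)) * cis (snd b)) *s u"

definition fib :: "real \<times> real \<Rightarrow> (complex ^ 'n) set" where
  "fib b = {z \<in> \<Omega>. \<exists>x\<in>V. \<exists>c. z = q + x + c *s v b}"

text \<open>The hermitian product, in the coordinates \<open>a1\<close> and \<open>a2\<close>, of
  \<open>z - q\<close> with the unit vector \<open>v b\<close>. It reads off the coefficient of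
  \<open>v b\<close> and is jointly continuous in \<open>b\<close> and \<open>z\<close>.\<close>

definition coeff :: "real \<times> real \<Rightarrow> complex ^ 'n \<Rightarrow> complex" where
  "coeff b z = complex_of_real (cos (fst b)) * cform a1 (z - q)
     + complex_of_real (sin (fst b)) * cis (- snd b) * cform a2 (z - q)"

text \<open>A single logarithm, continuous on the total space of the fibres over \<open>I\<close>
  and not just on each fibre.\<close>

definition has_log :: "(real \<times> real) set \<Rightarrow> bool" where
  "has_log I \<longleftrightarrow> (\<exists>F. continuous_on (Sigma I fib) F \<and> (\<forall>b\<in>I. \<forall>z\<in>fib b. exp (F (b, z)) = coeff b z))"

lemma open_\<Omega>: "open \<Omega>"
  using C_convex by (simp add: C_convex_domain_def domain_in_def)

lemma coeff_eq: "x \<in> V \<Longrightarrow> coeff b (q + x + c *s v b) = c"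
proof -
  assume x: "x \<in> V"
  have "coeff b (q + x + c *s v b) =
      c * (complex_of_real ((cos (fst b))\<^sup>2) + complex_of_real ((sin (fst b))\<^sup>2) * (cis (- snd b) * cis (snd b)))"
    using a1 a2 x by (simp add: coeff_def v_def algebra_simps power2_eq_square)
  also have "\<dots> = c * complex_of_real ((cos (fst b))\<^sup>2 + (sin (fst b))\<^sup>2)"
    by (simp only: cis_mult of_real_add) simp
  also have "\<dots> = c" by (simp only: sin_cos_squared_add2) simp
  finally show ?thesis .
qed

lemma coeff_nonzero: "z \<in> fib b \<Longrightarrow> coeff b z \<noteq> 0"
proof
  assume z: "z \<in> fib b" "coeff b z = 0"
  then obtain x c where x: "x \<in> V" "z = q + x + c *s v b" "z \<in> \<Omega>" by (auto simp: fib_def)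
  then have "c = 0" using z(2) coeff_eq by metis
  then show False using x missed by auto
qed

lemma coeff_line: "coeff b (z + c *s (z' - z)) = coeff b z + c * (coeff b z' - coeff b z)"
  by (simp add: coeff_def algebra_simps)

lemma fib_line:
  assumes "z \<in> fib b" "z' \<in> fib b" "z + c *s (z' - z) \<in> \<Omega>"
  shows "z + c *s (z' - z) \<in> fib b"
proof -
  from assms(1,2) obtain x y s t where x: "x \<in> V" "z = q + x + s *s v b" and y: "y \<in> V" "z' = q + y + t *s v b"
    by (auto simp: fib_def)
  have "z + c *s (z' - z) = q + (x + c *s (y - x)) + (s + c * (t - s)) *s v b"
    by (simp add: x y vec_eq_iff algebra_simps)
  moreover have "x + c *s (y - x) \<in> V"
    using V x y by (intro vec.subspace_add vec.subspace_scale vec.subspace_diff)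
  ultimately show ?thesis using assms(3) unfolding fib_def by blast
qed

lemma continuous_on_v [continuous_intros]:
  fixes S :: "'a::t2_space set"
  shows "continuous_on S f \<Longrightarrow> continuous_on S (\<lambda>x. v (f x))"
  unfolding v_def cis_conv_exp by (intro continuous_intros continuous_on_cos continuous_on_sin)

lemma continuous_on_coeff:
  fixes S :: "'a::t2_space set"
  shows "continuous_on S f \<Longrightarrow> continuous_on S g \<Longrightarrow> continuous_on S (\<lambda>x. coeff (f x) (g x))"
  unfolding coeff_def cis_conv_exp by (intro continuous_intros continuous_on_cos continuous_on_sin)

text \<open>Keep \<open>x\<close> and \<open>c\<close> fixed and vary only \<open>b\<close>;
  openness of \<Omega> keeps the point inside, and its coefficient stays constant.\<close>

lemma local_section:
  assumes "z \<in> fib b"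
  obtains \<sigma> \<epsilon> c where "continuous_on UNIV \<sigma>" "\<epsilon> > 0" "\<And>b'. b' \<in> ball b \<epsilon> \<Longrightarrow> \<sigma> b' \<in> fib b'"
    "\<And>b'. coeff b' (\<sigma> b') = c" "\<sigma> b = z"
proof -
  from assms obtain x c where x: "x \<in> V" "z = q + x + c *s v b" "z \<in> \<Omega>" by (auto simp: fib_def)
  define \<sigma> where "\<sigma> b' = q + x + c *s v b'" for b'
  have cont: "continuous_on UNIV \<sigma>" unfolding \<sigma>_def by (intro continuous_intros)
  then have "open (\<sigma> -` \<Omega>)" using open_vimage[OF open_\<Omega>] by blast
  moreover have "b \<in> \<sigma> -` \<Omega>" using x by (simp add: \<sigma>_def)
  ultimately obtain \<epsilon> where \<epsilon>: "\<epsilon> > 0" "ball b \<epsilon> \<subseteq> \<sigma> -` \<Omega>" using open_contains_ball by blast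
  show ?thesis
  proof (rule that[OF cont \<epsilon>(1)])
    show "\<sigma> b' \<in> fib b'" if "b' \<in> ball b \<epsilon>" for b'
      using that \<epsilon>(2) x(1) by (auto simp: fib_def \<sigma>_def)
    show "coeff b' (\<sigma> b') = c" for b' using coeff_eq x by (simp add: \<sigma>_def)
    show "\<sigma> b = z" using x by (simp add: \<sigma>_def)
  qed
qed

text \<open>Two points of a fibre are joined inside the connected slice of their complex line;
  neighbouring fibres are compared along a \<open>local_section\<close>.\<close>

lemma constant_over_connected:
  fixes \<Phi> :: "(real \<times> real) \<times> (complex ^ 'n) \<Rightarrow> complex"
  assumes I: "connected I" and ne: "\<And>b. b \<in> I \<Longrightarrow> fib b \<noteq> {}"
    and \<Phi>: "continuous_on (Sigma I fib) \<Phi>" and exp: "\<And>b z. b \<in> I \<Longrightarrow> z \<in> fib b \<Longrightarrow> exp (\<Phi> (b, z)) = c"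
    and "b \<in> I" "z \<in> fib b" "b' \<in> I" "z' \<in> fib b'"
  shows "\<Phi> (b, z) = \<Phi> (b', z')"
proof -
  have fibre: "\<Phi> (b, z) = \<Phi> (b, z')" if b: "b \<in> I" and z: "z \<in> fib b" "z' \<in> fib b" for b z z'
  proof -
    let ?A = "{c. z + c *s (z' - z) \<in> \<Omega>}"
    have "continuous_on ?A (\<lambda>c. (b, z + c *s (z' - z)))"
      by (intro continuous_intros)
    then have "continuous_on ?A (\<lambda>c. \<Phi> (b, z + c *s (z' - z)))"
      by (rule continuous_on_compose2[OF \<Phi>]) (use fib_line[OF z] b in auto)
    moreover have "exp (\<Phi> (b, z + c' *s (z' - z))) = c" if "c' \<in> ?A" for c'
      using exp[OF b fib_line[OF z]] that by auto
    ultimately have "\<Phi> (b, z + 0 *s (z' - z)) = \<Phi> (b, z + 1 *s (z' - z))"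
      using exp_constant_imp_constant[OF C_convex_slice(2)[OF C_convex, of z "z' - z"], where \<Phi> = "\<lambda>c. \<Phi> (b, z + c *s (z' - z))"
          and x = 0 and y = 1 and c = c] z by (simp only: mem_Collect_eq) (simp add: fib_def)
    then show ?thesis by simp
  qed
  define Z where "Z b = (SOME z. z \<in> fib b)" for b
  have Z: "Z b \<in> fib b" if "b \<in> I" for b using ne[OF that] by (simp add: Z_def some_in_eq)
  have "continuous_on I (\<lambda>b. \<Phi> (b, Z b))"
    unfolding continuous_on_eq_continuous_within
  proof
    fix b assume b: "b \<in> I"
    obtain \<sigma> \<epsilon> c where \<sigma>: "continuous_on UNIV \<sigma>" "\<epsilon> > 0" "\<And>b'. b' \<in> ball b \<epsilon> \<Longrightarrow> \<sigma> b' \<in> fib b'"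
      using local_section[OF Z[OF b]] by metis
    have "continuous_on (I \<inter> ball b \<epsilon>) (\<lambda>b. \<Phi> (b, \<sigma> b))"
      by (rule continuous_on_compose2[OF \<Phi>])
        (use \<sigma> in \<open>auto intro!: continuous_intros intro: continuous_on_subset\<close>)
    then have "continuous (at b within I \<inter> ball b \<epsilon>) (\<lambda>b. \<Phi> (b, \<sigma> b))"
      using b \<sigma>(2) continuous_on_eq_continuous_within by (metis IntI centre_in_ball)
    then have "continuous (at b within I) (\<lambda>b. \<Phi> (b, \<sigma> b))"
      using at_within_nhd[of b "ball b \<epsilon>" "I \<inter> ball b \<epsilon>" I] \<sigma>(2) by auto
    then show "continuous (at b within I) (\<lambda>b. \<Phi> (b, Z b))"
      by (rule continuous_transform_within[OF _ \<sigma>(2) b]) (use fibre \<sigma>(3) Z in \<open>auto simp: dist_commute\<close>)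
  qed
  then have "\<Phi> (b, Z b) = \<Phi> (b', Z b')"
    using exp_constant_imp_constant[OF I, of "\<lambda>b. \<Phi> (b, Z b)" c b b'] exp Z assms by blast
  then show ?thesis using fibre Z assms by metis
qed

lemma has_log_subset: "has_log I \<Longrightarrow> J \<subseteq> I \<Longrightarrow> has_log J"
  unfolding has_log_def by (meson Sigma_mono continuous_on_subset order_refl subsetD)

text \<open>Over the connected overlap the two logarithms differ by one constant \<open>n\<close>
  with \<open>exp n = 1\<close>; shifting one of them by \<open>n\<close> makes them agree.\<close>

lemma has_log_Un:
  assumes "closed I" "closed J" "connected (I \<inter> J)" "has_log I" "has_log J"
    and ne: "\<And>b. b \<in> I \<inter> J \<Longrightarrow> fib b \<noteq> {}"
  shows "has_log (I \<union> J)"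
proof -
  obtain F where F: "continuous_on (Sigma I fib) F" "\<And>b z. b \<in> I \<Longrightarrow> z \<in> fib b \<Longrightarrow> exp (F (b, z)) = coeff b z"
    using assms(4) unfolding has_log_def by blast
  obtain H where H: "continuous_on (Sigma J fib) H" "\<And>b z. b \<in> J \<Longrightarrow> z \<in> fib b \<Longrightarrow> exp (H (b, z)) = coeff b z"
    using assms(5) unfolding has_log_def by blast
  have "\<exists>n. exp n = 1 \<and> (\<forall>b\<in>I \<inter> J. \<forall>z\<in>fib b. F (b, z) = H (b, z) + n)"
  proof (cases "Sigma (I \<inter> J) fib = {}")
    case True
    then show ?thesis by (intro exI[of _ 0]) auto
  next
    case False
    then obtain b0 z0 where 0: "b0 \<in> I \<inter> J" "z0 \<in> fib b0" by auto
    let ?\<Phi> = "\<lambda>y. F y - H y"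
    have "continuous_on (Sigma (I \<inter> J) fib) ?\<Phi>"
      by (intro continuous_intros continuous_on_subset[OF F(1)] continuous_on_subset[OF H(1)]) auto
    note cont = this
    have e: "exp (?\<Phi> (b, z)) = 1" if "b \<in> I \<inter> J" "z \<in> fib b" for b z
      using F(2) H(2) coeff_nonzero that by (simp add: exp_diff)
    have "?\<Phi> (b, z) = ?\<Phi> (b0, z0)" if "b \<in> I \<inter> J" "z \<in> fib b" for b z
      by (rule constant_over_connected[where I = "I \<inter> J" and \<Phi> = ?\<Phi> and c = 1, OF assms(3) ne cont e that 0])
    then show ?thesis using e[OF 0] by (intro exI[of _ "?\<Phi> (b0, z0)"]) (auto simp: algebra_simps)
  qed
  then obtain n where n: "exp n = 1" "\<And>b z. b \<in> I \<inter> J \<Longrightarrow> z \<in> fib b \<Longrightarrow> F (b, z) = H (b, z) + n" by blast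
  have cl: "closedin (top_of_set (Sigma I fib \<union> Sigma J fib)) (Sigma K fib)" if "closed K" "K = I \<or> K = J" for K
  proof -
    have "Sigma K fib = (Sigma I fib \<union> Sigma J fib) \<inter> fst -` K" using that by auto
    moreover have "closed (fst -` K :: ((real \<times> real) \<times> (complex ^ 'n)) set)" by (rule closed_vimage_fst[OF that(1)])
    ultimately show ?thesis using closedin_closed_Int by metis
  qed
  let ?G = "\<lambda>y. if fst y \<in> I then F y else H y + n"
  have "continuous_on (Sigma I fib \<union> Sigma J fib) ?G"
    by (rule continuous_on_cases_local[OF cl[OF assms(1)] cl[OF assms(2)] F(1)])
      (use n(2) in \<open>auto intro!: continuous_intros H(1)\<close>)
  moreover have "Sigma (I \<union> J) fib = Sigma I fib \<union> Sigma J fib" by auto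
  moreover have "exp (?G (b, z)) = coeff b z" if "b \<in> I \<union> J" "z \<in> fib b" for b z
    using that F(2)[of b z] H(2)[of b z] n(1) by (cases "b \<in> I") (simp_all add: exp_add)
  ultimately show ?thesis unfolding has_log_def by (intro exI[of _ ?G]) auto
qed

text \<open>Start in each fibre at a section with constant coefficient \<open>w\<close> and continue
  \<open>Ln w\<close> along the complex line to \<open>z\<close>. Simple connectivity of the slice
  makes the result independent of the path.\<close>

lemma has_log_local:
  assumes "fib b0 \<noteq> {}"
  obtains \<delta> where "\<delta> > 0" "has_log (ball b0 \<delta>)"
proof -
  obtain z0 where "z0 \<in> fib b0" using assms by blast
  then obtain \<sigma> \<epsilon> w where \<sigma>: "continuous_on UNIV \<sigma>" and "\<epsilon> > 0"
    and \<sigma>fib: "\<And>b. b \<in> ball b0 \<epsilon> \<Longrightarrow> \<sigma> b \<in> fib b" and w: "\<And>b. coeff b (\<sigma> b) = w"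
    using local_section by metis
  have w0: "w \<noteq> 0" using coeff_nonzero[OF \<sigma>fib[of b0]] w[of b0] \<open>\<epsilon> > 0\<close> by simp
  define A where "A y = {c. \<sigma> (fst y) + c *s (snd y - \<sigma> (fst y)) \<in> \<Omega>}" for y
  \<comment> \<open>The relative change of \<open>coeff\<close> from the section to the point, so
    \<open>coeff\<close> at parameter \<open>c\<close> of the line is
    \<open>w * (1 + c * k y)\<close>.\<close>
  define k where "k y = coeff (fst y) (snd y) / w - 1" for y
  let ?E = "Sigma (ball b0 \<epsilon>) fib"
  have AE: "0 \<in> A y" "1 \<in> A y" "\<And>c. c \<in> A y \<Longrightarrow> 1 + c * k y \<noteq> 0" if "y \<in> ?E" for y
  proof -
    have y: "\<sigma> (fst y) \<in> fib (fst y)" "snd y \<in> fib (fst y)" using that \<sigma>fib by auto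
    then show "0 \<in> A y" "1 \<in> A y" by (auto simp: A_def fib_def)
    fix c assume "c \<in> A y"
    then have "coeff (fst y) (\<sigma> (fst y) + c *s (snd y - \<sigma> (fst y))) \<noteq> 0"
      using fib_line[OF y] coeff_nonzero by (simp add: A_def)
    moreover have "w * (1 + c * k y) = w + c * (coeff (fst y) (snd y) - w)"
      using w0 by (simp add: k_def field_simps)
    ultimately have "w * (1 + c * k y) \<noteq> 0" unfolding coeff_line w by simp
    then show "1 + c * k y \<noteq> 0" by auto
  qed
  have Asl: "open (A y)" "connected (A y)" "simply_connected (A y)" for y
    unfolding A_def by (rule C_convex_slice[OF C_convex])+
  have "\<forall>y. \<exists>h. y \<in> ?E \<longrightarrow> continuous_on (A y) h \<and> (\<forall>c\<in>A y. exp (h c) = 1 + c * k y) \<and> h 0 = 0"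
    using slice_log_exists[OF Asl(1,3)] AE by metis
  then obtain h where h: "\<And>y. y \<in> ?E \<Longrightarrow> continuous_on (A y) (h y)"
    "\<And>y c. y \<in> ?E \<Longrightarrow> c \<in> A y \<Longrightarrow> exp (h y c) = 1 + c * k y" "\<And>y. y \<in> ?E \<Longrightarrow> h y 0 = 0" by metis
  have "continuous_on ?E (\<lambda>y. h y 1)"
    unfolding continuous_on_eq_continuous_within
  proof
    fix y assume y: "y \<in> ?E"
    obtain P \<delta> where P: "compact P" "P \<subseteq> A y" "0 \<in> P" "\<delta> > 0"
      and perturb: "\<And>A' k' h'. P \<subseteq> A' \<Longrightarrow> continuous_on A' h' \<Longrightarrow> (\<And>c. c \<in> A' \<Longrightarrow> exp (h' c) = 1 + c * k') \<Longrightarrow>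
       h' 0 = 0 \<Longrightarrow> cmod (k' - k y) < \<delta> \<Longrightarrow> h' 1 = h y 1 + Ln ((1 + k') / (1 + k y))"
      using slice_log_perturb[OF Asl(1,2) AE(1,2)[OF y] h(1,2,3)[OF y]] by metis
    \<comment> \<open>By the tube lemma the compact path \<open>P\<close> lies in the slices of all
      nearby points too, so \<open>slice_log_perturb\<close> compares the lifts.\<close>
    let ?m = "\<lambda>x :: complex \<times> (real \<times> real) \<times> (complex ^ 'n). \<sigma> (fst (snd x)) + fst x *s (snd (snd x) - \<sigma> (fst (snd x)))"
    have "continuous_on UNIV ?m"
      by (intro continuous_intros continuous_on_compose2[OF \<sigma>]) auto
    then have "openin (top_of_set (P \<times> UNIV)) ((P \<times> UNIV) \<inter> ?m -` \<Omega>)"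
      using open_vimage[OF open_\<Omega>] by blast
    then obtain U where U: "openin (top_of_set UNIV) U" "y \<in> U" "P \<times> U \<subseteq> (P \<times> UNIV) \<inter> ?m -` \<Omega>"
      by (rule tube_lemma[OF P(1), rotated 2]) (use P in \<open>auto simp: A_def\<close>)
    have PA: "P \<subseteq> A y'" if "y' \<in> U" for y'
      using U(3) that by (fastforce simp: A_def)
    have ck: "continuous_on UNIV k" unfolding k_def
      using w0 by (intro continuous_intros continuous_on_coeff) auto
    have "open (U \<inter> (k -` ball (k y) \<delta>))"
      using U(1) open_vimage[OF open_ball ck] by auto
    moreover have "y \<in> U \<inter> (k -` ball (k y) \<delta>)" using U(2) P(4) by simp
    ultimately obtain r where r: "r > 0" "ball y r \<subseteq> U \<inter> (k -` ball (k y) \<delta>)" using open_contains_ball by blast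
    have eq: "h y 1 + Ln ((1 + k y') / (1 + k y)) = h y' 1" if "y' \<in> ?E" "dist y' y < r" for y'
    proof -
      have "y' \<in> ball y r" using that(2) by (simp add: dist_commute)
      then have "y' \<in> U" "k y' \<in> ball (k y) \<delta>" using r(2) by auto
      then have "y' \<in> U" "cmod (k y' - k y) < \<delta>" by (auto simp: dist_norm norm_minus_commute)
      then show ?thesis using perturb[OF PA h(1,2,3)[OF that(1)]] by simp
    qed
    have nz: "1 + k y \<noteq> 0" using AE(3)[OF y AE(2)[OF y]] by simp
    have "isCont k y" using ck continuous_on_eq_continuous_at[OF open_UNIV] by blast
    then have "isCont (\<lambda>y'. h y 1 + Ln ((1 + k y') / (1 + k y))) y"
      using nz by (intro continuous_intros) auto
    then have "continuous (at y within ?E) (\<lambda>y'. h y 1 + Ln ((1 + k y') / (1 + k y)))"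
      by (rule continuous_at_imp_continuous_at_within)
    then show "continuous (at y within ?E) (\<lambda>y. h y 1)"
      by (rule continuous_transform_within[OF _ r(1) y]) (use eq in blast)
  qed
  then have "continuous_on ?E (\<lambda>y. Ln w + h y 1)" by (intro continuous_intros)
  moreover have "exp (Ln w + h (b, z) 1) = coeff b z" if "b \<in> ball b0 \<epsilon>" "z \<in> fib b" for b z
    using h(2)[of "(b, z)" 1] AE(2)[of "(b, z)"] that w0 by (simp add: exp_add k_def)
  ultimately have "has_log (ball b0 \<epsilon>)" unfolding has_log_def by (intro exI[of _ "\<lambda>y. Ln w + h y 1"]) auto
  then show ?thesis using that \<open>\<epsilon> > 0\<close> by blast
qed

text \<open>Bisection in the longitude gives logarithms over thin strips, and bisection in the
  latitude joins the strips. The overlaps are segments, hence connected.\<close>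

lemma has_log_rectangle:
  assumes ne: "\<And>b. fib b \<noteq> {}" and "r0 \<le> r1" "t0 \<le> t1"
  shows "has_log ({r0..r1} \<times> {t0..t1})"
proof -
  have strip: "\<exists>\<delta>>0. has_log ({r - \<delta>..r + \<delta>} \<times> {t0..t1})" for r
    using assms(3)
  proof (induction t0 t1 rule: Bolzano)
    case (trans a b c)
    then obtain \<delta> \<delta>' where \<delta>: "\<delta> > 0" "has_log ({r - \<delta>..r + \<delta>} \<times> {a..b})" "\<delta>' > 0" "has_log ({r - \<delta>'..r + \<delta>'} \<times> {b..c})"
      by blast
    define \<eta> where "\<eta> = min \<delta> \<delta>'"
    have "has_log ({r - \<eta>..r + \<eta>} \<times> {a..b})" "has_log ({r - \<eta>..r + \<eta>} \<times> {b..c})"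
      by (rule has_log_subset[OF \<delta>(2)], force simp: \<eta>_def, rule has_log_subset[OF \<delta>(4)], force simp: \<eta>_def)
    moreover have "({r - \<eta>..r + \<eta>} \<times> {a..b}) \<inter> ({r - \<eta>..r + \<eta>} \<times> {b..c}) = {r - \<eta>..r + \<eta>} \<times> {b}"
      using trans by auto
    ultimately have "has_log (({r - \<eta>..r + \<eta>} \<times> {a..b}) \<union> ({r - \<eta>..r + \<eta>} \<times> {b..c}))"
      using ne by (intro has_log_Un closed_Times) (auto intro!: connected_Times)
    moreover have "({r - \<eta>..r + \<eta>} \<times> {a..b}) \<union> ({r - \<eta>..r + \<eta>} \<times> {b..c}) = {r - \<eta>..r + \<eta>} \<times> {a..c}"
      using trans by auto
    ultimately show ?case using \<delta> by (intro exI[of _ \<eta>]) (auto simp: \<eta>_def)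
  next
    case (local t)
    obtain \<delta> where \<delta>: "\<delta> > 0" "has_log (ball (r, t) \<delta>)" using has_log_local[OF ne] by metis
    have "has_log ({r - \<delta> / 3..r + \<delta> / 3} \<times> {a..b})" if ab: "a \<le> t" "t \<le> b" "b - a < \<delta> / 3" for a b
    proof (rule has_log_subset[OF \<delta>(2)], rule subsetI)
      fix y assume "y \<in> {r - \<delta> / 3..r + \<delta> / 3} \<times> {a..b}"
      moreover obtain y1 y2 where "y = (y1, y2)" by (cases y)
      ultimately have "y = (y1, y2)" "r - \<delta> / 3 \<le> y1" "y1 \<le> r + \<delta> / 3" "a \<le> y2" "y2 \<le> b" by auto
      then have y: "y = (y1, y2)" "\<bar>r - y1\<bar> \<le> \<delta> / 3" "\<bar>t - y2\<bar> \<le> \<delta> / 3"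
        using ab by linarith+
      have "dist (r, t) y \<le> \<bar>r - y1\<bar> + \<bar>t - y2\<bar>"
        using norm_Pair_le[of "r - y1" "t - y2"] by (simp add: y(1) dist_norm)
      then show "y \<in> ball (r, t) \<delta>" using y \<delta>(1) by simp
    qed
    then show ?case using \<delta>(1) by (intro exI[of _ "\<delta> / 3"] conjI allI impI exI[of _ "\<delta> / 3"]) auto
  qed
  show ?thesis
    using assms(2)
  proof (induction r0 r1 rule: Bolzano)
    case (trans a b c)
    have "({a..b} \<times> {t0..t1}) \<inter> ({b..c} \<times> {t0..t1}) = {b} \<times> {t0..t1}"
      using trans by auto
    then have "has_log (({a..b} \<times> {t0..t1}) \<union> ({b..c} \<times> {t0..t1}))"
      using ne trans by (intro has_log_Un closed_Times) (auto intro!: connected_Times)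
    moreover have "({a..b} \<times> {t0..t1}) \<union> ({b..c} \<times> {t0..t1}) = {a..c} \<times> {t0..t1}"
      using trans by auto
    ultimately show ?case by simp
  next
    case (local r)
    obtain \<delta> where \<delta>: "\<delta> > 0" "has_log ({r - \<delta>..r + \<delta>} \<times> {t0..t1})" using strip by blast
    then show ?case
      by (intro exI[of _ \<delta>] conjI allI impI) (auto intro!: has_log_subset[OF \<delta>(2)])
  qed
qed

text \<open>The tautological bundle is not trivial: going once around \<open>snd b\<close> changes the logarithm by 0
  over \<open>fst b = 0\<close> and by \<open>- 2 \<pi> \<i>\<close> over \<open>fst b = \<pi> / 2\<close>.\<close>

lemma some_fibre_empty: "\<exists>b. fib b = {}"
proof (rule ccontr)
  assume "\<nexists>b. fib b = {}"
  then have ne: "\<And>b. fib b \<noteq> {}" by blast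
  let ?I = "{0..pi / 2} \<times> {0..2 * pi}"
  obtain F where F: "continuous_on (Sigma ?I fib) F"
    and expF: "\<And>b z. b \<in> ?I \<Longrightarrow> z \<in> fib b \<Longrightarrow> exp (F (b, z)) = coeff b z"
    using has_log_rectangle[OF ne, of 0 "pi / 2" 0 "2 * pi"] unfolding has_log_def by auto
  obtain z0 where z0: "z0 \<in> fib (0, 0)" using ne by blast
  \<comment> \<open>At latitude 0 neither fibre nor coefficient depends on the longitude, so the
    logarithm is constant.\<close>
  have z0': "z0 \<in> fib (0, t)" for t using z0 by (simp add: fib_def v_def)
  have c0: "coeff (0, t) z0 = cform a1 (z0 - q)" for t by (simp add: coeff_def)
  have "continuous_on {0..2 * pi} (\<lambda>t. F ((0, t), z0))"
    by (rule continuous_on_compose2[OF F]) (use z0' in \<open>auto intro!: continuous_intros\<close>)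
  then have F0: "F ((0, 2 * pi), z0) = F ((0, 0), z0)"
    using exp_constant_imp_constant[of "{0..2 * pi}" "\<lambda>t. F ((0, t), z0)" "cform a1 (z0 - q)" "2 * pi" 0]
      expF z0' c0 by auto
  obtain z1 where z1: "z1 \<in> fib (pi / 2, 0)" using ne by blast
  have z1': "z1 \<in> fib (pi / 2, t)" for t
  proof -
    from z1 obtain x c where x: "x \<in> V" "z1 = q + x + c *s u" "z1 \<in> \<Omega>" by (auto simp: fib_def v_def)
    moreover have "c *s u = (c * cis (- t)) *s v (pi / 2, t)"
      by (simp add: v_def cis_mult mult.assoc)
    ultimately show ?thesis unfolding fib_def by auto
  qed
  \<comment> \<open>At latitude \<open>pi / 2\<close> the coefficient rotates by
    \<open>exp (- \<i> * t)\<close>; adding \<open>\<i> * t\<close> to its logarithm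
    compensates.\<close>
  have c1: "exp (\<i> * t) * coeff (pi / 2, t) z1 = cform a2 (z1 - q)" for t
    by (simp add: coeff_def cis_conv_exp flip: exp_add mult.assoc)
  have "continuous_on {0..2 * pi} (\<lambda>t. \<i> * t + F ((pi / 2, t), z1))"
    by (intro continuous_intros continuous_on_compose2[OF F]) (use z1' in \<open>auto intro!: continuous_intros\<close>)
  then have F1: "\<i> * (2 * pi) + F ((pi / 2, 2 * pi), z1) = \<i> * 0 + F ((pi / 2, 0), z1)"
    using exp_constant_imp_constant[of "{0..2 * pi}" "\<lambda>t. \<i> * t + F ((pi / 2, t), z1)" "cform a2 (z1 - q)" "2 * pi" 0]
      expF z1' c1 by (auto simp: exp_add)
  have per: "fib (r, 2 * pi) = fib (r, 0)" "coeff (r, 2 * pi) z = coeff (r, 0) z" for r z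
    by (auto simp: fib_def v_def coeff_def simp flip: cis_cnj)
  let ?J = "{0..pi / 2} \<times> {0::real}"
  \<comment> \<open>Longitudes 0 and \<open>2 * pi\<close> give the same fibres and coefficients, so
    this difference is a logarithm of 1, hence constant in the latitude; \<open>F0\<close> and
    \<open>F1\<close> give it different values at the two ends.\<close>
  let ?\<Phi> = "\<lambda>y. F ((fst (fst y), 2 * pi), snd y) - F y"
  have "continuous_on (Sigma ?J fib) ?\<Phi>"
    by (intro continuous_intros continuous_on_compose2[OF F] continuous_on_subset[OF F])
      (use per(1) in \<open>auto intro!: continuous_intros\<close>)
  moreover have "exp (?\<Phi> (b, z)) = 1" if "b \<in> ?J" "z \<in> fib b" for b z
    using that expF[of "(fst b, 2 * pi)" z] expF[of b z] per coeff_nonzero by (auto simp: exp_diff)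
  ultimately have "?\<Phi> ((0, 0), z0) = ?\<Phi> ((pi / 2, 0), z1)"
    using constant_over_connected[of ?J ?\<Phi> 1 "(0, 0)" z0 "(pi / 2, 0)" z1] ne z0 z1
    by (simp add: connected_Times)
  then have "\<i> * (2 * complex_of_real pi) = 0" using F0 F1 by (simp add: algebra_simps)
  then show False by simp
qed

end

section \<open>Maximal subspaces missing the domain\<close>

lemma functional_exists:
  fixes V :: "(complex ^ 'n) set"
  assumes "vec.subspace V" "p \<notin> V"
  obtains a where "cform a p = 1" "\<And>x. x \<in> V \<Longrightarrow> cform a x = 0"
proof -
  obtain B where B: "B \<subseteq> V" "vec.independent B" "V \<subseteq> vec.span B"
    using vec.maximal_independent_subset[of V] by blast
  have "vec.span B \<subseteq> V" using vec.span_minimal[OF B(1) assms(1)] .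
  then have p: "p \<notin> vec.span B" using assms(2) by blast
  \<comment> \<open>The functional is the \<open>k\<close>-th coordinate of a linear map that kills
    \<open>B\<close> and sends \<open>p\<close> to the \<open>k\<close>-th unit vector; any index
    will do.\<close>
  fix k :: 'n
  have "\<exists>g. Vector_Spaces.linear (*s) (*s) g \<and> (\<forall>x\<in>insert p B. g x = (if x = p then axis k 1 else (0 :: complex ^ 'n)))"
    by (rule vec.linear_independent_extend[OF vec.independent_insertI[OF p B(2)]])
  then obtain g where g: "Vector_Spaces.linear (*s) (*s) g" "g p = axis k 1"
    "\<And>x. x \<in> B \<Longrightarrow> g x = (if x = p then axis k 1 else (0 :: complex ^ 'n))" by auto
  define a where "a = (\<chi> j. g (axis j 1) $ k)"
  have a: "cform a x = g x $ k" for x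
  proof -
    have "g x $ k = (matrix g *v x) $ k" using matrix_works[OF g(1)] by simp
    then show ?thesis by (simp add: a_def cform_def matrix_def matrix_vector_mult_def)
  qed
  have "vec.subspace {x. cform a x = 0}" by (rule vec.subspaceI) auto
  moreover have "x \<noteq> p" if "x \<in> B" for x using that p vec.span_base by blast
  then have "B \<subseteq> {x. cform a x = 0}" using g(3) by (auto simp: a)
  ultimately have "V \<subseteq> {x. cform a x = 0}" using B(3) vec.span_minimal by blast
  moreover have "cform a p = 1" by (simp add: a g)
  ultimately show ?thesis using that by blast
qed

text \<open>A maximal complex affine subspace through \<open>q\<close> missing \<open>\<Omega>\<close> is a hyperplane.\<close>

theorem C_convex_imp_linearly_convex:
  fixes \<Omega> :: "(complex ^ 'n) set"
  assumes C: "C_convex_domain \<Omega>" and q: "q \<notin> \<Omega>"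
  obtains a where "\<And>z. z \<in> \<Omega> \<Longrightarrow> cform a z \<noteq> cform a q"
proof -
  let ?P = "\<lambda>V. vec.subspace V \<and> (\<forall>x\<in>V. q + x \<notin> \<Omega>)"
  have "?P {0}" using q vec.subspace_single_0 by auto
  moreover have "\<forall>V. ?P V \<longrightarrow> vec.dim V < CARD('n) + 1"
    using dim_subset_UNIV_cart_gen by (auto simp: less_Suc_eq_le)
  ultimately have "\<exists>V. ?P V \<and> (\<forall>V'. ?P V' \<longrightarrow> vec.dim V' \<le> vec.dim V)"
    by (rule ex_has_greatest_nat)
  then obtain V where V: "vec.subspace V" "\<forall>x\<in>V. q + x \<notin> \<Omega>"
    and max: "\<forall>V'. ?P V' \<longrightarrow> vec.dim V' \<le> vec.dim V"
    by (elim exE conjE)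
  have sp: "vec.span V = V" using V(1) by (simp add: vec.span_eq_iff)
  obtain z0 where "z0 \<in> \<Omega>" using C by (auto simp: C_convex_domain_def domain_in_def)
  define p where "p = z0 - q"
  have p: "p \<notin> V" using V(2) \<open>z0 \<in> \<Omega>\<close> by (auto simp: p_def)
  \<comment> \<open>Otherwise a plane is left to sweep: an empty fibre over \<open>b\<close> means
    that adding \<open>v b\<close> to \<open>V\<close> still misses \<Omega>, against
    maximality.\<close>
  have all: "u \<in> vec.span (insert p V)" for u
  proof (rule ccontr)
    assume u: "u \<notin> vec.span (insert p V)"
    then have p': "p \<notin> vec.span (insert u V)" using vec.in_span_insert[of p u V] p sp by auto
    obtain a1 where a1: "cform a1 p = 1" "\<And>x. x \<in> vec.span (insert u V) \<Longrightarrow> cform a1 x = 0"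
      using functional_exists[OF vec.subspace_span p'] by blast
    obtain a2 where a2: "cform a2 u = 1" "\<And>x. x \<in> vec.span (insert p V) \<Longrightarrow> cform a2 x = 0"
      using functional_exists[OF vec.subspace_span u] by blast
    interpret swept_plane \<Omega> V q p u a1 a2
      by unfold_locales (use C V a1 a2 in \<open>auto intro: vec.span_base\<close>)
    obtain b where b: "fib b = {}" using some_fibre_empty by blast
    have "v b \<notin> V"
    proof
      assume "v b \<in> V"
      then have "cform a1 (v b) = 0" "cform a2 (v b) = 0"
        using swept_plane.a1(3)[OF swept_plane_axioms] swept_plane.a2(3)[OF swept_plane_axioms] by auto
      then have "cos (fst b) = 0" "sin (fst b) = 0"
        using swept_plane.a1(1,2)[OF swept_plane_axioms] swept_plane.a2(1,2)[OF swept_plane_axioms]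
        by (simp_all add: v_def)
      then show False using sin_cos_squared_add[of "fst b"] by simp
    qed
    then have "v b \<notin> vec.span V" by (simp only: sp not_False_eq_True)
    then have "vec.dim (vec.span (insert (v b) V)) = vec.dim V + 1"
      by (simp add: vec.dim_insert)
    moreover have "?P (vec.span (insert (v b) V))"
    proof (intro conjI ballI)
      fix x assume "x \<in> vec.span (insert (v b) V)"
      then obtain c where "x - c *s v b \<in> V" using sp vec.span_breakdown_eq by metis
      moreover have "q + x = q + (x - c *s v b) + c *s v b" by simp
      ultimately show "q + x \<notin> \<Omega>" using b unfolding fib_def by blast
    qed (rule vec.subspace_span)
    ultimately show False using max by fastforce
  qed
  obtain a where a: "cform a p = 1" "\<And>x. x \<in> V \<Longrightarrow> cform a x = 0" using functional_exists[OF V(1) p] by blast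
  show ?thesis
  proof (rule that)
    fix z assume z: "z \<in> \<Omega>"
    obtain c where c: "(z - q) - c *s p \<in> V" using all[of "z - q"] sp vec.span_breakdown_eq by metis
    have "c \<noteq> 0" using c V(2) z by force
    moreover have "cform a (z - q) = c" using a(2)[OF c] a(1) by simp
    ultimately show "cform a z \<noteq> cform a q" by auto
  qed
qed

section \<open>Cusps along the hyperplanes\<close>

lemma complex_hyperplane_alt: "complex_hyperplane H \<longleftrightarrow> (\<exists>a b. a \<noteq> 0 \<and> H = {z. cform a z = b})"
  by (simp add: complex_hyperplane_def cform_def)

lemma finite_affine_solutions: "x \<noteq> b \<or> y \<noteq> 0 \<Longrightarrow> finite {c :: complex. x + c * y = b}"
proof (cases "y = 0")
  case False
  then have "{c. x + c * y = b} \<subseteq> {(b - x) / y}" by (auto simp: field_simps)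
  then show ?thesis using finite_subset by blast
qed auto

lemma finite_line_Int_hyperplane:
  assumes "complex_hyperplane H" "p \<notin> H"
  shows "finite {c. p + c *s y \<in> H}"
proof -
  obtain a b where "H = {z. cform a z = b}" using assms(1) complex_hyperplane_alt by metis
  then show ?thesis using finite_affine_solutions[of "cform a p" b "cform a y"] assms(2) by simp
qed

lemma closed_complex_hyperplane: "complex_hyperplane H \<Longrightarrow> closed H"
  unfolding complex_hyperplane_alt by (auto intro!: closed_Collect_eq continuous_intros)

text \<open>A removed point of \<Omega> is separated by the functional of its own hyperplane. For
  connectedness, the complex line through two points of the complement meets each hyperplane
  finitely often, and finitely many points do not disconnect an open connected plane set.\<close>

lemma linearly_convex_domain_complement:
  fixes \<Omega> :: "(complex ^ 'n) set"
  assumes C: "C_convex_domain \<Omega>" and "bounded \<Omega>" "finite \<S>"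
    and hyp: "\<And>H. H \<in> \<S> \<Longrightarrow> complex_hyperplane H"
  shows "linearly_convex_domain (\<Omega> - \<Union>\<S>)"
proof
  have op: "open \<Omega>" using C by (simp add: C_convex_domain_def domain_in_def)
  show "open (\<Omega> - \<Union>\<S>)"
    by (intro open_Diff op closed_Union) (use assms(3) hyp closed_complex_hyperplane in auto)
  show "bounded (\<Omega> - \<Union>\<S>)" using assms(2) bounded_subset by blast
  show "\<exists>a. \<forall>z\<in>\<Omega> - \<Union>\<S>. cform a z \<noteq> cform a q" if qG: "q \<notin> \<Omega> - \<Union>\<S>" for q
  proof (cases "q \<in> \<Omega>")
    case True
    then obtain H where H: "H \<in> \<S>" "q \<in> H" using qG by blast
    obtain a b where "H = {z. cform a z = b}" using hyp[OF H(1)] complex_hyperplane_alt by metis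
    then show ?thesis using H by (intro exI[of _ a]) auto
  next
    case False
    then show ?thesis using C_convex_imp_linearly_convex[OF C False] by (metis DiffD1)
  qed
  show "connected (\<Omega> - \<Union>\<S>)"
    unfolding connected_iff_connected_component
  proof (intro ballI)
    fix p q assume pq: "p \<in> \<Omega> - \<Union>\<S>" "q \<in> \<Omega> - \<Union>\<S>"
    define y where "y = q - p"
    have py: "p + 1 *s y = q" by (simp add: y_def)
    let ?A = "{c. p + c *s y \<in> \<Omega>}" and ?F = "\<Union>H\<in>\<S>. {c. p + c *s y \<in> H}"
    have "finite ?F" using pq by (intro finite_UN_I assms(3) finite_line_Int_hyperplane hyp) auto
    then have "connected (?A - ?F)"
      using connected_open_delete_finite[OF C_convex_slice(1,2)[OF C]] by auto
    moreover have "continuous_on (?A - ?F) (\<lambda>c. p + c *s y)" by (intro continuous_intros)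
    ultimately have "connected ((\<lambda>c. p + c *s y) ` (?A - ?F))" using connected_continuous_image by blast
    moreover have "(\<lambda>c. p + c *s y) ` (?A - ?F) \<subseteq> \<Omega> - \<Union>\<S>" by auto
    moreover have "p \<in> (\<lambda>c. p + c *s y) ` (?A - ?F)" using pq by (intro image_eqI[of _ _ 0]) auto
    moreover have "q \<in> (\<lambda>c. p + c *s y) ` (?A - ?F)" using pq py by (intro image_eqI[of _ _ 1]) auto
    ultimately show "connected_component (\<Omega> - \<Union>\<S>) p q" unfolding connected_component_def by blast
  qed
qed

text \<open>The kernel of \<open>a\<close> is not a finite union of proper subspaces. In the
  induction step \<open>w\<close> is moved along a vector on which the new functional does not
  vanish, avoiding finitely many bad multiples.\<close>

lemma transversal_direction:
  fixes a :: "complex ^ 'n"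
  assumes "CARD('n) \<ge> 2" "a \<noteq> 0" "finite F"
  shows "\<exists>w. w \<noteq> 0 \<and> cform a w = 0 \<and> (\<forall>f\<in>F. (\<exists>y. cform a y = 0 \<and> cform f y \<noteq> 0) \<longrightarrow> cform f w \<noteq> 0)"
  using assms(3)
proof (induction F rule: finite_induct)
  case empty
  obtain i where i: "a $ i \<noteq> 0" using assms(2) by (auto simp: vec_eq_iff)
  obtain j where j: "j \<noteq> i"
  proof -
    have "(UNIV :: 'n set) \<noteq> {i}" using assms(1) by (metis One_nat_def card.empty card_insert_disjoint empty_iff finite.emptyI not_less_eq_eq numeral_2_eq_2 order_refl)
    then show ?thesis using that by blast
  qed
  define w where "w = axis j (a $ i) - axis i (a $ j)"
  have "w $ j = a $ i" using j by (simp add: w_def axis_def)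
  then have "w \<noteq> 0" using i by auto
  moreover have "cform a w = 0" by (simp add: w_def)
  ultimately show ?case by blast
next
  case (insert f F)
  then obtain w where w: "w \<noteq> 0" "cform a w = 0"
    "\<And>g. g \<in> F \<Longrightarrow> \<exists>y. cform a y = 0 \<and> cform g y \<noteq> 0 \<Longrightarrow> cform g w \<noteq> 0" by blast
  show ?case
  proof (cases "(\<exists>y. cform a y = 0 \<and> cform f y \<noteq> 0) \<and> cform f w = 0")
    case False
    then show ?thesis using w by blast
  next
    case True
    then obtain y where y: "cform a y = 0" "cform f y \<noteq> 0" and fw: "cform f w = 0" by blast
    have "finite (insert 0 (\<Union>g\<in>{g \<in> F. cform g w \<noteq> 0}. {c. cform g w + c * cform g y = 0}))" (is "finite ?B")
      using insert(1) by (auto intro!: finite_affine_solutions)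
    then obtain t where t: "t \<notin> ?B" using ex_new_if_finite[OF infinite_UNIV_char_0] by blast
    have "cform f (w + t *s y) \<noteq> 0" using fw y t by simp
    moreover from this have "w + t *s y \<noteq> 0" by (metis cform_zero)
    moreover have "cform a (w + t *s y) = 0" using w y by simp
    moreover have "cform g (w + t *s y) \<noteq> 0" if "g \<in> F" "\<exists>y. cform a y = 0 \<and> cform g y \<noteq> 0" for g
      using w(3)[OF that] t that(1) by force
    ultimately show ?thesis by blast
  qed
qed

text \<open>The kernel of a functional has codimension at most one, so it is not properly contained
  in that of a non-zero functional.\<close>

lemma hyperplane_eq_if_kernel_subset:
  assumes "a' \<noteq> 0" "cform a p = b" "cform a' p = b'"
    and "\<And>y. cform a y = 0 \<Longrightarrow> cform a' y = 0"
  shows "{z. cform a z = b} = {z. cform a' z = b'}"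
proof -
  have "cform a y = 0" if y: "cform a' y = 0" for y
  proof (rule ccontr)
    assume ne: "cform a y \<noteq> 0"
    have "cform a' x = 0" for x
      using assms(4)[of "x - (cform a x / cform a y) *s y"] y ne by simp
    then have "a' $ i = 0" for i by (metis cform_axis_right mult.right_neutral)
    then show False using assms(1) by (simp add: vec_eq_iff)
  qed
  then have "cform a y = 0 \<longleftrightarrow> cform a' y = 0" for y using assms(4) by blast
  from this[of "_ - p"] show ?thesis using assms(2,3) by auto
qed

text \<open>If the line lay in \<open>H'\<close>, the choice of \<open>w\<close> would make the
  functional of \<open>H'\<close> vanish on the kernel of \<open>a\<close>, so \<open>H'\<close>
  would be \<open>H\<close>.\<close>

lemma transversal_line:
  fixes \<S> :: "(complex ^ 'n) set set"
  assumes "CARD('n) \<ge> 2" "finite \<S>" and hyp: "\<And>H. H \<in> \<S> \<Longrightarrow> complex_hyperplane H"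
    and H: "H \<in> \<S>" "H = {z. cform a z = b}" "a \<noteq> 0" "p \<in> H"
  obtains w where "w \<noteq> 0" "cform a w = 0" "\<And>H'. H' \<in> \<S> - {H} \<Longrightarrow> finite {c. p + c *s w \<in> H'}"
proof -
  obtain f \<beta> where f: "\<And>H. H \<in> \<S> \<Longrightarrow> f H \<noteq> 0 \<and> H = {z. cform (f H) z = \<beta> H}"
    using hyp unfolding complex_hyperplane_alt by metis
  obtain w where w: "w \<noteq> 0" "cform a w = 0"
    "\<And>g. g \<in> f ` \<S> \<Longrightarrow> \<exists>y. cform a y = 0 \<and> cform g y \<noteq> 0 \<Longrightarrow> cform g w \<noteq> 0"
    using transversal_direction[OF assms(1) H(3) finite_imageI[OF assms(2), of f]] by blast
  show ?thesis
  proof (rule that[OF w(1,2)])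
    fix H' assume H': "H' \<in> \<S> - {H}"
    have "cform (f H') p \<noteq> \<beta> H' \<or> cform (f H') w \<noteq> 0"
    proof (rule ccontr)
      assume "\<not> ?thesis"
      then have "cform (f H') p = \<beta> H'" "\<And>y. cform a y = 0 \<Longrightarrow> cform (f H') y = 0" using w(3) H' by blast+
      then have "{z. cform a z = b} = {z. cform (f H') z = \<beta> H'}"
        using hyperplane_eq_if_kernel_subset[of "f H'" a p b] f H' H by blast
      then show False using f[of H'] H' H(2) by blast
    qed
    then have "finite {c. cform (f H') p + c * cform (f H') w = \<beta> H'}" by (rule finite_affine_solutions)
    moreover have "z \<in> H' \<longleftrightarrow> cform (f H') z = \<beta> H'" for z using f[of H'] H' by blast
    ultimately show "finite {c. p + c *s w \<in> H'}" by simp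
  qed
qed

section \<open>Rays running into a cusp\<close>

lemma scaleR_eq_smult: "r *\<^sub>R (x :: complex ^ 'n) = complex_of_real r *s x"
  by (simp add: vec_eq_iff scaleR_conv_of_real[where 'a = complex])

text \<open>The curve below is the image of a unit speed geodesic of the punctured disc running into
  the puncture; \<open>\<zeta> \<mapsto> exp (- E (1 + \<zeta>) / (1 - \<zeta>))\<close> is the universal covering of the punctured disc.\<close>

lemma kobayashi_metric_cusp_le:
  assumes "\<And>x. x \<noteq> 0 \<Longrightarrow> cmod x < 1 \<Longrightarrow> Q + x *s e \<in> G"
  shows "kobayashi_metric G (Q + exp (- exp (2 * t)) *\<^sub>R e)
      ((l * (- 2 * exp (2 * t) * exp (- exp (2 * t)))) *\<^sub>R e) \<le> \<bar>l\<bar>"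
proof -
  define E where "E = exp (2 * t)"
  have E: "E > 0" by (simp add: E_def)
  define \<phi> where "\<phi> \<zeta> = exp (- complex_of_real E * ((1 + \<zeta>) / (1 - \<zeta>)))" for \<zeta>
  have hol: "\<phi> holomorphic_on ball 0 1" unfolding \<phi>_def by (intro holomorphic_intros) auto
  have lt1: "cmod (\<phi> \<zeta>) < 1" if \<zeta>: "cmod \<zeta> < 1" for \<zeta>
  proof -
    have ne: "1 - \<zeta> \<noteq> 0" using \<zeta> by auto
    have "(1 + \<zeta>) / (1 - \<zeta>) = (1 + \<zeta>) * cnj (1 - \<zeta>) / of_real ((cmod (1 - \<zeta>))\<^sup>2)"
      by (subst complex_div_cnj) simp
    moreover have "Re ((1 + \<zeta>) * cnj (1 - \<zeta>)) = 1 - (cmod \<zeta>)\<^sup>2"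
      by (simp add: cmod_power2) (simp add: power2_eq_square algebra_simps)
    ultimately have "Re ((1 + \<zeta>) / (1 - \<zeta>)) = (1 - (cmod \<zeta>)\<^sup>2) / (cmod (1 - \<zeta>))\<^sup>2"
      by (simp only: Re_divide_of_real)
    moreover have "(cmod \<zeta>)\<^sup>2 < 1" using \<zeta> by (simp add: power_less_one_iff)
    ultimately have "Re ((1 + \<zeta>) / (1 - \<zeta>)) > 0" using ne by simp
    then have "Re (- complex_of_real E * ((1 + \<zeta>) / (1 - \<zeta>))) < 0"
      using E by (simp only: Re_complex_of_real Im_complex_of_real times_complex.sel uminus_complex.sel) simp
    then show ?thesis by (simp only: \<phi>_def norm_exp_eq_Re exp_less_one_iff)
  qed
  let ?f = "\<lambda>\<zeta>. Q + \<phi> \<zeta> *s e"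
  \<comment> \<open>This equals the derivative of \<open>exp (- exp (2 * t))\<close> in
    \<open>t\<close>, which is why the curve has speed at most 1 and \<open>l\<close> is a
    reparametrisation factor.\<close>
  have d\<phi>: "(\<phi> has_field_derivative - 2 * E * exp (- E)) (at 0)"
    unfolding \<phi>_def by (auto intro!: derivative_eq_intros simp flip: exp_of_real)
  have "(\<chi> i. deriv (\<lambda>\<zeta>. ?f \<zeta> $ i) 0) = complex_of_real (- 2 * E * exp (- E)) *s e"
  proof -
    have "((\<lambda>\<zeta>. ?f \<zeta> $ i) has_field_derivative complex_of_real (- 2 * E * exp (- E)) * e $ i) (at 0)" for i
      using d\<phi> by (auto intro!: derivative_eq_intros)
    then show ?thesis by (simp add: vec_eq_iff DERIV_imp_deriv)
  qed
  then have "complex_of_real l *s (\<chi> i. deriv (\<lambda>\<zeta>. ?f \<zeta> $ i) 0) = (l * (- 2 * E * exp (- E))) *\<^sub>R e"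
    by (simp add: vec_eq_iff scaleR_conv_of_real[where 'a = complex] exp_of_real)
  moreover have "holomorphic_disc ?f G"
    unfolding holomorphic_disc_def
    using hol assms lt1 by (auto intro!: holomorphic_intros simp: \<phi>_def)
  moreover have "?f 0 = Q + exp (- E) *\<^sub>R e"
    by (simp add: \<phi>_def vec_eq_iff scaleR_conv_of_real[where 'a = complex] exp_of_real exp_minus)
  ultimately have "kobayashi_metric G (Q + exp (- E) *\<^sub>R e) ((l * (- 2 * E * exp (- E))) *\<^sub>R e) \<le> cmod (complex_of_real l)"
    by (intro kobayashi_metric_le)
  then show ?thesis by (simp add: E_def)
qed

lemma ekd_cusp_le:
  assumes "open G" and disc: "\<And>x. x \<noteq> 0 \<Longrightarrow> cmod x < 1 \<Longrightarrow> Q + x *s e \<in> G" and "s \<le> t"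
  shows "ekd G (Q + exp (- exp (2 * s)) *\<^sub>R e) (Q + exp (- exp (2 * t)) *\<^sub>R e) \<le> ennreal (t - s)"
proof -
  define \<tau> where "\<tau> x = s + (t - s) * x" for x
  define \<alpha> where "\<alpha> x = Q + exp (- exp (2 * \<tau> x)) *\<^sub>R e" for x
  define D where "D x = ((t - s) * (- 2 * exp (2 * \<tau> x) * exp (- exp (2 * \<tau> x)))) *\<^sub>R e" for x
  have "ekd G (\<alpha> 0) (\<alpha> 1) \<le> ennreal (t - s)"
  proof (rule ekd_le_of_speed[OF assms(1)])
    show "continuous_on {0..1} D" unfolding D_def \<tau>_def by (intro continuous_intros)
    show "\<alpha> ` {0..1} \<subseteq> G"
    proof
      fix z assume "z \<in> \<alpha> ` {0..1}"
      then obtain x where "z = \<alpha> x" by blast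
      then have "z = Q + complex_of_real (exp (- exp (2 * \<tau> x))) *s e"
        by (simp add: \<alpha>_def scaleR_eq_smult)
      then show "z \<in> G" using disc by simp
    qed
    fix x :: real assume "x \<in> {0..1}"
    have "((\<lambda>x. exp (- exp (2 * \<tau> x))) has_real_derivative
        (t - s) * (- 2 * exp (2 * \<tau> x) * exp (- exp (2 * \<tau> x)))) (at x within {0..1})"
      unfolding \<tau>_def by (auto intro!: derivative_eq_intros)
    then have "((\<lambda>x. exp (- exp (2 * \<tau> x)) *\<^sub>R e) has_vector_derivative D x) (at x within {0..1})"
      unfolding D_def has_real_derivative_iff_has_vector_derivative
      by (rule bounded_linear.has_vector_derivative[OF bounded_linear_scaleR_left])
    from has_vector_derivative_add[OF has_vector_derivative_const this]
    show "(\<alpha> has_vector_derivative D x) (at x within {0..1})"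
      unfolding \<alpha>_def by simp
    show "kobayashi_metric G (\<alpha> x) (D x) \<le> t - s"
      unfolding \<alpha>_def D_def using kobayashi_metric_cusp_le[OF disc, where l = "t - s"] assms(3) by simp
  qed
  then show ?thesis by (simp add: \<alpha>_def \<tau>_def)
qed

text \<open>The height is \<open>ln (ln (R / k) + exp (2 * t)) / 2\<close>. The first summand is
  between 0 and the second, so it adds at most \<open>ln 2 / 2\<close> to \<open>t\<close>.\<close>

lemma cusp_height_cusp:
  assumes "cform a Q = b" "cform a e = complex_of_real k" "0 < k" "k \<le> R" "ln (R / k) \<le> exp (2 * t)"
  shows "t \<le> cusp_height a b R (Q + exp (- exp (2 * t)) *\<^sub>R e)"
    "cusp_height a b R (Q + exp (- exp (2 * t)) *\<^sub>R e) \<le> t + 1"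
proof -
  let ?E = "exp (2 * t)"
  let ?L = "ln (R / k)"
  have L: "0 \<le> ?L" using assms(3,4) by simp
  have "cmod (cform a (Q + exp (- ?E) *\<^sub>R e) - b) = exp (- ?E) * k"
    using assms(1-3) by (simp add: norm_mult)
  moreover have "ln (R / (exp (- ?E) * k)) = ?L + ?E"
    using assms(3,4) by (simp add: ln_div ln_mult)
  ultimately have h: "cusp_height a b R (Q + exp (- ?E) *\<^sub>R e) = ln (?L + ?E) / 2"
    by (simp add: cusp_height_def)
  have "2 * t = ln ?E" by simp
  also have "\<dots> \<le> ln (?L + ?E)" using L by (subst ln_le_cancel_iff) (auto intro: add_nonneg_pos)
  finally show "t \<le> cusp_height a b R (Q + exp (- ?E) *\<^sub>R e)" by (simp add: h)
  have "ln (?L + ?E) \<le> ln (2 * ?E)" using L assms(5) by (subst ln_le_cancel_iff) (auto intro: add_nonneg_pos)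
  also have "\<dots> = ln 2 + 2 * t" by (simp add: ln_mult)
  also have "\<dots> \<le> 2 + 2 * t" using ln_2_less_1 by simp
  finally show "cusp_height a b R (Q + exp (- ?E) *\<^sub>R e) \<le> t + 1" by (simp add: h)
qed

lemma isCont_near_on_ray:
  fixes h :: "complex ^ 'n \<Rightarrow> real"
  assumes "isCont h Q"
  obtains \<epsilon> where "\<epsilon> > 0" "\<And>s. 0 < s \<Longrightarrow> s < \<epsilon> \<Longrightarrow> \<bar>h (Q + s *\<^sub>R e) - h Q\<bar> < 1 / 2"
proof -
  obtain \<delta> where \<delta>: "\<delta> > 0" "\<And>x. dist x Q < \<delta> \<Longrightarrow> dist (h x) (h Q) < 1 / 2"
    using assms unfolding continuous_at_eps_delta by (metis half_gt_zero zero_less_one)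
  show ?thesis
  proof (rule that[of "\<delta> / (norm e + 1)"])
    show "\<delta> / (norm e + 1) > 0" using \<delta>(1) by (simp add: add_nonneg_pos)
    fix s :: real assume s: "0 < s" "s < \<delta> / (norm e + 1)"
    have "s * norm e \<le> s * (norm e + 1)" using s by simp
    also have "\<dots> < \<delta>" using s by (simp add: pos_less_divide_eq add_nonneg_pos)
    finally show "\<bar>h (Q + s *\<^sub>R e) - h Q\<bar> < 1 / 2"
      using \<delta>(2)[of "Q + s *\<^sub>R e"] s by (simp add: dist_norm)
  qed
qed

lemma isCont_cusp_height:
  assumes "cform a Q \<noteq> b" "cmod (cform a Q - b) < R"
  shows "isCont (cusp_height a b R) Q"
proof -
  have "R / cmod (cform a Q - b) > 1" using assms by simp
  then have "ln (R / cmod (cform a Q - b)) > 0" by (rule ln_gt_zero)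
  moreover have "R > 0" by (rule le_less_trans[OF norm_ge_zero assms(2)])
  ultimately show ?thesis unfolding cusp_height_def
    using assms by (intro continuous_intros bounded_linear.isCont[OF bounded_linear_cform]) auto
qed

lemma exp_minus_exp_eventually_small:
  assumes "\<epsilon> > 0"
  obtains t0 where "0 \<le> t0" "\<And>t. t0 \<le> t \<Longrightarrow> exp (- exp (2 * t)) < (\<epsilon> :: real)" "\<And>t. t0 \<le> t \<Longrightarrow> L \<le> exp (2 * t)"
proof (rule that[of "max 0 (max L (1 - ln \<epsilon>))"])
  fix t assume "max 0 (max L (1 - ln \<epsilon>)) \<le> t"
  then have t: "0 \<le> t" "L \<le> t" "1 - ln \<epsilon> \<le> t" by auto
  have "t < exp (2 * t)" using exp_ge_add_one_self[of "2 * t"] t(1) by linarith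
  show "L \<le> exp (2 * t)" "exp (- exp (2 * t)) < \<epsilon>"
  proof -
    show "L \<le> exp (2 * t)" using t(2) \<open>t < exp (2 * t)\<close> by simp
    have "exp (- exp (2 * t)) < exp (ln \<epsilon>)" using t(3) \<open>t < exp (2 * t)\<close> by (subst exp_less_cancel_iff) linarith
    then show "exp (- exp (2 * t)) < \<epsilon>" using assms by simp
  qed
qed auto

theorem corollary1p4:
  fixes \<Omega> :: "(complex ^ 'n) set" and \<S> :: "(complex ^ 'n) set set"
  assumes "CARD('n) \<ge> 2"
    and "C_convex_domain \<Omega>" and "bounded \<Omega>"
    and "finite \<S>" and "\<S> \<noteq> {}"
    and "\<And>H. H \<in> \<S> \<Longrightarrow> complex_hyperplane H \<and> H \<inter> \<Omega> \<noteq> {}"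
  shows "\<not> Gromov_hyperbolic (\<Omega> - \<Union>\<S>) (kobayashi_dist (\<Omega> - \<Union>\<S>))"
proof
  let ?G = "\<Omega> - \<Union>\<S>"
  assume "Gromov_hyperbolic ?G (kobayashi_dist ?G)"
  then obtain M where M: "M > 0"
    and thin: "\<And>A B C. geodesic_triangle ?G (kobayashi_dist ?G) A B C \<Longrightarrow> thin_triangle (kobayashi_dist ?G) M A B C"
    unfolding Gromov_hyperbolic_def by blast
  interpret linearly_convex_domain ?G
    by (rule linearly_convex_domain_complement) (use assms in auto)
  interpret thin_geodesic_space ?G d M
    by unfold_locales (use geodesic_exists thin M in auto)
  have op: "open \<Omega>" using assms(2) by (simp add: C_convex_domain_def domain_in_def)
  obtain H where H: "H \<in> \<S>" using assms(5) by blast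
  obtain a b where ab: "a \<noteq> 0" "H = {z. cform a z = b}" using assms(6)[OF H] complex_hyperplane_alt by metis
  obtain p where p: "p \<in> H" "p \<in> \<Omega>" using assms(6)[OF H] by blast
  obtain w where w: "w \<noteq> 0" "cform a w = 0" "\<And>H'. H' \<in> \<S> - {H} \<Longrightarrow> finite {c. p + c *s w \<in> H'}"
    using transversal_line[OF assms(1,4) _ H ab(2,1) p(1)] assms(6) by blast
  \<comment> \<open>Near a point of \<open>U\<close> on \<open>H\<close>, only \<open>H\<close> has
    been removed.\<close>
  define U where "U = \<Omega> - \<Union>(\<S> - {H})"
  have opU: "open U" unfolding U_def
    by (intro open_Diff op closed_Union) (use assms closed_complex_hyperplane in auto)
  have G_eq: "?G = U - H" using H by (auto simp: U_def)
  define Q where "Q c = p + c *s w" for c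
  have aQ: "cform a (Q c) = b" for c using p(1) ab(2) w(2) by (simp add: Q_def)
  define A where "A = {c. Q c \<in> \<Omega>}"
  define F where "F = (\<Union>H'\<in>\<S> - {H}. {c. Q c \<in> H'})"
  have A: "open A" "connected A" unfolding A_def Q_def by (rule C_convex_slice[OF assms(2)])+
  have "finite F" unfolding F_def Q_def using assms(4) w(3) by (intro finite_UN_I) auto
  have AF: "open (A - F)" "connected (A - F)"
    using A \<open>finite F\<close> by (auto intro: open_Diff finite_imp_closed connected_open_delete_finite)
  have QU: "Q c \<in> U" if "c \<in> A - F" for c using that by (auto simp: A_def F_def U_def)
  have avoid: "S - F \<noteq> {}" if "open S" "S \<noteq> {}" for S
    using that \<open>finite F\<close> finite_imp_not_open[of S] by (metis Diff_eq_empty_iff finite_subset)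
  have "0 \<in> A" using p by (simp add: A_def Q_def)
  then obtain c1 where c1: "c1 \<in> A - F" using avoid A(1) by blast
  obtain i where i: "a $ i \<noteq> 0" using ab(1) by (auto simp: vec_eq_iff)
  \<comment> \<open>A direction transversal to \<open>H\<close>, normalised so that
    \<open>cform a\<close> exceeds \<open>b\<close> by exactly \<open>s\<close> at
    \<open>Q c + s *\<^sub>R e\<close>.\<close>
  define e where "e = axis i (1 / a $ i)"
  have ae: "cform a e = 1" using i by (simp add: e_def)
  have near_H: "cform a (Q c + complex_of_real s *s e) = b + s" for c s by (simp add: aQ ae)

  \<comment> \<open>The rays over \<open>c\<close> and \<open>c'\<close> stay at bounded distance.
    This is an equivalence relation, so it suffices to verify it locally on the connected set
    \<open>A - F\<close>.\<close>
  define R where "R c c' \<longleftrightarrow> (\<exists>B\<ge>0. \<exists>\<epsilon>>0. \<forall>s. 0 < s \<and> s < \<epsilon> \<longrightarrow>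
      ekd ?G (Q c + s *\<^sub>R e) (Q c' + s *\<^sub>R e) \<le> ennreal B)" for c c'
  have R: "R c c'" if "c \<in> A - F" "c' \<in> A - F" for c c'
  proof (rule connected_equivalence_relation[OF AF(2) that])
    fix x y z
    show "R x y \<Longrightarrow> R y x" unfolding R_def using ekd_sym[OF open_G] by metis
    assume "R x y" "R y z"
    then obtain B \<epsilon> B' \<epsilon>' where B: "B \<ge> 0" "\<epsilon> > 0" "B' \<ge> 0" "\<epsilon>' > 0"
      "\<And>s. 0 < s \<Longrightarrow> s < \<epsilon> \<Longrightarrow> ekd ?G (Q x + s *\<^sub>R e) (Q y + s *\<^sub>R e) \<le> ennreal B"
      "\<And>s. 0 < s \<Longrightarrow> s < \<epsilon>' \<Longrightarrow> ekd ?G (Q y + s *\<^sub>R e) (Q z + s *\<^sub>R e) \<le> ennreal B'"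
      unfolding R_def by metis
    have "ekd ?G (Q x + s *\<^sub>R e) (Q z + s *\<^sub>R e) \<le> ennreal (B + B')" if "0 < s" "s < min \<epsilon> \<epsilon>'" for s
      using order_trans[OF ekd_triangle[OF open_G] add_mono[OF B(5) B(6)]] that B(1,3) by (simp add: ennreal_plus)
    then show "R x z" unfolding R_def using B by (intro exI[of _ "B + B'"] conjI exI[of _ "min \<epsilon> \<epsilon>'"]) auto
  next
    fix x assume x: "x \<in> A - F"
    obtain \<rho>' where "\<rho>' > 0" "ball (Q x) \<rho>' \<subseteq> U" using QU[OF x] opU open_contains_ball by blast
    \<comment> \<open>Of the radius \<open>3 * \<rho>\<close>, the discs parallel to
      \<open>H\<close> use \<open>2 * \<rho>\<close> and the height above \<open>H\<close> uses
      \<open>\<rho>\<close>.\<close>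
    define \<rho> where "\<rho> = \<rho>' / 3"
    have \<rho>: "\<rho> > 0" "ball (Q x) (3 * \<rho>) \<subseteq> U" using \<open>\<rho>' > 0\<close> \<open>ball (Q x) \<rho>' \<subseteq> U\<close> by (auto simp: \<rho>_def)
    define \<delta> where "\<delta> = \<rho> / norm w"
    define \<epsilon> where "\<epsilon> = \<rho> / (norm e + 1)"
    have \<delta>\<epsilon>: "\<delta> > 0" "\<epsilon> > 0" using \<rho> w(1) by (auto simp: \<delta>_def \<epsilon>_def add_nonneg_pos)
    have "R x y" if y: "y \<in> ball x \<delta>" for y
    proof -
      have yx: "cmod (y - x) * norm w < \<rho>" using y w(1) by (simp add: \<delta>_def dist_norm norm_minus_commute pos_less_divide_eq)
      have "ekd ?G (Q x + s *\<^sub>R e) (Q y + s *\<^sub>R e) \<le> ennreal (1 / 1)" if s: "0 < s" "s < \<epsilon>" for s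
      proof (rule ekd_le_segment[OF open_G])
        fix t :: real and \<zeta> :: complex assume t: "t \<in> {0..1}" and \<zeta>: "cmod \<zeta> < 1"
        define c where "c = (complex_of_real t + complex_of_real 1 * \<zeta>) * (y - x)"
        \<comment> \<open>The whole disc stays in the parallel hyperplane at height
          \<open>s\<close>, so it misses \<open>H\<close> and the bound is independent of
          \<open>s\<close>.\<close>
        have eq: "Q x + s *\<^sub>R e + (complex_of_real t + complex_of_real 1 * \<zeta>) *s (Q y + s *\<^sub>R e - (Q x + s *\<^sub>R e))
            = Q (x + c) + complex_of_real s *s e"
          by (simp add: c_def Q_def vec_eq_iff scaleR_eq_smult algebra_simps)
        have "cmod (complex_of_real t + complex_of_real 1 * \<zeta>) \<le> 2"
          using norm_triangle_ineq[of "complex_of_real t" "\<zeta>"] t \<zeta> by simp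
        then have "cmod c * norm w \<le> 2 * (cmod (y - x) * norm w)"
          by (simp add: c_def norm_mult mult_right_mono mult.assoc)
        moreover have "s * norm e \<le> s * (norm e + 1)" "s * (norm e + 1) < \<rho>"
          using s by (simp_all add: \<epsilon>_def pos_less_divide_eq add_nonneg_pos)
        moreover have "norm (c *s w + complex_of_real s *s e) \<le> cmod c * norm w + s * norm e"
          using norm_triangle_ineq[of "c *s w" "complex_of_real s *s e"] s by (simp add: norm_smult)
        ultimately have "norm (c *s w + complex_of_real s *s e) < 3 * \<rho>" using yx by linarith
        moreover have "dist (Q x) (Q x + Y) = norm Y" for Y by (simp add: dist_norm)
        ultimately have "Q x + (c *s w + complex_of_real s *s e) \<in> ball (Q x) (3 * \<rho>)"
          by (simp only: mem_ball)
        moreover have "Q x + (c *s w + complex_of_real s *s e) = Q (x + c) + complex_of_real s *s e"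
          by (simp add: Q_def vec_eq_iff algebra_simps)
        ultimately have "Q (x + c) + complex_of_real s *s e \<in> U" using \<rho>(2) by auto
        moreover have "Q (x + c) + complex_of_real s *s e \<notin> H" using near_H s ab(2) by auto
        ultimately show "Q x + s *\<^sub>R e + (complex_of_real t + complex_of_real 1 * \<zeta>) *s (Q y + s *\<^sub>R e - (Q x + s *\<^sub>R e)) \<in> ?G"
          unfolding eq G_eq by blast
      qed simp
      then show ?thesis unfolding R_def using \<delta>\<epsilon> by (intro exI[of _ 1] conjI exI[of _ \<epsilon>]) auto
    qed
    then show "\<exists>T. openin (top_of_set (A - F)) T \<and> x \<in> T \<and> (\<forall>y\<in>T. R x y)"
      using x \<delta>\<epsilon> by (intro exI[of _ "(A - F) \<inter> ball x \<delta>"]) (auto intro: openin_open_Int)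
  qed

  have "A \<noteq> UNIV"
  proof
    assume "A = UNIV"
    obtain B where B: "\<And>z. z \<in> \<Omega> \<Longrightarrow> norm z \<le> B" using assms(3) unfolding bounded_iff by blast
    obtain j where j: "w $ j \<noteq> 0" using w(1) by (auto simp: vec_eq_iff)
    \<comment> \<open>At this parameter the \<open>j\<close>-th coordinate is
      \<open>B + 1\<close>.\<close>
    have "Q ((complex_of_real (B + 1) - p $ j) / w $ j) \<in> \<Omega>" using \<open>A = UNIV\<close> by (auto simp: A_def)
    then have "norm (Q ((complex_of_real (B + 1) - p $ j) / w $ j) $ j) \<le> B"
      using B by (intro order_trans[OF Finite_Cartesian_Product.norm_nth_le])
    then have "cmod (complex_of_real (B + 1)) \<le> B" using j by (simp add: Q_def)
    then show False by (simp only: norm_of_real)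
  qed
  then obtain c0 where c0: "c0 \<in> frontier A" using \<open>0 \<in> A\<close> frontier_eq_empty by (metis empty_iff equals0I)
  then have c0A: "c0 \<in> closure A" "c0 \<notin> A" using A(1) by (auto simp: frontier_def interior_open)
  define q where "q = Q c0"
  have "q \<notin> \<Omega>" using c0A by (simp add: q_def A_def)
  then obtain a' where a': "\<And>z. z \<in> \<Omega> \<Longrightarrow> cform a' z \<noteq> cform a' q"
    using C_convex_imp_linearly_convex[OF assms(2)] by blast
  define b' where "b' = cform a' q"
  obtain R' where R': "0 < R'" "\<And>z. z \<in> \<Omega> \<Longrightarrow> cmod (cform a' z - b') < R'" using bounded_cform[OF assms(3)] by metis
  define h where "h = cusp_height a' b' R'"
  have hd: "\<bar>h y - h x\<bar> \<le> d x y" if "x \<in> ?G" "y \<in> ?G" for x y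
    unfolding h_def by (rule cusp_height_le_d) (use a' R' that in \<open>auto simp: b'_def\<close>)
  \<comment> \<open>Continuity on all of \<Omega>, including its points on \<open>H\<close>: near
    the cusp over \<open>Q c\<close> the value of \<open>h\<close> is almost
    \<open>h (Q c)\<close>.\<close>
  have hcont: "isCont h z" if "z \<in> \<Omega>" for z
    unfolding h_def by (rule isCont_cusp_height) (use a' R' that in \<open>auto simp: b'_def\<close>)
  \<comment> \<open>\<open>8 * M + 4\<close> from \<open>asymptotic_rays_close\<close>, 1 for the
    variation of \<open>h\<close> by less than 1/2 on each ray, and 1 to spare.\<close>
  define K where "K = h (Q c1) + 8 * M + 6"
  \<comment> \<open>Height \<open>K\<close> means modulus \<open>R' * exp (- exp (2 * K))\<close>,
    and on the line the modulus is \<open>cmod (c - c0)\<close> times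
    \<open>cmod (cform a' w)\<close>. The \<open>+ 1\<close> keeps the denominator positive.\<close>
  define \<eta> where "\<eta> = R' * exp (- exp (2 * K)) / (cmod (cform a' w) + 1)"
  have \<eta>: "\<eta> > 0" using R'(1) by (simp add: \<eta>_def add_nonneg_pos)
  obtain y where "y \<in> A" "dist y c0 < \<eta>"
    using c0A(1) \<eta> unfolding closure_approachable by blast
  then have "ball c0 \<eta> \<inter> A \<noteq> {}" by (auto simp: dist_commute)
  then have "ball c0 \<eta> \<inter> A - F \<noteq> {}" using A(1) by (intro avoid open_Int open_ball)
  then obtain c2 where "c2 \<in> ball c0 \<eta> \<inter> A - F" by blast
  then have c2: "c2 \<in> A - F" "dist c2 c0 < \<eta>" by (auto simp: dist_commute)
  have "K \<le> h (Q c2)"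
  proof -
    have Q2: "Q c2 \<in> \<Omega>" using c2 by (simp add: A_def)
    have pos: "cmod (cform a' (Q c2) - b') > 0" using a'[OF Q2] by (simp add: b'_def)
    have "cform a' (Q c2) - b' = (c2 - c0) * cform a' w" by (simp add: b'_def q_def Q_def algebra_simps)
    then have "cmod (cform a' (Q c2) - b') = cmod (c2 - c0) * cmod (cform a' w)" by (simp only: norm_mult)
    also have "\<dots> \<le> \<eta> * (cmod (cform a' w) + 1)" using c2(2) \<eta> by (intro mult_mono) (auto simp: dist_norm)
    also have "\<dots> = R' * exp (- exp (2 * K))" using add_nonneg_pos[OF norm_ge_zero zero_less_one, of "cform a' w"] by (simp add: \<eta>_def less_imp_neq[symmetric])
    finally have "exp (exp (2 * K)) \<le> R' / cmod (cform a' (Q c2) - b')"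
      using pos by (simp add: pos_le_divide_eq exp_minus field_simps)
    then have "exp (2 * K) \<le> ln (R' / cmod (cform a' (Q c2) - b'))"
      by (metis exp_gt_zero less_le_trans ln_ge_iff)
    then have "2 * K \<le> ln (ln (R' / cmod (cform a' (Q c2) - b')))"
      by (metis exp_gt_zero less_le_trans ln_ge_iff)
    then show ?thesis by (simp add: h_def cusp_height_def)
  qed

  obtain \<rho>1 where \<rho>1: "\<rho>1 > 0" "ball (Q c1) \<rho>1 \<subseteq> U" using QU[OF c1] opU open_contains_ball by blast
  obtain \<rho>2 where \<rho>2: "\<rho>2 > 0" "ball (Q c2) \<rho>2 \<subseteq> U" using QU[OF c2(1)] opU open_contains_ball by blast
  \<comment> \<open>One scale for both base points, so that the two rays have equal height at equal
    times.\<close>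
  define k where "k = min \<rho>1 \<rho>2 / (norm e + 1)"
  have k: "k > 0" using \<rho>1 \<rho>2 by (simp add: k_def add_nonneg_pos)
  have disc: "Q c + x *s (k *\<^sub>R e) \<in> ?G" if "c \<in> {c1, c2}" "x \<noteq> 0" "cmod x < 1" for c x
  proof -
    have "norm (x *s (k *\<^sub>R e)) \<le> 1 * (k * norm e)"
      unfolding norm_smult using that k by (intro mult_mono) auto
    also have "\<dots> < k * (norm e + 1)" using k by simp
    also have "\<dots> = min \<rho>1 \<rho>2" using add_nonneg_pos[OF norm_ge_zero zero_less_one, of e] by (simp add: k_def less_imp_neq[symmetric])
    finally have "Q c + x *s (k *\<^sub>R e) \<in> U" using that(1) \<rho>1(2) \<rho>2(2) by (auto simp: subset_iff dist_norm)
    moreover have "cform a (Q c + x *s (k *\<^sub>R e)) \<noteq> b" using that k by (simp add: aQ ae)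
    ultimately show ?thesis unfolding G_eq ab(2) by blast
  qed
  obtain R1 where "0 < R1" "\<And>z. z \<in> \<Omega> \<Longrightarrow> cmod (cform a z - b) < R1" using bounded_cform[OF assms(3)] by metis
  \<comment> \<open>\<open>R2\<close> must also dominate \<open>k\<close>, as
    \<open>cusp_height_cusp\<close> requires.\<close>
  then obtain R2 where R2: "k \<le> R2" "\<And>z. z \<in> ?G \<Longrightarrow> cform a z \<noteq> b \<and> cmod (cform a z - b) < R2"
    using that[of "max k R1"] ab(2) H by (force simp: less_max_iff_disj)
  obtain B \<epsilon> where B: "B \<ge> 0" "\<epsilon> > 0"
    "\<And>s. 0 < s \<Longrightarrow> s < \<epsilon> \<Longrightarrow> ekd ?G (Q c1 + s *\<^sub>R e) (Q c2 + s *\<^sub>R e) \<le> ennreal B"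
    using R[OF c1 c2(1)] unfolding R_def by metis
  obtain \<epsilon>1 where \<epsilon>1: "\<epsilon>1 > 0" "\<And>s. 0 < s \<Longrightarrow> s < \<epsilon>1 \<Longrightarrow> \<bar>h (Q c1 + s *\<^sub>R e) - h (Q c1)\<bar> < 1 / 2"
    using isCont_near_on_ray[OF hcont[of "Q c1"]] c1 by (auto simp: A_def)
  obtain \<epsilon>2 where \<epsilon>2: "\<epsilon>2 > 0" "\<And>s. 0 < s \<Longrightarrow> s < \<epsilon>2 \<Longrightarrow> \<bar>h (Q c2 + s *\<^sub>R e) - h (Q c2)\<bar> < 1 / 2"
    using isCont_near_on_ray[OF hcont[of "Q c2"]] c2 by (auto simp: A_def)
  \<comment> \<open>From \<open>t0\<close> on the rays are low enough for the three local estimates,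
    and their \<open>cusp_height\<close> along \<open>H\<close> agrees with the parameter up to
    1.\<close>
  obtain t0 where t0: "0 \<le> t0" "\<And>t. t0 \<le> t \<Longrightarrow> exp (- exp (2 * t)) < min \<epsilon> (min \<epsilon>1 \<epsilon>2) / k"
      "\<And>t. t0 \<le> t \<Longrightarrow> ln (R2 / k) \<le> exp (2 * t)"
    using exp_minus_exp_eventually_small[of "min \<epsilon> (min \<epsilon>1 \<epsilon>2) / k" "ln (R2 / k)"] B(2) \<epsilon>1(1) \<epsilon>2(1) k by auto
  define V where "V c t = Q c + exp (- exp (2 * t)) *\<^sub>R (k *\<^sub>R e)" for c t
  define s where "s t = exp (- exp (2 * t)) * k" for t
  have V_s: "V c t = Q c + s t *\<^sub>R e" for c t by (simp add: V_def s_def)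
  have s: "0 < s t" "s t < \<epsilon>" "s t < \<epsilon>1" "s t < \<epsilon>2" if "t0 \<le> t" for t
    using t0(2)[OF that] k by (auto simp: s_def pos_less_divide_eq)
  have VG: "V c t \<in> ?G" if "c \<in> {c1, c2}" for c t
  proof -
    have "V c t = Q c + complex_of_real (exp (- exp (2 * t))) *s (k *\<^sub>R e)"
      unfolding V_def by (simp only: scaleR_eq_smult[of "exp (- exp (2 * t))"])
    then show ?thesis using disc[OF that, of "complex_of_real (exp (- exp (2 * t)))"] by simp
  qed
  have Vd: "t - r - 1 \<le> d (V c r) (V c t) \<and> d (V c r) (V c t) \<le> t - r"
    if c: "c \<in> {c1, c2}" and rt: "t0 \<le> r" "r \<le> t" for c r t
  proof
    have "ekd ?G (V c r) (V c t) \<le> ennreal (t - r)"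
      unfolding V_def by (rule ekd_cusp_le[OF open_G disc[OF c] rt(2)])
    then show "d (V c r) (V c t) \<le> t - r" using VG[OF c] rt by (intro d_le) auto
    have ake: "cform a (k *\<^sub>R e) = complex_of_real k" by (simp add: ae scaleR_conv_of_real[where 'a = complex])
    have "t \<le> cusp_height a b R2 (V c t)" "cusp_height a b R2 (V c r) \<le> r + 1"
      unfolding V_def using cusp_height_cusp[OF aQ ake k R2(1)] t0(3) rt by auto
    moreover have "\<bar>cusp_height a b R2 (V c t) - cusp_height a b R2 (V c r)\<bar> \<le> d (V c r) (V c t)"
      by (rule cusp_height_le_d[OF R2(2) VG[OF c] VG[OF c]])
    ultimately show "t - r - 1 \<le> d (V c r) (V c t)" by linarith
  qed
  have "\<exists>r\<ge>t0. \<exists>t\<ge>t0. d (V c1 r) (V c2 t) \<le> 8 * M + 4"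
  proof (rule asymptotic_rays_close)
    show "d (V c1 t) (V c2 t) \<le> B" if "t0 \<le> t" for t
      using B(3)[OF s(1,2)[OF that]] VG B(1) by (intro d_le) (auto simp: V_s)
  qed (use VG Vd in auto)
  then obtain r t where rt: "t0 \<le> r" "t0 \<le> t" "d (V c1 r) (V c2 t) \<le> 8 * M + 4" by blast
  have "\<bar>h (V c1 r) - h (Q c1)\<bar> < 1 / 2" "\<bar>h (V c2 t) - h (Q c2)\<bar> < 1 / 2"
    using \<epsilon>1(2) \<epsilon>2(2) s rt by (auto simp: V_s)
  moreover have "\<bar>h (V c2 t) - h (V c1 r)\<bar> \<le> d (V c1 r) (V c2 t)" using hd VG by simp
  ultimately show False using rt(3) \<open>K \<le> h (Q c2)\<close> unfolding K_def by linarith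
qed

end
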